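(* Let $0\le d\le n$ be integers. The space $\mathbb{P}\underline{\mathrm{L}}^d_n$ of all multiaffine Lorentzian polynomials $f\in\mathrm{H}^d_n$ with $f(1,\ldots,1)=1$ (with the Euclidean topology on coefficients) is homeomorphic to a closed Euclidean ball.
   Context: $\mathrm{H}^d_n$ denotes the real vector space of homogeneous polynomials of degree $d$ in $\mathbb{R}[w_1,\ldots,w_n]$ together with the zero polynomial. A polynomial is multiaffine if it has degree at most one in each variable. For $d\ge 2$, $f\in \mathrm{H}^d_n$ is strictly Lorentzian if all its coefficients (of all degree-$d$ monomials) are positive and for all $1\le i_1,\ldots,i_{d-2}\le n$ the quadratic form $\partial_{i_1}\cdots\partial_{i_{d-2}} f$ has signature $(+,-,\ldots,-)$. For $d\in\{0,1\}$, $f$ is strictly Lorentzian if all its coefficients are positive. A polynomial in $\mathrm{H}^d_n$ is Lorentzian if it is a coefficientwise limit of strictly Lorentzian polynomials. A closed Euclidean ball of dimension $0$ is a point. *)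

theory Defs
  imports
    "HOL-Analysis.Analysis"
    "HOL-Library.Poly_Mapping"
    "Jordan_Normal_Form.Matrix"
begin

text \<open>
  A monomial is a finitely supported exponent function, and a polynomial maps monomials to real
  coefficients with finite support.  The variables \<open>w\<^sub>1, \<dots>, w\<^sub>n\<close> of the mathematical notation
  are indexed by \<open>0, \<dots>, n - 1\<close>; that a polynomial involves no others is part of \<open>homogeneous\<close>.
\<close>

type_synonym monomial = "nat \<Rightarrow>\<^sub>0 nat"
type_synonym mpoly = "monomial \<Rightarrow>\<^sub>0 real"

definition monomials :: "nat \<Rightarrow> nat \<Rightarrow> monomial set" where
  "monomials d n =
     {m. Poly_Mapping.keys m \<subseteq> {..<n} \<and> (\<Sum>i\<in>Poly_Mapping.keys m. Poly_Mapping.lookup m i) = d}"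

definition homogeneous :: "nat \<Rightarrow> nat \<Rightarrow> mpoly set" where
  "homogeneous d n = {f. Poly_Mapping.keys f \<subseteq> monomials d n}"

definition multiaffine :: "mpoly \<Rightarrow> bool" where
  "multiaffine f \<longleftrightarrow> (\<forall>m\<in>Poly_Mapping.keys f. \<forall>i. Poly_Mapping.lookup m i \<le> 1)"

definition eval_mpoly :: "mpoly \<Rightarrow> (nat \<Rightarrow> real) \<Rightarrow> real" where
  "eval_mpoly f x =
     (\<Sum>m\<in>Poly_Mapping.keys f.
        Poly_Mapping.lookup f m * (\<Prod>i\<in>Poly_Mapping.keys m. x i ^ Poly_Mapping.lookup m i))"

text \<open>
  The subtraction of exponents is truncated, but it only truncates where the exponent of the
  \<open>i\<close>-th variable is zero, and there the coefficient vanishes.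
\<close>

definition partial_deriv :: "nat \<Rightarrow> mpoly \<Rightarrow> mpoly" where
  "partial_deriv i f =
     (\<Sum>m\<in>Poly_Mapping.keys f.
        Poly_Mapping.single (m - Poly_Mapping.single i 1)
          (real (Poly_Mapping.lookup m i) * Poly_Mapping.lookup f m))"

lemma lookup_partial_deriv:
  "Poly_Mapping.lookup (partial_deriv i f) m =
     real (Poly_Mapping.lookup m i + 1) * Poly_Mapping.lookup f (m + Poly_Mapping.single i 1)"
proof -
  let ?e = "Poly_Mapping.single i (1::nat)"
  have shift: "k = m + ?e" if "k - ?e = m" "Poly_Mapping.lookup k i \<noteq> 0" for k
  proof (rule poly_mapping_eqI)
    fix j
    have "Poly_Mapping.lookup m j = Poly_Mapping.lookup k j - Poly_Mapping.lookup ?e j"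
      using that(1) by (metis lookup_minus)
    then show "Poly_Mapping.lookup k j = Poly_Mapping.lookup (m + ?e) j"
      using that(2) by (cases "i = j") (auto simp: lookup_add lookup_single)
  qed
  have "Poly_Mapping.lookup (partial_deriv i f) m =
      (\<Sum>k\<in>Poly_Mapping.keys f.
         if k = m + ?e then real (Poly_Mapping.lookup k i) * Poly_Mapping.lookup f k else 0)"
    unfolding partial_deriv_def lookup_sum
  proof (intro sum.cong refl)
    fix k
    show "Poly_Mapping.lookup (Poly_Mapping.single (k - ?e)
            (real (Poly_Mapping.lookup k i) * Poly_Mapping.lookup f k)) m =
          (if k = m + ?e then real (Poly_Mapping.lookup k i) * Poly_Mapping.lookup f k else 0)"
    proof (cases "Poly_Mapping.lookup k i = 0")
      case False
      then have "k - ?e = m \<longleftrightarrow> k = m + ?e"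
        using shift[of k] by auto
      then show ?thesis
        by (simp add: lookup_single when_def)
    qed auto
  qed
  also have "\<dots> =
      real (Poly_Mapping.lookup m i + 1) * Poly_Mapping.lookup f (m + ?e)"
    by (simp add: lookup_add in_keys_iff)
  finally show ?thesis .
qed

text \<open>
  The quadratic form \<open>q\<close> on \<open>\<real>\<^sup>n\<close> has signature with \<open>p\<close> plus signs and \<open>m\<close> minus signs
  (hence \<open>n - p - m\<close> zeros) if an invertible linear change of coordinates brings it to
  \<open>y\<^sub>1\<^sup>2 + \<dots> + y\<^sub>p\<^sup>2 - y\<^sub>p\<^sub>+\<^sub>1\<^sup>2 - \<dots> - y\<^sub>p\<^sub>+\<^sub>m\<^sup>2\<close>.
\<close>

definition has_signature :: "nat \<Rightarrow> mpoly \<Rightarrow> nat \<Rightarrow> nat \<Rightarrow> bool" where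
  "has_signature n q p m \<longleftrightarrow>
     p + m \<le> n \<and>
     (\<exists>A\<in>carrier_mat n n. invertible_mat A \<and>
        (\<forall>y\<in>carrier_vec n.
           eval_mpoly q (vec_index (A *\<^sub>v y)) =
             (\<Sum>i<p. (vec_index y i)\<^sup>2) - (\<Sum>i=p..<p + m. (vec_index y i)\<^sup>2)))"

definition strictly_Lorentzian :: "nat \<Rightarrow> nat \<Rightarrow> mpoly \<Rightarrow> bool" where
  "strictly_Lorentzian d n f \<longleftrightarrow>
     f \<in> homogeneous d n \<and>
     (\<forall>m\<in>monomials d n. Poly_Mapping.lookup f m > 0) \<and>
     (d \<ge> 2 \<longrightarrow>
        (\<forall>is. length is = d - 2 \<and> set is \<subseteq> {..<n} \<longrightarrow>
           has_signature n (foldr partial_deriv is f) 1 (n - 1)))"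

definition Lorentzian :: "nat \<Rightarrow> nat \<Rightarrow> mpoly \<Rightarrow> bool" where
  "Lorentzian d n f \<longleftrightarrow>
     f \<in> homogeneous d n \<and>
     (\<exists>g :: nat \<Rightarrow> mpoly.
        (\<forall>k. strictly_Lorentzian d n (g k)) \<and>
        (\<forall>m. (\<lambda>k. Poly_Mapping.lookup (g k) m) \<longlonglongrightarrow> Poly_Mapping.lookup f m))"

definition PL_set :: "nat \<Rightarrow> nat \<Rightarrow> mpoly set" where
  "PL_set d n = {f. Lorentzian d n f \<and> multiaffine f \<and> eval_mpoly f (\<lambda>_. 1) = 1}"

text \<open>
  The topology of coefficientwise convergence.  On \<open>homogeneous d n\<close> only the finitely many
  coefficients at \<open>monomials d n\<close> can be nonzero, so there this is the Euclidean topology.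
\<close>

definition coeff_topology :: "mpoly topology" where
  "coeff_topology = pullback_topology UNIV Poly_Mapping.lookup (powertop_real UNIV)"

definition PL_space :: "nat \<Rightarrow> nat \<Rightarrow> mpoly topology" where
  "PL_space d n = subtopology coeff_topology (PL_set d n)"

definition closed_unit_ball :: "nat \<Rightarrow> (nat \<Rightarrow> real) topology" where
  "closed_unit_ball k = subtopology (Euclidean_space k) {x. (\<Sum>i<k. (x i)\<^sup>2) \<le> 1}"

end

theory Submission
  imports Defs
begin

text \<open>
  Under the symmetric exclusion process, a multiaffine polynomial moves along the linear flow whose
  generator sums \<open>\<sigma> f - f\<close> over all transpositions \<open>\<sigma>\<close> of the variables.  Normalised multiaffine
  polynomials are contracted towards the elementary symmetric polynomial, and the
  quadratic forms that express the strict Lorentzian condition stay nondegenerate: if one of them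
  acquired a kernel vector, its value on this vector would have a negative derivative, so it would have
  been positive shortly before.  Hence the flow maps the closure of the strict polynomials into this open
  set at once, and in a diagonalising basis, after a substitution by signed powers, this closure is
  star-shaped about an interior point.

  The multiaffine Lorentzian polynomials are this closure: the multiaffine part of a strictly Lorentzian
  polynomial is strict in the multiaffine sense, and conversely the substitution
  \<open>w\<^sub>j \<mapsto> w\<^sub>j + \<epsilon> (w\<^sub>1 + \<dots> + w\<^sub>n)\<close> makes a strict multiaffine polynomial strictly Lorentzian.
\<close>

section \<open>Quadratic forms of hyperbolic signature\<close>

text \<open>What replaces it is a pair of conditions on each quadratic form:
  \<open>hyperbolic\<close> is open, by a spectral gap, and \<open>weak_hyperbolic\<close> is closed
  under limits; a form of positive total that satisfies only the second has a kernel vector.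

  On a kernel vector y of the form at A, the derivative along the flow splits into one term per
  transposition of a and b. If both lie in A, the term is 0. If both lie outside, it is minus a
  square times a coefficient. If exactly one lies in A, the moved y is orthogonal to an isotropic
  coordinate vector of another form, and weak hyperbolicity of that form gives the sign. This is why
  the forms at all A have to be followed together.

  The eigenvalues of the generator may differ, so its flow is no uniform scaling; the powers 1/rate
  equalise the rates. The dimension of the ball is the number of eigenvectors on the zero-sum
  functions. For d < 2 there are no quadratic conditions, and if there is only one d-subset, there
  are no eigenvectors and the ball is a point.\<close>

definition bform :: "'b set \<Rightarrow> ('b \<Rightarrow> 'b \<Rightarrow> real) \<Rightarrow> ('b \<Rightarrow> real) \<Rightarrow> ('b \<Rightarrow> real) \<Rightarrow> real" where
  "bform I M x y = (\<Sum>i\<in>I. \<Sum>j\<in>I. M i j * x i * y j)"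

definition sym_on :: "'b set \<Rightarrow> ('b \<Rightarrow> 'b \<Rightarrow> real) \<Rightarrow> bool" where
  "sym_on I M \<longleftrightarrow> (\<forall>i\<in>I. \<forall>j\<in>I. M i j = M j i)"

text \<open>Signature (+,-,...,-) on the functions on \<open>I\<close>, witnessed by a vector
  \<open>u\<close> of positive value whose orthogonal complement is negative definite. Carrying a
  witness avoids counting eigenvalues; it is usually the all-ones vector, whose value stays positive
  for positive coefficients.\<close>

definition hyperbolic :: "'b set \<Rightarrow> ('b \<Rightarrow> 'b \<Rightarrow> real) \<Rightarrow> ('b \<Rightarrow> real) \<Rightarrow> bool" where
  "hyperbolic I M u \<longleftrightarrow> 0 < bform I M u u \<and>
     (\<forall>x. (\<exists>i\<in>I. x i \<noteq> 0) \<longrightarrow> bform I M u x = 0 \<longrightarrow> bform I M x x < 0)"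

text \<open>The reverse Cauchy-Schwarz inequality against the all-ones vector. As a non-strict
  inequality it passes to limits, in which \<open>hyperbolic\<close> may be lost.\<close>

definition weak_hyperbolic :: "'b set \<Rightarrow> ('b \<Rightarrow> 'b \<Rightarrow> real) \<Rightarrow> bool" where
  "weak_hyperbolic I M \<longleftrightarrow>
     (\<forall>x. bform I M (\<lambda>_. 1) (\<lambda>_. 1) * bform I M x x \<le> (bform I M (\<lambda>_. 1) x)\<^sup>2)"

lemma bform_cong:
  assumes "\<And>i j. i \<in> I \<Longrightarrow> j \<in> I \<Longrightarrow> M i j = M' i j" "\<And>i. i \<in> I \<Longrightarrow> x i = x' i"
    "\<And>i. i \<in> I \<Longrightarrow> y i = y' i"
  shows "bform I M x y = bform I M' x' y'"
  unfolding bform_def using assms by (auto intro!: sum.cong)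

lemma bform_commute: "sym_on I M \<Longrightarrow> bform I M x y = bform I M y x"
  unfolding bform_def sym_on_def by (subst sum.swap) (auto intro!: sum.cong)

lemma bform_lincomb_right: "bform I M x (\<lambda>i. a * y i + b * z i) = a * bform I M x y + b * bform I M x z"
  unfolding bform_def by (simp add: algebra_simps sum.distrib sum_distrib_left)

lemma bform_lincomb_left: "bform I M (\<lambda>i. a * y i + b * z i) x = a * bform I M y x + b * bform I M z x"
  unfolding bform_def by (simp add: algebra_simps sum.distrib sum_distrib_left)

lemma bform_lincomb:
  assumes "sym_on I M"
  shows "bform I M (\<lambda>i. a * x i + b * y i) (\<lambda>i. a * x i + b * y i) =
    a\<^sup>2 * bform I M x x + 2 * a * b * bform I M x y + b\<^sup>2 * bform I M y y"
  using bform_commute[OF assms, of x y]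
  by (simp add: bform_lincomb_left bform_lincomb_right power2_eq_square algebra_simps)

lemma bform_scale_right: "bform I M x (\<lambda>i. a * y i) = a * bform I M x y"
  using bform_lincomb_right[of I M x a y 0 y] by simp

lemma bform_scale_left: "bform I M (\<lambda>i. a * y i) x = a * bform I M y x"
  using bform_lincomb_left[of I M a y 0 y x] by simp

lemma bform_rows: "bform I M x y = (\<Sum>i\<in>I. x i * (\<Sum>j\<in>I. M i j * y j))"
  unfolding bform_def by (simp add: sum_distrib_left algebra_simps)

lemma bform_unit_left:
  assumes "finite I" "k \<in> I"
  shows "bform I M (\<lambda>i. if i = k then 1 else 0) x = (\<Sum>j\<in>I. M k j * x j)"
proof -
  have "bform I M (\<lambda>i. if i = k then 1 else 0) x
      = (\<Sum>i\<in>I. if i = k then (\<Sum>j\<in>I. M i j * x j) else 0)"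
    unfolding bform_rows by (intro sum.cong) auto
  then show ?thesis using assms by simp
qed

lemma hypD:
  assumes "hyperbolic I M u" "\<exists>i\<in>I. x i \<noteq> 0" "bform I M u x = 0"
  shows "bform I M x x < 0"
  using assms unfolding hyperbolic_def by blast

lemma hyperbolic_cong:
  assumes "\<And>i j. i \<in> I \<Longrightarrow> j \<in> I \<Longrightarrow> M i j = M' i j"
  shows "hyperbolic I M u \<longleftrightarrow> hyperbolic I M' u"
proof -
  have "bform I M = bform I M'" by (intro ext bform_cong assms) auto
  then show ?thesis unfolding hyperbolic_def by simp
qed

text \<open>For x orthogonal to \<open>v\<close>, the combination of x and \<open>v\<close> that is
  orthogonal to \<open>u\<close> has nonpositive value. This value is a positive multiple of that of
  x plus a nonnegative multiple of that of \<open>v\<close>, without mixed term.\<close>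

lemma hyperbolic_change_reference:
  assumes sym: "sym_on I M" and h: "hyperbolic I M u" and p: "0 < bform I M v v"
  shows "hyperbolic I M v"
  unfolding hyperbolic_def
proof (intro conjI allI impI p)
  fix x assume nz: "\<exists>i\<in>I. x i \<noteq> 0" and 0: "bform I M v x = 0"
  have nzv: "\<exists>i\<in>I. v i \<noteq> 0"
  proof (rule ccontr)
    assume "\<not> ?thesis"
    then have "bform I M v v = bform I M (\<lambda>i. 0) (\<lambda>_. 0)" by (intro bform_cong) auto
    then show False using p by (simp add: bform_def)
  qed
  have uv: "bform I M u v \<noteq> 0"
    using h nzv p unfolding hyperbolic_def by force
  show "bform I M x x < 0"
  proof (cases "bform I M u x = 0")
    case True
    then show ?thesis using h nz unfolding hyperbolic_def by blast
  next
    case False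
    define y where "y = (\<lambda>i. bform I M u v * x i + (- bform I M u x) * v i)"
    have "bform I M u y = 0" unfolding y_def bform_lincomb_right by simp
    then have "bform I M y y \<le> 0"
      using h unfolding hyperbolic_def bform_rows
      by (cases "\<exists>i\<in>I. y i \<noteq> 0") (force simp: less_imp_le)+
    then have "(bform I M u v)\<^sup>2 * bform I M x x + (bform I M u x)\<^sup>2 * bform I M v v \<le> 0"
      unfolding y_def bform_lincomb[OF sym] using 0 bform_commute[OF sym, of x v] by simp
    moreover have "0 < (bform I M u x)\<^sup>2 * bform I M v v" using False p by simp
    ultimately have "(bform I M u v)\<^sup>2 * bform I M x x < 0" by linarith
    then show ?thesis by (simp add: mult_less_0_iff)
  qed
qed

text \<open>The component of x orthogonal to \<open>u\<close> has nonpositive value; it is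
  multiplied by the value of \<open>u\<close> to avoid a division.\<close>

lemma hyperbolic_reverse_Cauchy_Schwarz:
  assumes sym: "sym_on I M" and h: "hyperbolic I M u"
  shows "bform I M u u * bform I M x x \<le> (bform I M u x)\<^sup>2"
proof -
  let ?T = "bform I M u u" and ?r = "bform I M u x"
  have T: "?T > 0" using h hyperbolic_def by blast
  define y where "y = (\<lambda>i. ?T * x i + (- ?r) * u i)"
  have 0: "bform I M u y = 0"
    unfolding y_def bform_lincomb_right by simp
  then have "bform I M y y \<le> 0"
    using h unfolding hyperbolic_def bform_rows
    by (cases "\<exists>i\<in>I. y i \<noteq> 0") (force simp: less_imp_le)+
  moreover have "bform I M y y = ?T\<^sup>2 * bform I M x x - ?T * ?r\<^sup>2"
    using bform_lincomb[OF sym, of ?T x "- ?r" u] bform_commute[OF sym, of x u]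
    unfolding y_def by (simp add: power2_eq_square algebra_simps)
  ultimately have "?T * (?T * bform I M x x - ?r\<^sup>2) \<le> 0"
    by (simp add: power2_eq_square algebra_simps)
  then show "?T * bform I M x x \<le> ?r\<^sup>2" using T by (simp add: mult_le_0_iff)
qed

lemma hyperbolic_imp_weak:
  "sym_on I M \<Longrightarrow> hyperbolic I M (\<lambda>_. 1) \<Longrightarrow> weak_hyperbolic I M"
  unfolding weak_hyperbolic_def using hyperbolic_reverse_Cauchy_Schwarz by blast

text \<open>The semidefinite counterpart of a change of reference vector. Here \<open>e\<close> may
  be isotropic, provided that the all-ones vector is not orthogonal to it; it will be a coordinate
  vector.\<close>

lemma weak_hyperbolic_orthogonal:
  assumes sym: "sym_on I M" and w: "weak_hyperbolic I M" and T: "0 < bform I M (\<lambda>_. 1) (\<lambda>_. 1)"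
    and e: "0 \<le> bform I M e e" "bform I M (\<lambda>_. 1) e \<noteq> 0" and x: "bform I M e x = 0"
  shows "bform I M x x \<le> 0"
proof -
  let ?a = "bform I M (\<lambda>_. 1) e" and ?b = "bform I M (\<lambda>_. 1) x"
  define y where "y = (\<lambda>i. ?a * x i + (- ?b) * e i)"
  have "bform I M (\<lambda>_. 1) y = 0" unfolding y_def bform_lincomb_right by simp
  then have "bform I M y y \<le> 0"
    using w T unfolding weak_hyperbolic_def
    by (metis mult_le_0_iff not_le power_zero_numeral)
  then have "?a\<^sup>2 * bform I M x x + ?b\<^sup>2 * bform I M e e \<le> 0"
    unfolding y_def bform_lincomb[OF sym] using x bform_commute[OF sym, of x e] by simp
  moreover have "0 \<le> ?b\<^sup>2 * bform I M e e" using e by simp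
  ultimately have "?a\<^sup>2 * bform I M x x \<le> 0" by linarith
  then show ?thesis using e by (simp add: mult_le_0_iff)
qed

text \<open>A vector on which a semidefinite form vanishes lies in the kernel of the form.\<close>

lemma psd_zero_imp_kernel:
  fixes a b :: real
  assumes "\<And>t::real. 0 \<le> 2 * t * b + t\<^sup>2 * a"
  shows "b = 0"
proof (rule ccontr)
  assume b: "b \<noteq> 0"
  \<comment> \<open>With \<open>c\<close> positive and above \<open>a\<close>, the choice t = - b /
    c minimises 2 t b + t^2 c.\<close>
  define c where "c = \<bar>a\<bar> + 1"
  have c: "c > 0" "a < c" unfolding c_def by auto
  have "0 \<le> 2 * (- b / c) * b + (- b / c)\<^sup>2 * a" by (rule assms)
  also have "\<dots> \<le> 2 * (- b / c) * b + (- b / c)\<^sup>2 * c"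
    using c by (intro add_left_mono mult_left_mono) auto
  also have "\<dots> = - (b\<^sup>2 / c)" using c by (simp add: power2_eq_square field_simps)
  also have "\<dots> < 0" using b c by simp
  finally show False by simp
qed

text \<open>If definiteness fails, some nonzero y orthogonal to the all-ones vector has value 0. It
  is a zero of the positive semidefinite form (1.z)^2 - (1.1)(z.z), hence in the kernel of that
  form, and so in the kernel of \<open>M\<close>.\<close>

lemma weak_hyperbolic_degenerate:
  assumes sym: "sym_on I M" and w: "weak_hyperbolic I M" and T: "0 < bform I M (\<lambda>_. 1) (\<lambda>_. 1)"
    and n: "\<not> hyperbolic I M (\<lambda>_. 1)"
  obtains y where "\<exists>i\<in>I. y i \<noteq> 0" "\<And>z. bform I M y z = 0"
proof -
  let ?T = "bform I M (\<lambda>_. 1) (\<lambda>_. 1)" and ?r = "bform I M (\<lambda>_. 1)"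
  from n T obtain y where y: "\<exists>i\<in>I. y i \<noteq> 0" "?r y = 0" "bform I M y y \<ge> 0"
    unfolding hyperbolic_def by force
  have "bform I M y y \<le> 0"
    using w T y(2) unfolding weak_hyperbolic_def by (metis mult_le_0_iff not_le power_zero_numeral)
  then have yy: "bform I M y y = 0" using y(3) by linarith
  have "bform I M y z = 0" for z
  proof -
    have "0 \<le> 2 * t * (- ?T * bform I M y z) + t\<^sup>2 * ((?r z)\<^sup>2 - ?T * bform I M z z)" for t :: real
    proof -
      define x where "x = (\<lambda>i. 1 * y i + t * z i)"
      have "?T * bform I M x x \<le> (?r x)\<^sup>2" using w unfolding weak_hyperbolic_def by blast
      moreover have "bform I M x x = 2 * t * bform I M y z + t\<^sup>2 * bform I M z z"
        unfolding x_def bform_lincomb[OF sym] using yy by simp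
      moreover have "?r x = t * ?r z"
        unfolding x_def bform_lincomb_right using y by simp
      ultimately show ?thesis by (simp add: power2_eq_square algebra_simps)
    qed
    then have "- ?T * bform I M y z = 0" by (rule psd_zero_imp_kernel)
    then show ?thesis using T by simp
  qed
  then show ?thesis using that y(1) by blast
qed

section \<open>Compactness, and the spectral theorem on the complement of an eigenvector\<close>

lemma compact_box:
  "compact {x :: 'b \<Rightarrow> real. (\<forall>b\<in>S. \<bar>x b\<bar> \<le> c) \<and> (\<forall>b. b \<notin> S \<longrightarrow> x b = 0)}"
proof -
  let ?B = "\<lambda>b. if b \<in> S then {-c..c} else {0::real}"
  have "compactin (product_topology (\<lambda>_. euclidean) UNIV) (PiE UNIV ?B)"
    unfolding compactin_PiE by (intro disjI2 ballI) simp
  then have "compact (PiE UNIV ?B)"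
    unfolding euclidean_product_topology compactin_euclidean_iff .
  moreover
  have "x \<in> PiE UNIV ?B \<longleftrightarrow> (\<forall>b\<in>S. \<bar>x b\<bar> \<le> c) \<and> (\<forall>b. b \<notin> S \<longrightarrow> x b = 0)" for x
  proof -
    have "x \<in> PiE UNIV ?B \<longleftrightarrow> (\<forall>b. x b \<in> ?B b)" by (simp add: PiE_iff)
    also have "\<dots> \<longleftrightarrow> (\<forall>b. (b \<in> S \<longrightarrow> \<bar>x b\<bar> \<le> c) \<and> (b \<notin> S \<longrightarrow> x b = 0))"
    proof (intro iff_allI)
      fix b show "x b \<in> ?B b \<longleftrightarrow> (b \<in> S \<longrightarrow> \<bar>x b\<bar> \<le> c) \<and> (b \<notin> S \<longrightarrow> x b = 0)"
        by (cases "b \<in> S") (simp_all add: abs_le_iff minus_le_iff conj_commute)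
    qed
    finally show ?thesis by blast
  qed
  then have "PiE UNIV ?B = {x. (\<forall>b\<in>S. \<bar>x b\<bar> \<le> c) \<and> (\<forall>b. b \<notin> S \<longrightarrow> x b = 0)}" by blast
  ultimately show ?thesis by simp
qed

lemma continuous_on_coordinate: "continuous_on S (\<lambda>x. x i :: real)"
  by (rule continuous_on_subset[OF continuous_on_product_coordinates]) simp

lemma continuous_on_bform: "continuous_on S (\<lambda>x. bform I M x x)"
  unfolding bform_def by (intro continuous_intros continuous_on_coordinate)

lemma bform_eigenvector:
  assumes "\<And>b. b \<in> I \<Longrightarrow> (\<Sum>a\<in>I. M b a * z a) = \<mu> * z b"
  shows "bform I M x z = \<mu> * (\<Sum>b\<in>I. x b * z b)"
  unfolding bform_rows using assms by (simp add: sum_distrib_left algebra_simps)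

text \<open>An orthonormal basis of eigenvectors of \<open>M\<close> on the complement of
  \<open>w\<close>; the last clause is completeness. A known eigenvector \<open>w\<close> is kept
  out of the basis: the all-ones vector for the generator and for \<open>reduced\<close>, a positive
  Perron vector in \<open>hyperbolic_from_links\<close>.\<close>

definition eigenbasis ::
  "'b set \<Rightarrow> ('b \<Rightarrow> 'b \<Rightarrow> real) \<Rightarrow> ('b \<Rightarrow> real) \<Rightarrow> nat \<Rightarrow> (nat \<Rightarrow> 'b \<Rightarrow> real) \<Rightarrow> (nat \<Rightarrow> real) \<Rightarrow> bool"
where
  "eigenbasis I M w m \<phi> \<mu> \<longleftrightarrow>
     (\<forall>k<m. (\<Sum>b\<in>I. w b * \<phi> k b) = 0) \<and>
     (\<forall>k<m. \<forall>l<m. (\<Sum>b\<in>I. \<phi> k b * \<phi> l b) = (if k = l then 1 else 0)) \<and>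
     (\<forall>k<m. \<forall>b\<in>I. (\<Sum>a\<in>I. M b a * \<phi> k a) = \<mu> k * \<phi> k b) \<and>
     (\<forall>x. (\<Sum>b\<in>I. w b * x b) = 0 \<longrightarrow>
        (\<forall>b\<in>I. x b = (\<Sum>k<m. (\<Sum>a\<in>I. \<phi> k a * x a) * \<phi> k b)))"

lemma eigenbasisD:
  assumes "eigenbasis I M w m \<phi> \<mu>"
  shows "k < m \<Longrightarrow> (\<Sum>b\<in>I. w b * \<phi> k b) = 0"
    "k < m \<Longrightarrow> l < m \<Longrightarrow> (\<Sum>b\<in>I. \<phi> k b * \<phi> l b) = (if k = l then 1 else 0)"
    "k < m \<Longrightarrow> b \<in> I \<Longrightarrow> (\<Sum>a\<in>I. M b a * \<phi> k a) = \<mu> k * \<phi> k b"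
    "(\<Sum>b\<in>I. w b * x b) = 0 \<Longrightarrow> b \<in> I \<Longrightarrow>
       x b = (\<Sum>k<m. (\<Sum>a\<in>I. \<phi> k a * x a) * \<phi> k b)"
  using assms unfolding eigenbasis_def by simp_all

lemma eigenbasis_pairing:
  assumes E: "eigenbasis I M w m \<phi> \<mu>" and x: "(\<Sum>b\<in>I. w b * x b) = 0"
  shows "(\<Sum>b\<in>I. x b * y b) = (\<Sum>k<m. (\<Sum>a\<in>I. \<phi> k a * x a) * (\<Sum>a\<in>I. \<phi> k a * y a))"
proof -
  have "(\<Sum>b\<in>I. x b * y b) = (\<Sum>b\<in>I. \<Sum>k<m. (\<Sum>a\<in>I. \<phi> k a * x a) * \<phi> k b * y b)"
    using eigenbasisD(4)[OF E x] by (intro sum.cong refl) (simp flip: sum_distrib_right)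
  also have "\<dots> = (\<Sum>k<m. \<Sum>b\<in>I. (\<Sum>a\<in>I. \<phi> k a * x a) * (\<phi> k b * y b))"
    by (subst sum.swap) (simp add: mult.assoc)
  finally show ?thesis by (simp flip: sum_distrib_left)
qed

lemma eigenbasis_Parseval:
  assumes "eigenbasis I M w m \<phi> \<mu>" "(\<Sum>b\<in>I. w b * x b) = 0"
  shows "(\<Sum>b\<in>I. (x b)\<^sup>2) = (\<Sum>k<m. (\<Sum>a\<in>I. \<phi> k a * x a)\<^sup>2)"
  using eigenbasis_pairing[OF assms, of x] by (simp add: power2_eq_square)

lemma eigenbasis_diagonal:
  assumes E: "eigenbasis I M w m \<phi> \<mu>" and sym: "sym_on I M" and x: "(\<Sum>b\<in>I. w b * x b) = 0"
  shows "bform I M x x = (\<Sum>k<m. \<mu> k * (\<Sum>a\<in>I. \<phi> k a * x a)\<^sup>2)"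
proof -
  have "bform I M (\<phi> k) x = \<mu> k * (\<Sum>a\<in>I. \<phi> k a * x a)" if "k < m" for k
    using bform_eigenvector[OF eigenbasisD(3)[OF E that], of x] bform_commute[OF sym, of "\<phi> k" x]
    by (simp add: mult.commute)
  then show ?thesis
    using eigenbasis_pairing[OF E x, of "\<lambda>b. \<Sum>a\<in>I. M b a * x a"]
    by (simp add: bform_rows power2_eq_square mult_ac)
qed

text \<open>
  A maximal orthonormal family of eigenvectors is complete: on the sphere of the orthogonal complement
  of a family that is not, the Rayleigh quotient would be maximal at a further eigenvector.  The size
  of a family is bounded by Bessel's inequality.  The case \<open>w = 0\<close> is the usual spectral theorem.
\<close>

lemma spectral_theorem:
  fixes M :: "'b \<Rightarrow> 'b \<Rightarrow> real"
  assumes fin: "finite I" and sym: "sym_on I M"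
    and w: "\<And>b. b \<in> I \<Longrightarrow> (\<Sum>a\<in>I. M b a * w a) = \<nu> * w b"
  shows "\<exists>m \<phi> \<mu>. eigenbasis I M w m \<phi> \<mu>"
proof -
  define ip where "ip x y = (\<Sum>b\<in>I. x b * y b)" for x y :: "'b \<Rightarrow> real"
  have ip_commute: "ip x y = ip y x" for x y
    unfolding ip_def by (simp add: mult.commute)
  have ip_diff: "ip x (\<lambda>b. y b - z b) = ip x y - ip x z" for x y z
    unfolding ip_def by (simp add: algebra_simps sum_subtractf)
  have ip_scale: "ip x (\<lambda>b. c * y b) = c * ip x y" for x y c
    unfolding ip_def by (simp add: algebra_simps sum_distrib_left)
  have ip_sum: "ip x (\<lambda>b. \<Sum>k<m. c k * \<phi> k b) = (\<Sum>k<m. c k * ip x (\<phi> k))" for x c and m :: nat and \<phi>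
    unfolding ip_def sum_distrib_left by (subst sum.swap) (simp add: algebra_simps)
  have ip_diff_left: "ip (\<lambda>b. y b - z b) x = ip y x - ip z x" for x y z
    unfolding ip_commute[of _ x] by (rule ip_diff)
  have ip_sum_left: "ip (\<lambda>b. \<Sum>k<m. c k * \<phi> k b) x = (\<Sum>k<m. c k * ip (\<phi> k) x)" for x c and m :: nat and \<phi>
    unfolding ip_commute[of _ x] by (rule ip_sum)
  have ip_scale_left: "ip (\<lambda>b. c * y b) x = c * ip y x" for x y c
    unfolding ip_commute[of _ x] by (rule ip_scale)
  have ip_pos: "0 < ip x x" if nz: "\<exists>b\<in>I. x b \<noteq> 0" for x
  proof -
    obtain b where b: "b \<in> I" "x b \<noteq> 0" using nz by blast
    show ?thesis unfolding ip_def by (rule sum_pos2[OF fin b(1)]) (use b in \<open>auto simp: zero_less_mult_iff\<close>)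
  qed
  define good where "good m \<phi> \<mu> \<longleftrightarrow>
      (\<forall>k<m. ip w (\<phi> k) = 0) \<and>
      (\<forall>k<m. \<forall>l<m. ip (\<phi> k) (\<phi> l) = (if k = l then 1 else 0)) \<and>
      (\<forall>k<m. \<forall>b\<in>I. (\<Sum>a\<in>I. M b a * \<phi> k a) = \<mu> k * \<phi> k b)"
    for m :: nat and \<phi> \<mu>
  have bound: "m \<le> card I" if g: "good m \<phi> \<mu>" for m \<phi> \<mu>
  proof -
    have bessel: "(\<Sum>k<m. (\<phi> k b)\<^sup>2) \<le> 1" if b: "b \<in> I" for b
    proof -
      define e where "e = (\<lambda>a. if a = b then 1 else 0 :: real)"
      define r where "r = (\<lambda>a. e a - (\<Sum>k<m. \<phi> k b * \<phi> k a))"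
      have ie: "ip x e = x b" for x unfolding ip_def e_def using b fin by (simp add: if_distrib[of "\<lambda>t. _ * t"] cong: if_cong)
      have "ip (\<phi> l) r = 0" if "l < m" for l
        using g that unfolding r_def ip_diff ip_sum ie good_def
        by (simp add: if_distrib[of "\<lambda>t. _ * t"] cong: if_cong)
      then have "ip (\<lambda>a. \<Sum>k<m. \<phi> k b * \<phi> k a) r = 0"
        unfolding ip_sum_left by simp
      then have "ip r r = ip e r"
        by (subst (1) r_def) (simp add: ip_diff_left)
      also have "\<dots> = 1 - (\<Sum>k<m. (\<phi> k b)\<^sup>2)"
        unfolding r_def ip_diff ip_sum ip_commute[of e] ie
        by (simp add: e_def power2_eq_square)
      moreover have "0 \<le> ip r r" unfolding ip_def by (intro sum_nonneg) auto
      ultimately show ?thesis by linarith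
    qed
    \<comment> \<open>The squared entries of the family sum to \<open>m\<close> by vectors and to at
      most \<open>card I\<close> by coordinates.\<close>
    have "real m = (\<Sum>k<m. ip (\<phi> k) (\<phi> k))" using g unfolding good_def by simp
    also have "\<dots> = (\<Sum>b\<in>I. \<Sum>k<m. (\<phi> k b)\<^sup>2)"
      unfolding ip_def by (subst sum.swap) (simp add: power2_eq_square)
    also have "\<dots> \<le> (\<Sum>b\<in>I. 1)" by (intro sum_mono bessel)
    finally show ?thesis by simp
  qed
  have ex: "\<exists>\<phi> \<mu>. good 0 \<phi> \<mu>" unfolding good_def by auto
  obtain m where "\<exists>\<phi> \<mu>. good m \<phi> \<mu>" and max: "\<And>m' \<phi> \<mu>. good m' \<phi> \<mu> \<Longrightarrow> m' \<le> m"
  proof -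
    have "\<forall>m. (\<exists>\<phi> \<mu>. good m \<phi> \<mu>) \<longrightarrow> m < Suc (card I)"
      using bound by (auto simp: less_Suc_eq_le)
    from ex_has_greatest_nat[of "\<lambda>m. \<exists>\<phi> \<mu>. good m \<phi> \<mu>" 0 "\<lambda>m. m", OF ex this]
    show ?thesis using that by blast
  qed
  then obtain \<phi> \<mu> where g: "good m \<phi> \<mu>" by blast
  have g1: "ip w (\<phi> k) = 0" if "k < m" for k using g that unfolding good_def by blast
  have g2: "ip (\<phi> k) (\<phi> l) = (if k = l then 1 else 0)" if "k < m" "l < m" for k l
    using g that unfolding good_def by blast
  have g3: "(\<Sum>a\<in>I. M b a * \<phi> k a) = \<mu> k * \<phi> k b" if "k < m" "b \<in> I" for k b
    using g that unfolding good_def by blast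
  have complete: "\<forall>b\<in>I. x b = (\<Sum>k<m. ip (\<phi> k) x * \<phi> k b)" if wx: "ip w x = 0" for x
  proof (rule ccontr)
    assume neg: "\<not> ?thesis"
    define W where "W = {v. ip w v = 0 \<and> (\<forall>k<m. ip (\<phi> k) v = 0)}"
    define r where "r = (\<lambda>b. x b - (\<Sum>k<m. ip (\<phi> k) x * \<phi> k b))"
    have rnz: "\<exists>b\<in>I. r b \<noteq> 0" using neg unfolding r_def by auto
    have rW: "r \<in> W"
      using g1 g2 wx unfolding W_def r_def
      by (simp add: ip_diff ip_sum if_distrib[of "\<lambda>t. _ * t"] cong: if_cong)
    \<comment> \<open>The unit sphere of \<open>W\<close>. The values off \<open>I\<close>, which
      \<open>ip\<close> and \<open>bform\<close> do not see, are fixed to make it compact.\<close>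
    define X where "X = {v. (\<forall>b. b \<notin> I \<longrightarrow> v b = 0) \<and> ip v v = 1 \<and> v \<in> W}"
    have closed_ip: "closed {v. ip (f v) (h v) = c}"
      if "\<And>b. continuous_on UNIV (\<lambda>v. f v b)" "\<And>b. continuous_on UNIV (\<lambda>v. h v b)"
      for f h :: "('b \<Rightarrow> real) \<Rightarrow> 'b \<Rightarrow> real" and c
      unfolding ip_def by (intro closed_Collect_eq continuous_intros that)
    have "X = {v. (\<forall>b\<in>I. \<bar>v b\<bar> \<le> 1) \<and> (\<forall>b. b \<notin> I \<longrightarrow> v b = 0)} \<inter> ({v. ip v v = 1} \<inter> W)"
    proof -
      have "\<bar>v b\<bar> \<le> 1" if "ip v v = 1" "b \<in> I" for v b
      proof -
        have "v b * v b \<le> 1"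
          using member_le_sum[OF that(2), of "\<lambda>b. v b * v b"] fin that(1) unfolding ip_def by auto
        then show ?thesis by (metis abs_le_square_iff abs_one one_power2 power2_eq_square)
      qed
      then show ?thesis unfolding X_def by auto
    qed
    moreover have "W = {v. ip w v = 0} \<inter> (\<Inter>k\<in>{..<m}. {v. ip (\<phi> k) v = 0})"
      unfolding W_def by auto
    then have "closed W"
      by (auto intro!: closed_Int closed_INT closed_ip continuous_intros)
    ultimately have cX: "compact X"
      by (auto intro!: compact_Int_closed compact_box closed_Int closed_ip)
    have "X \<noteq> {}"
    proof -
      define v where "v = (\<lambda>b. if b \<in> I then (1 / sqrt (ip r r)) * r b else 0)"
      have iv: "ip z v = (1 / sqrt (ip r r)) * ip z r" for z
        unfolding ip_scale[symmetric] unfolding ip_def v_def by (intro sum.cong) auto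
      have "ip v v = (1 / sqrt (ip r r)) * ((1 / sqrt (ip r r)) * ip r r)"
        unfolding iv ip_commute[of v r] by (rule refl)
      also have "\<dots> = 1" using ip_pos[OF rnz] by (simp add: field_simps)
      finally have "v \<in> X" unfolding X_def using rW by (auto simp: W_def iv) (auto simp: v_def)
      then show ?thesis by auto
    qed
    then obtain z where z: "z \<in> X" and zmax: "\<And>v. v \<in> X \<Longrightarrow> bform I M v v \<le> bform I M z z"
      using continuous_attains_sup[OF cX _ continuous_on_bform[of X I M]] by auto
    define \<kappa> where "\<kappa> = bform I M z z"
    have zW: "z \<in> W" "ip z z = 1" using z X_def by auto
    have ray: "bform I M v v \<le> \<kappa> * ip v v" if "v \<in> W" for v
    proof (cases "\<exists>b\<in>I. v b \<noteq> 0")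
      case True
      define c where "c = 1 / sqrt (ip v v)"
      have c2: "c * (c * ip v v) = 1" using ip_pos[OF True] unfolding c_def by (simp add: field_simps)
      define u where "u = (\<lambda>b. if b \<in> I then c * v b else 0)"
      have iu: "ip z u = c * ip z v" for z
        unfolding ip_scale[symmetric] unfolding ip_def u_def by (intro sum.cong) auto
      have "ip u u = 1" using c2 unfolding iu ip_commute[of u v] by simp
      then have "u \<in> X" unfolding X_def using that by (auto simp: W_def iu) (auto simp: u_def)
      then have "bform I M u u \<le> \<kappa>" unfolding \<kappa>_def by (rule zmax)
      moreover have "bform I M u u = bform I M (\<lambda>b. c * v b) (\<lambda>b. c * v b)"
        unfolding u_def by (intro bform_cong) auto
      ultimately have "c * (c * bform I M v v) \<le> c * (c * (\<kappa> * ip v v))"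
        using c2 by (simp add: bform_scale_left bform_scale_right algebra_simps)
      moreover have "c > 0" unfolding c_def using ip_pos[OF True] by simp
      ultimately show ?thesis by simp
    next
      case False
      then have "ip v v = 0" "bform I M v v = 0" unfolding ip_def bform_rows by auto
      then show ?thesis by simp
    qed
    \<comment> \<open>The first-order condition at the maximum: on \<open>W\<close> the form
      \<open>\<kappa> * ip u u - bform I M u u\<close> is nonnegative, and it vanishes at
      \<open>z\<close>.\<close>
    have crit: "\<kappa> * ip z v - bform I M z v = 0" if v: "v \<in> W" for v
    proof (rule psd_zero_imp_kernel)
      fix t :: real
      define u where "u = (\<lambda>b. 1 * z b + t * v b)"
      have ipu: "ip x u = ip x z + t * ip x v" for x
        unfolding ip_def u_def by (simp add: algebra_simps sum.distrib sum_distrib_left)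
      have "u \<in> W" using v zW(1) unfolding W_def by (simp add: ipu)
      from ray[OF this] have "bform I M u u \<le> \<kappa> * ip u u" .
      moreover have "ip u u = 1 + 2 * t * ip z v + t\<^sup>2 * ip v v"
        unfolding ipu ip_commute[of u z] ip_commute[of u v] using zW(2) ip_commute[of v z]
        by (simp add: power2_eq_square algebra_simps)
      moreover have "bform I M u u = \<kappa> + 2 * t * bform I M z v + t\<^sup>2 * bform I M v v"
        unfolding u_def bform_lincomb[OF sym] \<kappa>_def by simp
      ultimately show "0 \<le> 2 * t * (\<kappa> * ip z v - bform I M z v) + t\<^sup>2 * (\<kappa> * ip v v - bform I M v v)"
        by (simp add: algebra_simps)
    qed
    define Mz where "Mz = (\<lambda>b. \<Sum>a\<in>I. M b a * z a)"
    have ipMz: "ip v Mz = bform I M v z" for v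
      unfolding ip_def Mz_def bform_rows by simp
    \<comment> \<open>The residual of the eigenvalue equation lies in \<open>W\<close>, as
      \<open>M\<close> preserves \<open>W\<close>. Testing criticality against the residual itself
      shows that its norm is 0.\<close>
    define v where "v = (\<lambda>b. \<kappa> * z b - Mz b)"
    have "v \<in> W"
    proof -
      have "ip w Mz = 0"
        unfolding ipMz bform_commute[OF sym, of w] using bform_eigenvector[OF w, of z] zW(1)
        by (simp add: W_def ip_commute[of w] flip: ip_def)
      moreover have "ip (\<phi> k) Mz = 0" if "k < m" for k
        unfolding ipMz bform_commute[OF sym, of "\<phi> k"] using bform_eigenvector[OF g3, of k z] zW(1) that
        by (simp add: W_def ip_commute[of z "\<phi> k"] flip: ip_def)
      ultimately show ?thesis
        using zW(1) unfolding W_def v_def by (simp add: ip_diff ip_scale)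
    qed
    moreover have "ip v v = \<kappa> * ip z v - bform I M z v"
      by (subst (1) v_def) (simp only: ip_diff_left ip_scale_left ip_commute[of Mz v] ipMz bform_commute[OF sym, of v z])
    ultimately have "ip v v = 0" using crit by simp
    then have ev: "\<forall>b\<in>I. v b = 0" using ip_pos[of v] by force
    have "good (Suc m) (\<phi>(m := z)) (\<mu>(m := \<kappa>))"
      unfolding good_def
    proof (intro conjI allI impI ballI)
      fix k assume "k < Suc m"
      then show "ip w ((\<phi>(m := z)) k) = 0" using g1 zW(1) by (auto simp: W_def less_Suc_eq)
    next
      fix k l assume "k < Suc m" "l < Suc m"
      then show "ip ((\<phi>(m := z)) k) ((\<phi>(m := z)) l) = (if k = l then 1 else 0)"
        using g2 zW by (auto simp: W_def less_Suc_eq ip_commute[of z "\<phi> _"])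
    next
      fix k b assume "k < Suc m" "b \<in> I"
      then show "(\<Sum>a\<in>I. M b a * (\<phi>(m := z)) k a) = (\<mu>(m := \<kappa>)) k * (\<phi>(m := z)) k b"
        using g3 ev by (auto simp: less_Suc_eq v_def Mz_def)
    qed
    from max[OF this] show False by simp
  qed
  have "eigenbasis I M w m \<phi> \<mu>"
    unfolding eigenbasis_def using g1 g2 g3 complete by (simp add: ip_def)
  then show ?thesis by blast
qed


section \<open>Stability of hyperbolicity under perturbation\<close>

text \<open>
  Up to the factor \<open>bform I M 1 1\<close>, the form of this matrix is the negative of the form of \<open>M\<close> on the
  complement of the all-ones vector.  It is invariant under adding constants, so that \<open>hyperbolic\<close> becomes
  definiteness on the fixed hyperplane of vectors with zero sum.
\<close>

definition reduced :: "'b set \<Rightarrow> ('b \<Rightarrow> 'b \<Rightarrow> real) \<Rightarrow> 'b \<Rightarrow> 'b \<Rightarrow> real" where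
  "reduced I M i j = (\<Sum>a\<in>I. M a i) * (\<Sum>a\<in>I. M a j) - bform I M (\<lambda>_. 1) (\<lambda>_. 1) * M i j"

lemma bform_reduced:
  "bform I (reduced I M) x y =
     bform I M (\<lambda>_. 1) x * bform I M (\<lambda>_. 1) y - bform I M (\<lambda>_. 1) (\<lambda>_. 1) * bform I M x y"
proof -
  have col: "bform I M (\<lambda>_. 1) z = (\<Sum>i\<in>I. (\<Sum>a\<in>I. M a i) * z i)" for z
    unfolding bform_def by (subst sum.swap) (simp add: sum_distrib_right)
  show ?thesis
    unfolding col[of x] col[of y] sum_product
    unfolding bform_def[of I "reduced I M"] reduced_def bform_def[of I M x y]
    by (simp add: algebra_simps sum_subtractf sum_distrib_left)
qed

text \<open>With T the value of the all-ones vector, y = T x - (1.x) 1 is orthogonal to that vector,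
  and its value is -T times the reduced value of x. A zero-sum x that is constant vanishes, so y is
  nonzero.\<close>

lemma hyperbolic_imp_reduced_pos:
  assumes fin: "finite I" and sym: "sym_on I M" and h: "hyperbolic I M (\<lambda>_. 1)"
    and x: "\<exists>i\<in>I. x i \<noteq> 0" "sum x I = 0"
  shows "0 < bform I (reduced I M) x x"
proof -
  let ?T = "bform I M (\<lambda>_. 1) (\<lambda>_. 1)" and ?r = "bform I M (\<lambda>_. 1) x"
  have T: "?T > 0" using h hyperbolic_def by blast
  define y where "y = (\<lambda>i. ?T * x i + (- ?r) * 1)"
  have 0: "bform I M (\<lambda>_. 1) y = 0"
    using bform_lincomb_right[of I M "\<lambda>_. 1" ?T x "- ?r" "\<lambda>_. 1"] unfolding y_def by simp
  have "\<exists>i\<in>I. y i \<noteq> 0"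
  proof (rule ccontr)
    assume n: "\<not> ?thesis"
    have "(\<Sum>i\<in>I. y i) = ?T * sum x I - real (card I) * ?r"
      unfolding y_def by (simp add: sum_subtractf sum_distrib_left)
    then have "?r = 0" using n x fin by (auto simp: card_eq_0_iff)
    then show False using n x T unfolding y_def by auto
  qed
  then have "bform I M y y < 0" using 0 h unfolding hyperbolic_def by blast
  moreover have "bform I M y y = ?T\<^sup>2 * bform I M x x - ?T * ?r\<^sup>2"
    using bform_lincomb[OF sym, of ?T x "- ?r" "\<lambda>_. 1"] bform_commute[OF sym, of x "\<lambda>_. 1"]
    unfolding y_def by (simp add: power2_eq_square algebra_simps)
  ultimately have "0 < ?T * bform I (reduced I M) x x"
    by (simp add: bform_reduced power2_eq_square algebra_simps)
  then show ?thesis using T by (simp add: zero_less_mult_iff)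
qed

lemma reduced_pos_imp_hyperbolic:
  assumes fin: "finite I" and sym: "sym_on I M" and T: "0 < bform I M (\<lambda>_. 1) (\<lambda>_. 1)"
    and pos: "\<And>x. \<exists>i\<in>I. x i \<noteq> 0 \<Longrightarrow> sum x I = 0 \<Longrightarrow> 0 < bform I (reduced I M) x x"
  shows "hyperbolic I M (\<lambda>_. 1)"
  unfolding hyperbolic_def
proof (intro conjI allI impI T)
  fix x assume nz: "\<exists>i\<in>I. x i \<noteq> 0" and 0: "bform I M (\<lambda>_. 1) x = 0"
  let ?T = "bform I M (\<lambda>_. 1) (\<lambda>_. 1)"
  \<comment> \<open>The mean of x; removing it leads into the zero-sum hyperplane without changing
    the reduced form.\<close>
  define c where "c = sum x I / card I"
  define y where "y = (\<lambda>i. 1 * x i + (- c) * 1)"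
  have r: "bform I M (\<lambda>_. 1) y = - c * ?T"
    using bform_lincomb_right[of I M "\<lambda>_. 1" 1 x "- c" "\<lambda>_. 1"] 0 unfolding y_def by simp
  have yy: "bform I M y y = bform I M x x + c\<^sup>2 * ?T"
    using bform_lincomb[OF sym, of 1 x "- c" "\<lambda>_. 1"] bform_commute[OF sym, of x "\<lambda>_. 1"] 0
    unfolding y_def by simp
  have "\<exists>i\<in>I. y i \<noteq> 0"
  proof (rule ccontr)
    assume n: "\<not> ?thesis"
    then have "bform I M (\<lambda>_. 1) y = bform I M (\<lambda>_. 1) (\<lambda>_. 0)" by (intro bform_cong) auto
    then have "c = 0" using r T by (simp add: bform_def)
    then show False using n nz unfolding y_def by auto
  qed
  moreover have "sum y I = 0"
    using fin nz unfolding y_def c_def by (auto simp: sum_subtractf)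
  ultimately have "0 < bform I (reduced I M) y y" by (rule pos)
  then have "?T * bform I M x x < 0"
    unfolding bform_reduced r yy by (simp add: power2_eq_square algebra_simps)
  then show "bform I M x x < 0" using T by (simp add: mult_less_0_iff)
qed

lemma reduced_gap:
  assumes fin: "finite I" and sym: "sym_on I M" and h: "hyperbolic I M (\<lambda>_. 1)"
  obtains g where "g > 0" "\<And>x. sum x I = 0 \<Longrightarrow> g * (\<Sum>i\<in>I. (x i)\<^sup>2) \<le> bform I (reduced I M) x x"
proof -
  have symr: "sym_on I (reduced I M)"
    using sym unfolding sym_on_def reduced_def by (simp add: mult.commute)
  have ker: "(\<Sum>a\<in>I. reduced I M b a * 1) = 0 * 1" if b: "b \<in> I" for b
  proof -
    have "(\<Sum>a\<in>I. reduced I M b a) = (\<Sum>a\<in>I. M a b) * (\<Sum>i\<in>I. \<Sum>a\<in>I. M a i)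
        - bform I M (\<lambda>_. 1) (\<lambda>_. 1) * (\<Sum>a\<in>I. M b a)"
      unfolding reduced_def by (simp add: sum_subtractf sum_distrib_left)
    also have "(\<Sum>i\<in>I. \<Sum>a\<in>I. M a i) = bform I M (\<lambda>_. 1) (\<lambda>_. 1)"
      unfolding bform_def by (subst sum.swap) simp
    also have "(\<Sum>a\<in>I. M b a) = (\<Sum>a\<in>I. M a b)"
      using sym b unfolding sym_on_def by (intro sum.cong) auto
    finally show ?thesis by simp
  qed
  obtain m \<phi> \<mu> where eb: "eigenbasis I (reduced I M) (\<lambda>_. 1) m \<phi> \<mu>"
    using spectral_theorem[OF fin symr ker] by blast
  note s2 = eigenbasisD(2)[OF eb] and s3 = eigenbasisD(3)[OF eb]
  have s1: "sum (\<phi> k) I = 0" if "k < m" for k using eigenbasisD(1)[OF eb that] by simp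
  have pos: "\<mu> k > 0" if k: "k < m" for k
  proof -
    have "bform I (reduced I M) (\<phi> k) (\<phi> k) = \<mu> k"
      using bform_eigenvector[OF s3, of k "\<phi> k"] s2 k by simp
    moreover have "\<exists>i\<in>I. \<phi> k i \<noteq> 0"
    proof (rule ccontr)
      assume "\<not> ?thesis"
      then have "(\<Sum>b\<in>I. \<phi> k b * \<phi> k b) = 0" by (intro sum.neutral) auto
      then show False using s2[OF k k] by simp
    qed
    ultimately show ?thesis
      using hyperbolic_imp_reduced_pos[OF fin sym h, of "\<phi> k"] s1[OF k] by simp
  qed
  \<comment> \<open>The element 1 keeps the set nonempty when there are no eigenvectors.\<close>
  define g where "g = Min (insert 1 (\<mu> ` {..<m}))"
  have "g > 0" unfolding g_def using pos by (subst Min_gr_iff) auto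
  moreover have "g * (\<Sum>i\<in>I. (x i)\<^sup>2) \<le> bform I (reduced I M) x x" if "sum x I = 0" for x
  proof -
    have "g \<le> \<mu> k" if "k < m" for k unfolding g_def using that by (intro Min_le) auto
    then show ?thesis using eigenbasis_Parseval[OF eb, of x] eigenbasis_diagonal[OF eb symr, of x] that
      by (auto simp: sum_distrib_left intro!: sum_mono mult_right_mono)
  qed
  ultimately show ?thesis using that by blast
qed

lemma bform_bound:
  assumes "\<And>i j. i \<in> I \<Longrightarrow> j \<in> I \<Longrightarrow> \<bar>M i j\<bar> \<le> c"
  shows "\<bar>bform I M x x\<bar> \<le> c * card I * (\<Sum>i\<in>I. (x i)\<^sup>2)"
proof -
  have am: "\<bar>x i * x j\<bar> \<le> ((x i)\<^sup>2 + (x j)\<^sup>2) / 2" for i j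
    using sum_squares_bound[of "\<bar>x i\<bar>" "\<bar>x j\<bar>"] by (simp add: abs_mult)
  have "\<bar>bform I M x x\<bar> \<le> (\<Sum>i\<in>I. \<Sum>j\<in>I. \<bar>M i j * (x i * x j)\<bar>)"
    unfolding bform_def mult.assoc by (intro order_trans[OF sum_abs] sum_mono) simp
  also have "\<dots> \<le> (\<Sum>i\<in>I. \<Sum>j\<in>I. c * (((x i)\<^sup>2 + (x j)\<^sup>2) / 2))"
  proof (intro sum_mono)
    fix i j assume "i \<in> I" "j \<in> I"
    then show "\<bar>M i j * (x i * x j)\<bar> \<le> c * (((x i)\<^sup>2 + (x j)\<^sup>2) / 2)"
      unfolding abs_mult[of "M i j"] using assms[of i j] am[of i j]
      by (intro mult_mono) auto
  qed
  also have "\<dots> = c * card I * (\<Sum>i\<in>I. (x i)\<^sup>2)"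
    by (simp add: sum.distrib add_divide_distrib flip: sum_distrib_left sum_divide_distrib)
  finally show ?thesis .
qed

text \<open>If the entries of \<open>reduced\<close> move by less than \<delta>, the form changes by
  at most \<delta> times \<open>card I\<close> times the squared norm, which the gap of the limit
  form absorbs.\<close>

lemma hyperbolic_eventually:
  assumes fin: "finite I" and sym: "\<And>s. sym_on I (M s)" "sym_on I M0"
    and h: "hyperbolic I M0 (\<lambda>_. 1)"
    and lim: "\<And>i j. i \<in> I \<Longrightarrow> j \<in> I \<Longrightarrow> ((\<lambda>s. M s i j) \<longlongrightarrow> M0 i j) F"
  shows "\<forall>\<^sub>F s in F. hyperbolic I (M s) (\<lambda>_. 1)"
proof -
  obtain g where g: "g > 0"
    "\<And>x. sum x I = 0 \<Longrightarrow> g * (\<Sum>i\<in>I. (x i)\<^sup>2) \<le> bform I (reduced I M0) x x"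
    using reduced_gap[OF fin sym(2) h] by blast
  \<comment> \<open>The summand 1 keeps the denominator positive for empty \<open>I\<close>.\<close>
  define \<delta> where "\<delta> = g / (2 * card I + 1)"
  have \<delta>: "\<delta> > 0" "\<delta> * card I < g"
    unfolding \<delta>_def using g(1) by (auto simp: field_simps add_pos_nonneg)
  have limT: "((\<lambda>s. bform I (M s) (\<lambda>_. 1) (\<lambda>_. 1)) \<longlongrightarrow> bform I M0 (\<lambda>_. 1) (\<lambda>_. 1)) F"
    unfolding bform_def by (intro tendsto_intros lim)
  have limN: "((\<lambda>s. reduced I (M s) i j) \<longlongrightarrow> reduced I M0 i j) F" if "i \<in> I" "j \<in> I" for i j
    unfolding reduced_def by (intro tendsto_intros lim limT that)
  have e1: "\<forall>\<^sub>F s in F. 0 < bform I (M s) (\<lambda>_. 1) (\<lambda>_. 1)"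
    using h limT by (auto simp: hyperbolic_def dest: order_tendstoD)
  have e2: "\<forall>\<^sub>F s in F. \<forall>i\<in>I. \<forall>j\<in>I. dist (reduced I (M s) i j) (reduced I M0 i j) < \<delta>"
    using limN \<delta>(1) by (intro eventually_ball_finite[OF fin] ballI tendstoD)
  from e1 e2 show ?thesis
  proof eventually_elim
    case (elim s)
    show ?case
    proof (rule reduced_pos_imp_hyperbolic[OF fin sym(1) elim(1)])
      fix x :: "'a \<Rightarrow> real" assume nz: "\<exists>i\<in>I. x i \<noteq> 0" and x: "sum x I = 0"
      let ?D = "\<lambda>i j. reduced I (M s) i j - reduced I M0 i j"
      obtain i where i: "i \<in> I" "x i \<noteq> 0" using nz by blast
      have S: "0 < (\<Sum>i\<in>I. (x i)\<^sup>2)" using i by (intro sum_pos2[OF fin i(1)]) auto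
      have "\<bar>bform I ?D x x\<bar> \<le> \<delta> * card I * (\<Sum>i\<in>I. (x i)\<^sup>2)"
        using elim(2) by (intro bform_bound) (auto simp: dist_real_def less_imp_le)
      also have "\<dots> < g * (\<Sum>i\<in>I. (x i)\<^sup>2)" using \<delta>(2) S by simp
      also have "\<dots> \<le> bform I (reduced I M0) x x" by (rule g(2)[OF x])
      finally have "\<bar>bform I ?D x x\<bar> < bform I (reduced I M0) x x" .
      moreover have "bform I (reduced I (M s)) x x = bform I (reduced I M0) x x + bform I ?D x x"
        unfolding bform_def by (simp add: algebra_simps flip: sum.distrib)
      ultimately show "0 < bform I (reduced I (M s)) x x" by linarith
    qed
  qed
qed

section \<open>Signature and hyperbolicity\<close>

text \<open>In the diagonalising coordinates, orthogonality of x to \<open>u\<close> equates the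
  product of their 0-th coordinates with the inner product of the remaining parts. Cauchy-Schwarz
  for these parts and the positivity of \<open>u\<close> force the 0-th coordinate of x below the
  length of its remaining part.\<close>

lemma has_signature_imp_hyperbolic:
  assumes sig: "has_signature n q 1 (n - 1)" and sym: "sym_on {..<n} M"
    and q: "\<And>x. eval_mpoly q x = bform {..<n} M x x / 2" and u: "0 < bform {..<n} M u u"
  shows "hyperbolic {..<n} M u"
proof -
  \<comment> \<open>As subtraction is truncated, the fact \<open>n\<close> says that n is positive,
    so that coordinate 0 exists.\<close>
  from sig obtain A where n: "1 + (n - 1) \<le> n" and A: "A \<in> carrier_mat n n" and inv: "invertible_mat A"
    and form: "\<And>y. y \<in> carrier_vec n \<Longrightarrow> eval_mpoly q (vec_index (A *\<^sub>v y)) =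
             (\<Sum>i<1. (vec_index y i)\<^sup>2) - (\<Sum>i=1..<1 + (n - 1). (vec_index y i)\<^sup>2)"
    unfolding has_signature_def by blast
  from inv obtain B where AB: "A * B = 1\<^sub>m n" and BA: "B * A = 1\<^sub>m (dim_row B)"
    using A unfolding invertible_mat_def inverts_mat_def by auto
  have B: "B \<in> carrier_mat n n"
    using A AB BA by (metis carrier_matD(2) carrier_matI index_mult_mat(2,3) index_one_mat(2,3))
  \<comment> \<open>The coordinates of x in the diagonalising basis; \<open>B\<close> is the inverse
    of \<open>A\<close>.\<close>
  define C where "C x i = (\<Sum>j<n. B $$ (i, j) * x j)" for x i
  have C: "vec_index (B *\<^sub>v vec n x) i = C x i" if "i < n" for x i
    using B that unfolding C_def by (simp add: scalar_prod_def lessThan_atLeast0 row_def)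
  have ACx: "A *\<^sub>v (B *\<^sub>v vec n x) = vec n x" for x
    using A B AB by (simp flip: assoc_mult_mat_vec)
  have diag: "bform {..<n} M x x = 2 * ((C x 0)\<^sup>2 - (\<Sum>i=1..<n. (C x i)\<^sup>2))" for x
  proof -
    have "bform {..<n} M x x = bform {..<n} M (vec_index (vec n x)) (vec_index (vec n x))"
      by (intro bform_cong) auto
    also have "\<dots> = 2 * eval_mpoly q (vec_index (A *\<^sub>v (B *\<^sub>v vec n x)))"
      unfolding q ACx by simp
    also have "eval_mpoly q (vec_index (A *\<^sub>v (B *\<^sub>v vec n x)))
        = (vec_index (B *\<^sub>v vec n x) 0)\<^sup>2 - (\<Sum>i=1..<n. (vec_index (B *\<^sub>v vec n x) i)\<^sup>2)"
      using B n by (subst form) auto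
    also have "(\<Sum>i=1..<n. (vec_index (B *\<^sub>v vec n x) i)\<^sup>2) = (\<Sum>i=1..<n. (C x i)\<^sup>2)"
      by (intro sum.cong refl) (simp only: C atLeastLessThan_iff)
    finally show ?thesis using C[of 0 x] n by simp
  qed
  have Clin: "C (\<lambda>i. 1 * x i + 1 * y i) i = C x i + C y i" for x y i
    unfolding C_def by (simp add: algebra_simps sum.distrib)
  have polar: "bform {..<n} M x y = 2 * (C x 0 * C y 0 - (\<Sum>i=1..<n. C x i * C y i))" for x y
  proof -
    have "(\<Sum>i=1..<n. (C x i + C y i)\<^sup>2)
        = (\<Sum>i=1..<n. (C x i)\<^sup>2) + (\<Sum>i=1..<n. (C y i)\<^sup>2) + 2 * (\<Sum>i=1..<n. C x i * C y i)"
      by (simp add: power2_sum sum.distrib sum_distrib_left mult.assoc)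
    then show ?thesis
      using diag[of "\<lambda>i. 1 * x i + 1 * y i"] unfolding bform_lincomb[OF sym] Clin diag[of x] diag[of y]
      by (simp add: power2_sum algebra_simps)
  qed
  show ?thesis
    unfolding hyperbolic_def
  proof (intro conjI allI impI u)
    fix x assume nz: "\<exists>i\<in>{..<n}. x i \<noteq> 0" and 0: "bform {..<n} M u x = 0"
    define X where "X = (\<Sum>i=1..<n. (C x i)\<^sup>2)"
    define U where "U = (\<Sum>i=1..<n. (C u i)\<^sup>2)"
    have X: "X \<ge> 0" unfolding X_def by (intro sum_nonneg) auto
    have U: "(C u 0)\<^sup>2 > U" using u unfolding diag U_def by simp
    have "C u 0 * C x 0 = (\<Sum>i=1..<n. C u i * C x i)" using 0 unfolding polar by simp
    then have CS: "(C u 0)\<^sup>2 * (C x 0)\<^sup>2 \<le> U * X"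
      using Cauchy_Schwarz_ineq_sum[of "C u" "C x" "{1..<n}"] unfolding U_def X_def
      by (simp flip: power_mult_distrib)
    have U0: "U \<ge> 0" unfolding U_def by (intro sum_nonneg) auto
    have "(C x 0)\<^sup>2 < X"
    proof (cases "X = 0")
      \<comment> \<open>The estimate in the other case relies on X > 0. Here all coordinates of x
        vanish, against \<open>nz\<close>.\<close>
      case True
      then have "(C u 0)\<^sup>2 * (C x 0)\<^sup>2 \<le> 0" using CS by simp
      moreover have "C u 0 \<noteq> 0" using U U0 by auto
      ultimately have "C x 0 = 0" by (simp add: mult_le_0_iff)
      moreover have "C x i = 0" if "1 \<le> i" "i < n" for i
        using True that unfolding X_def by (simp add: sum_nonneg_eq_0_iff)
      ultimately have "C x i = 0" if "i < n" for i
        using that by (cases "i = 0") auto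
      then have "B *\<^sub>v vec n x = 0\<^sub>v n" using B C by (intro eq_vecI) auto
      then have "vec n x = A *\<^sub>v 0\<^sub>v n" using ACx[of x] by simp
      also have "\<dots> = 0\<^sub>v n" using A by (intro eq_vecI) auto
      finally have "vec n x = 0\<^sub>v n" .
      then have "x i = 0" if "i < n" for i
        using that by (metis index_vec index_zero_vec(1))
      then show ?thesis using nz by auto
    next
      case False
      then have "X > 0" using X by simp
      show ?thesis
      proof (rule ccontr)
        assume "\<not> ?thesis"
        then have "U * X \<le> U * (C x 0)\<^sup>2" using U0 by (intro mult_left_mono) auto
        also have "\<dots> < (C u 0)\<^sup>2 * (C x 0)\<^sup>2"
          using U \<open>X > 0\<close> \<open>\<not> (C x 0)\<^sup>2 < X\<close> by (intro mult_strict_right_mono) auto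
        finally show False using CS by simp
      qed
    qed
    then show "bform {..<n} M x x < 0" unfolding diag X_def by simp
  qed
qed

text \<open>Completeness applied to coordinate vectors yields the dual orthogonality relations.
  Counting squared entries in two ways then shows that there are n eigenvectors.\<close>

lemma orthogonal_diagonalization:
  fixes M :: "nat \<Rightarrow> nat \<Rightarrow> real"
  assumes sym: "sym_on {..<n} M"
  obtains \<phi> \<mu> where
    "\<And>k l. k < n \<Longrightarrow> l < n \<Longrightarrow> (\<Sum>b<n. \<phi> k b * \<phi> l b) = (if k = l then 1 else 0)"
    "\<And>a b. a < n \<Longrightarrow> b < n \<Longrightarrow> (\<Sum>k<n. \<phi> k a * \<phi> k b) = (if a = b then 1 else 0)"
    "\<And>x. bform {..<n} M x x = (\<Sum>k<n. \<mu> k * (\<Sum>a<n. \<phi> k a * x a)\<^sup>2)"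
proof -
  obtain m \<phi> \<mu> where eb: "eigenbasis {..<n} M (\<lambda>_. 0) m \<phi> \<mu>"
    using spectral_theorem[OF finite_lessThan sym, of "\<lambda>_. 0" 0] by auto
  note s2 = eigenbasisD(2)[OF eb]
  have dual: "(\<Sum>k<m. \<phi> k a * \<phi> k b) = (if a = b then 1 else 0)" if "a < n" "b < n" for a b
    using eigenbasisD(4)[OF eb, of "\<lambda>i. if i = a then 1 else 0" b] that
    by (auto simp: if_distrib[of "\<lambda>t. _ * t"] cong: if_cong)
  have "real m = (\<Sum>k<m. \<Sum>b<n. \<phi> k b * \<phi> k b)" using s2 by simp
  also have "\<dots> = (\<Sum>b<n. \<Sum>k<m. \<phi> k b * \<phi> k b)" by (rule sum.swap)
  also have "\<dots> = real n" using dual by simp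
  finally have "m = n" by simp
  then show ?thesis using that[of \<phi> \<mu>] s2 dual eigenbasis_diagonal[OF eb sym] by simp
qed

lemma hyperbolic_imp_has_signature:
  assumes h: "hyperbolic {..<n} M u" and sym: "sym_on {..<n} M"
    and q: "\<And>x. eval_mpoly q x = bform {..<n} M x x / 2"
  shows "has_signature n q 1 (n - 1)"
proof -
  obtain \<phi> \<mu> where
    orth: "\<And>k l. k < n \<Longrightarrow> l < n \<Longrightarrow> (\<Sum>b<n. \<phi> k b * \<phi> l b) = (if k = l then 1 else 0)"
    and dual: "\<And>a b. a < n \<Longrightarrow> b < n \<Longrightarrow> (\<Sum>k<n. \<phi> k a * \<phi> k b) = (if a = b then 1 else 0 :: real)"
    and diag: "\<And>x. bform {..<n} M x x = (\<Sum>k<n. \<mu> k * (\<Sum>a<n. \<phi> k a * x a)\<^sup>2)"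
    by (rule orthogonal_diagonalization[OF sym], rule that)
  have synth: "(\<Sum>a<n. \<phi> l a * (\<Sum>k<n. c k * \<phi> k a)) = c l" if "l < n" for l c
  proof -
    have "(\<Sum>a<n. \<phi> l a * (\<Sum>k<n. c k * \<phi> k a)) = (\<Sum>k<n. c k * (\<Sum>a<n. \<phi> l a * \<phi> k a))"
      unfolding sum_distrib_left by (subst sum.swap) (simp add: algebra_simps)
    then show ?thesis using orth that by (simp add: if_distrib[of "\<lambda>t. _ * t"] cong: if_cong)
  qed
  have diag_synth: "bform {..<n} M (\<lambda>a. \<Sum>k<n. c k * \<phi> k a) (\<lambda>a. \<Sum>k<n. c k * \<phi> k a) = (\<Sum>k<n. \<mu> k * (c k)\<^sup>2)" for c
    unfolding diag using synth by simp
  have synth_nz: "\<exists>a\<in>{..<n}. (\<Sum>k<n. c k * \<phi> k a) \<noteq> 0" if "l < n" "c l \<noteq> 0" for c l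
  proof (rule ccontr)
    assume "\<not> ?thesis"
    then have "(\<Sum>a<n. \<phi> l a * (\<Sum>k<n. c k * \<phi> k a)) = 0" by (intro sum.neutral) auto
    then show False using synth[OF that(1), of c] that(2) by simp
  qed
  \<comment> \<open>Eigenvectors k and l with nonnegative eigenvalues would span a plane that meets
    the complement of \<open>u\<close> in a nonzero vector of nonnegative value.\<close>
  have two: "k = l" if kl: "k < n" "l < n" "\<mu> k \<ge> 0" "\<mu> l \<ge> 0" for k l
  proof (rule ccontr)
    assume ne: "k \<noteq> l"
    define r where "r = (\<lambda>k. bform {..<n} M u (\<phi> k))"
    have neg: "a\<^sup>2 * \<mu> k + b\<^sup>2 * \<mu> l < 0" if "a * r k + b * r l = 0" "a \<noteq> 0 \<or> b \<noteq> 0" for a b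
    proof -
      define c where "c = (\<lambda>j. if j = k then a else if j = l then b else 0)"
      have split: "(\<Sum>j<n. f j * c j) = f k * a + f l * b" for f :: "nat \<Rightarrow> real"
      proof -
        have "(\<Sum>j<n. f j * c j) = (\<Sum>j\<in>{k, l}. f j * c j)"
          using kl by (intro sum.mono_neutral_right) (auto simp: c_def)
        then show ?thesis using ne by (simp add: c_def)
      qed
      have x: "(\<Sum>j<n. c j * \<phi> j i) = a * \<phi> k i + b * \<phi> l i" for i
        using split[of "\<lambda>j. \<phi> j i"] by (simp add: mult.commute)
      have "bform {..<n} M u (\<lambda>a. \<Sum>j<n. c j * \<phi> j a) = 0"
        unfolding x bform_lincomb_right using that(1) by (simp add: r_def)
      moreover have "\<exists>i\<in>{..<n}. (\<Sum>j<n. c j * \<phi> j i) \<noteq> 0"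
        using that(2) synth_nz[of k c] synth_nz[of l c] kl ne by (auto simp: c_def)
      ultimately have "bform {..<n} M (\<lambda>a. \<Sum>j<n. c j * \<phi> j a) (\<lambda>a. \<Sum>j<n. c j * \<phi> j a) < 0"
        by (intro hypD[OF h])
      then have "(\<Sum>j<n. \<mu> j * (c j)\<^sup>2) < 0" by (simp only: diag_synth)
      then show ?thesis
        using split[of "\<lambda>j. \<mu> j * c j"] by (simp add: power2_eq_square c_def ne[symmetric] ne algebra_simps)
    qed
    have "(r l)\<^sup>2 * \<mu> k + (- r k)\<^sup>2 * \<mu> l \<ge> 0" using kl by simp
    then have "r l = 0 \<and> r k = 0" using neg[of "r l" "- r k"] by force
    then show False using neg[of 1 0] kl by simp
  qed
  have "\<exists>k0<n. \<mu> k0 > 0"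
  proof (rule ccontr)
    assume "\<not> ?thesis"
    then have "\<mu> k \<le> 0" if "k < n" for k using that by (meson not_less)
    then have "bform {..<n} M u u \<le> 0"
      unfolding diag by (intro sum_nonpos mult_nonpos_nonneg) auto
    then show False using h unfolding hyperbolic_def by simp
  qed
  then obtain k0 where k0: "k0 < n" "\<mu> k0 > 0" by blast
  have negk: "\<mu> k < 0" if "k < n" "k \<noteq> k0" for k
    using two[of k k0] k0 that by force
  \<comment> \<open>Exchanges 0 and \<open>k0\<close>, to put the positive eigenvalue first.\<close>
  define p where "p = (\<lambda>k. if k = 0 then k0 else if k = k0 then 0 else k)"
  have pp: "p (p k) = k" for k unfolding p_def by simp
  have pn: "p k < n" if "k < n" for k using that k0 unfolding p_def by auto
  have bij: "bij_betw p {..<n} {..<n}"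
    by (rule bij_betwI[of _ _ _ p]) (auto simp: pp pn)
  \<comment> \<open>Scales the eigenvalues to 1 and -1; the 2 compensates the factor 1/2 between
    \<open>q\<close> and \<open>M\<close>.\<close>
  define s where "s = (\<lambda>k. sqrt (2 / \<bar>\<mu> k\<bar>))"
  have mnz: "\<mu> k \<noteq> 0" if "k < n" for k using negk[OF that] k0 by (cases "k = k0") auto
  have spos: "s k > 0" if "k < n" for k unfolding s_def using mnz[OF that] by simp
  define A where "A = mat n n (\<lambda>(i, k). \<phi> (p k) i * s (p k))"
  define B where "B = mat n n (\<lambda>(k, i). \<phi> (p k) i / s (p k))"
  have A: "A \<in> carrier_mat n n" and B: "B \<in> carrier_mat n n" unfolding A_def B_def by auto
  have "A * B = 1\<^sub>m n"
  proof (rule eq_matI)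
    fix i j assume ij: "i < dim_row (1\<^sub>m n)" "j < dim_col (1\<^sub>m n)"
    have "(A * B) $$ (i, j) = (\<Sum>k<n. \<phi> (p k) i * s (p k) * (\<phi> (p k) j / s (p k)))"
      using ij by (simp add: A_def B_def scalar_prod_def lessThan_atLeast0)
    also have "\<dots> = (\<Sum>k<n. \<phi> (p k) i * \<phi> (p k) j)"
      using spos pn by (intro sum.cong refl) (auto simp: field_simps less_imp_neq[symmetric])
    also have "\<dots> = (\<Sum>k<n. \<phi> k i * \<phi> k j)" by (rule sum.reindex_bij_betw[OF bij])
    finally show "(A * B) $$ (i, j) = 1\<^sub>m n $$ (i, j)" using dual ij by simp
  qed (simp_all add: A_def B_def)
  moreover have "B * A = 1\<^sub>m n"
  proof (rule eq_matI)
    fix i j assume ij: "i < dim_row (1\<^sub>m n)" "j < dim_col (1\<^sub>m n)"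
    have "(B * A) $$ (i, j) = (\<Sum>a<n. \<phi> (p i) a / s (p i) * (\<phi> (p j) a * s (p j)))"
      using ij by (simp add: A_def B_def scalar_prod_def lessThan_atLeast0)
    also have "\<dots> = s (p j) / s (p i) * (\<Sum>a<n. \<phi> (p i) a * \<phi> (p j) a)"
      by (simp add: sum_distrib_left algebra_simps)
    also have "\<dots> = (if i = j then 1 else 0)"
    proof -
      have "p i = p j \<longleftrightarrow> i = j" using pp by metis
      then show ?thesis using orth pn spos[OF pn, of j] ij by simp
    qed
    finally show "(B * A) $$ (i, j) = 1\<^sub>m n $$ (i, j)" using ij by simp
  qed (simp_all add: A_def B_def)
  ultimately have inv: "invertible_mat A"
    unfolding invertible_mat_def inverts_mat_def using A B by (auto intro!: exI[of _ B])
  have "eval_mpoly q (vec_index (A *\<^sub>v y)) = (\<Sum>i<1. (vec_index y i)\<^sup>2) - (\<Sum>i=1..<1 + (n - 1). (vec_index y i)\<^sup>2)"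
    if y: "y \<in> carrier_vec n" for y
  proof -
    define c where "c = (\<lambda>k. s k * vec_index y (p k))"
    have "vec_index (A *\<^sub>v y) i = (\<Sum>k<n. c k * \<phi> k i)" if "i < n" for i
    proof -
      have "vec_index (A *\<^sub>v y) i = (\<Sum>k<n. \<phi> (p k) i * s (p k) * vec_index y (p (p k)))"
        unfolding pp using y that by (simp add: A_def scalar_prod_def lessThan_atLeast0)
      also have "\<dots> = (\<Sum>k<n. \<phi> k i * s k * vec_index y (p k))"
        by (rule sum.reindex_bij_betw[OF bij])
      finally show ?thesis by (simp add: c_def algebra_simps)
    qed
    then have "bform {..<n} M (vec_index (A *\<^sub>v y)) (vec_index (A *\<^sub>v y)) = (\<Sum>k<n. \<mu> k * (c k)\<^sup>2)"
      unfolding diag_synth[symmetric] by (intro bform_cong) auto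
    then have "eval_mpoly q (vec_index (A *\<^sub>v y)) = (\<Sum>k<n. \<mu> k * (c k)\<^sup>2 / 2)"
      unfolding q by (simp add: sum_divide_distrib)
    also have "\<dots> = (\<Sum>k<n. sgn (\<mu> k) * (vec_index y (p k))\<^sup>2)"
      unfolding c_def s_def using mnz
      by (intro sum.cong refl) (auto simp: power_mult_distrib sgn_if abs_if)
    also have "\<dots> = (\<Sum>k<n. sgn (\<mu> (p k)) * (vec_index y (p (p k)))\<^sup>2)"
      by (rule sum.reindex_bij_betw[OF bij, symmetric])
    also have "\<dots> = sgn (\<mu> (p 0)) * (vec_index y 0)\<^sup>2 + (\<Sum>k=1..<n. sgn (\<mu> (p k)) * (vec_index y k)\<^sup>2)"
      using k0 unfolding pp by (simp add: lessThan_atLeast0 sum.atLeast_Suc_lessThan)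
    also have "(\<Sum>k=1..<n. sgn (\<mu> (p k)) * (vec_index y k)\<^sup>2) = (\<Sum>k=1..<n. - (vec_index y k)\<^sup>2)"
    proof (intro sum.cong refl)
      fix k assume "k \<in> {1..<n}"
      then have "p k \<noteq> k0" "p k < n" using pn by (auto simp: p_def)
      then show "sgn (\<mu> (p k)) * (vec_index y k)\<^sup>2 = - (vec_index y k)\<^sup>2"
        using negk by simp
    qed
    also have "sgn (\<mu> (p 0)) = 1" using k0 by (simp add: p_def)
    finally show ?thesis using k0 by (simp add: sum_negf)
  qed
  then show ?thesis
    unfolding has_signature_def using A inv k0 by auto
qed

section \<open>Polynomials and their coefficients\<close>

abbreviation unit_mono :: "nat \<Rightarrow> monomial" where
  "unit_mono i \<equiv> Poly_Mapping.single i (Suc 0)"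

abbreviation mono_of_list :: "nat list \<Rightarrow> monomial" where
  "mono_of_list is \<equiv> sum_list (map unit_mono is)"

definition mono_of_set :: "nat set \<Rightarrow> monomial" where
  "mono_of_set B = (\<Sum>i\<in>B. unit_mono i)"

definition mfact :: "monomial \<Rightarrow> real" where
  "mfact m = (\<Prod>i\<in>Poly_Mapping.keys m. fact (Poly_Mapping.lookup m i))"

text \<open>The coefficient with respect to the divided powers w^m / m!. In this normalisation, a
  partial derivative is a mere shift of the exponent.\<close>

definition ncoeff :: "mpoly \<Rightarrow> monomial \<Rightarrow> real" where
  "ncoeff f m = mfact m * Poly_Mapping.lookup f m"

lemma lookup_add_unit_mono:
  "Poly_Mapping.lookup (m + unit_mono i) j = Poly_Mapping.lookup m j + (if j = i then 1 else 0)"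
  by (simp add: lookup_add lookup_single)

lemma mfact_superset:
  assumes "finite X" "Poly_Mapping.keys m \<subseteq> X"
  shows "mfact m = (\<Prod>i\<in>X. fact (Poly_Mapping.lookup m i))"
  unfolding mfact_def using assms
  by (intro prod.mono_neutral_left) (auto simp: in_keys_iff)

lemma mfact_pos: "mfact m > 0"
  unfolding mfact_def by (intro prod_pos) auto

lemma mfact_add_unit_mono:
  "mfact (m + unit_mono i) = real (Poly_Mapping.lookup m i + 1) * mfact m"
proof -
  let ?X = "insert i (Poly_Mapping.keys m)"
  have k: "Poly_Mapping.keys (m + unit_mono i) \<subseteq> ?X"
    using Poly_Mapping.keys_add[of m "unit_mono i"] by auto
  have "mfact (m + unit_mono i) = (\<Prod>j\<in>?X. fact (Poly_Mapping.lookup (m + unit_mono i) j))"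
    by (intro mfact_superset k) simp
  also have "\<dots> = (\<Prod>j\<in>?X. (if j = i then real (Poly_Mapping.lookup m i + 1) else 1) * fact (Poly_Mapping.lookup m j))"
    by (intro prod.cong refl) (simp add: lookup_add_unit_mono)
  also have "\<dots> = real (Poly_Mapping.lookup m i + 1) * (\<Prod>j\<in>?X. fact (Poly_Mapping.lookup m j))"
    by (simp only: prod.distrib) simp
  also have "(\<Prod>j\<in>?X. fact (Poly_Mapping.lookup m j)) = mfact m"
    by (rule mfact_superset[symmetric]) auto
  finally show ?thesis .
qed

lemma ncoeff_partial_deriv: "ncoeff (partial_deriv i f) m = ncoeff f (m + unit_mono i)"
  unfolding ncoeff_def mfact_add_unit_mono by (simp add: lookup_partial_deriv)

lemma ncoeff_foldr_partial_deriv: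
  "ncoeff (foldr partial_deriv is f) m = ncoeff f (m + mono_of_list is)"
  by (induction "is" arbitrary: m) (simp_all add: ncoeff_partial_deriv add.assoc)

lemma in_monomials_iff:
  "m \<in> monomials d n \<longleftrightarrow>
     Poly_Mapping.keys m \<subseteq> {..<n} \<and> (\<Sum>i<n. Poly_Mapping.lookup m i) = d"
proof (cases "Poly_Mapping.keys m \<subseteq> {..<n}")
  case True
  then have "(\<Sum>i\<in>Poly_Mapping.keys m. Poly_Mapping.lookup m i) = (\<Sum>i<n. Poly_Mapping.lookup m i)"
    by (intro sum.mono_neutral_left) (auto simp: in_keys_iff)
  then show ?thesis unfolding monomials_def by simp
qed (simp add: monomials_def)

lemma keys_add_unit_mono:
  "Poly_Mapping.keys (m + unit_mono i) = insert i (Poly_Mapping.keys m)"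
  by (auto simp: in_keys_iff lookup_add_unit_mono split: if_splits)

lemma add_unit_mono_in_monomials:
  "m + unit_mono i \<in> monomials (Suc d) n \<longleftrightarrow> m \<in> monomials d n \<and> i < n"
  unfolding in_monomials_iff keys_add_unit_mono
  by (auto simp: lookup_add_unit_mono sum.distrib)

lemma minus_unit_mono:
  assumes "Poly_Mapping.lookup m i \<noteq> 0"
  shows "m - unit_mono i + unit_mono i = m"
proof (rule poly_mapping_eqI)
  fix j
  show "Poly_Mapping.lookup (m - unit_mono i + unit_mono i) j = Poly_Mapping.lookup m j"
    using assms by (simp add: lookup_add_unit_mono lookup_minus lookup_single)
qed

lemma monomials_SucE:
  assumes "m \<in> monomials (Suc d) n"
  obtains i m' where "i < n" "m' \<in> monomials d n" "m = m' + unit_mono i"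
proof -
  have "(\<Sum>i<n. Poly_Mapping.lookup m i) \<noteq> 0" using assms unfolding in_monomials_iff by simp
  then obtain i where i: "i < n" "Poly_Mapping.lookup m i \<noteq> 0"
    by (metis lessThan_iff sum.neutral)
  show ?thesis
    using that[of i "m - unit_mono i"] minus_unit_mono[OF i(2)] i assms
      add_unit_mono_in_monomials[of "m - unit_mono i" i d n] by simp
qed

lemma monomials_0: "monomials 0 n = {0}"
proof -
  have "m = 0" if "m \<in> monomials 0 n" for m
  proof (rule poly_mapping_eqI)
    fix i show "Poly_Mapping.lookup m i = Poly_Mapping.lookup 0 i"
      using that unfolding in_monomials_iff by (cases "i < n") (auto simp: in_keys_iff)
  qed
  then show ?thesis by (auto simp: in_monomials_iff)
qed

lemma finite_monomials: "finite (monomials d n)"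
proof (induction d)
  case (Suc d)
  have "monomials (Suc d) n \<subseteq> (\<lambda>(i, m). m + unit_mono i) ` ({..<n} \<times> monomials d n)"
    by (auto elim!: monomials_SucE)
  then show ?case using Suc finite_subset by blast
qed (simp add: monomials_0)

lemma mono_of_list_in_monomials:
  "set is \<subseteq> {..<n} \<Longrightarrow> mono_of_list is \<in> monomials (length is) n"
proof (induction "is")
  case (Cons i "is")
  then show ?case
    using add_unit_mono_in_monomials[of "mono_of_list is" i "length is" n] by (simp add: add.commute)
qed (simp add: monomials_0)

lemma monomials_ex_list:
  assumes "m \<in> monomials d n"
  shows "\<exists>is. length is = d \<and> set is \<subseteq> {..<n} \<and> mono_of_list is = m"
  using assms
proof (induction d arbitrary: m)
  case (Suc d)
  then obtain i m' where i: "i < n" "m' \<in> monomials d n" "m = m' + unit_mono i"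
    by (elim monomials_SucE)
  with Suc.IH[of m'] obtain "is" where "length is = d" "set is \<subseteq> {..<n}" "mono_of_list is = m'"
    by blast
  with i show ?case by (intro exI[of _ "i # is"]) (auto simp: add.commute)
qed (simp add: monomials_0)

lemma lookup_mono_of_list: "Poly_Mapping.lookup (mono_of_list is) i = count (mset is) i"
  by (induction "is") (auto simp: lookup_add lookup_single)

lemma mono_of_list_eq_iff: "mono_of_list is = mono_of_list js \<longleftrightarrow> mset is = mset js"
proof
  assume "mono_of_list is = mono_of_list js"
  then show "mset is = mset js"
    by (intro multiset_eqI) (simp flip: lookup_mono_of_list)
next
  assume "mset is = mset js"
  then show "mono_of_list is = mono_of_list js"
    by (intro poly_mapping_eqI) (simp add: lookup_mono_of_list)
qed

lemma mono_of_set_insert: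
  "finite B \<Longrightarrow> i \<notin> B \<Longrightarrow> mono_of_set (insert i B) = unit_mono i + mono_of_set B"
  unfolding mono_of_set_def by simp

lemma mono_of_list_distinct: "distinct is \<Longrightarrow> mono_of_list is = mono_of_set (set is)"
  unfolding mono_of_set_def by (rule sum_list_distinct_conv_sum_set)

lemma lookup_mono_of_set:
  "finite B \<Longrightarrow> Poly_Mapping.lookup (mono_of_set B) i = (if i \<in> B then 1 else 0)"
  unfolding mono_of_set_def by (simp add: lookup_sum lookup_single when_def)

lemma keys_mono_of_set: "finite B \<Longrightarrow> Poly_Mapping.keys (mono_of_set B) = B"
  by (auto simp: in_keys_iff lookup_mono_of_set split: if_splits)

lemma mfact_mono_of_set: "finite B \<Longrightarrow> mfact (mono_of_set B) = 1"
  unfolding mfact_def by (simp add: keys_mono_of_set lookup_mono_of_set)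

lemma mono_of_set_in_monomials:
  assumes "B \<subseteq> {..<n}"
  shows "mono_of_set B \<in> monomials d n \<longleftrightarrow> card B = d"
proof -
  have "finite B" using assms finite_subset by blast
  then show ?thesis
    using assms unfolding monomials_def by (simp add: keys_mono_of_set lookup_mono_of_set)
qed

lemma mono_of_set_inj:
  "finite B \<Longrightarrow> finite C \<Longrightarrow> mono_of_set B = mono_of_set C \<Longrightarrow> B = C"
  by (metis keys_mono_of_set)

lemma multiaffine_monomial:
  assumes "\<And>i. Poly_Mapping.lookup m i \<le> 1"
  shows "m = mono_of_set (Poly_Mapping.keys m)"
proof (rule poly_mapping_eqI)
  fix i
  show "Poly_Mapping.lookup m i = Poly_Mapping.lookup (mono_of_set (Poly_Mapping.keys m)) i"
    using assms[of i] by (auto simp: lookup_mono_of_set in_keys_iff)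
qed

lemma homogeneousD:
  "f \<in> homogeneous d n \<Longrightarrow> Poly_Mapping.lookup f m \<noteq> 0 \<Longrightarrow> m \<in> monomials d n"
  unfolding homogeneous_def by (auto simp: in_keys_iff)

lemma homogeneous_partial_deriv:
  assumes "f \<in> homogeneous (Suc d) n"
  shows "partial_deriv i f \<in> homogeneous d n"
  unfolding homogeneous_def
proof (intro CollectI subsetI)
  fix m assume "m \<in> Poly_Mapping.keys (partial_deriv i f)"
  then have "Poly_Mapping.lookup f (m + unit_mono i) \<noteq> 0"
    by (simp add: in_keys_iff lookup_partial_deriv)
  from homogeneousD[OF assms this] show "m \<in> monomials d n"
    by (simp add: add_unit_mono_in_monomials)
qed

lemma homogeneous_foldr_partial_deriv:
  "f \<in> homogeneous (length is + d) n \<Longrightarrow> foldr partial_deriv is f \<in> homogeneous d n"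
  by (induction "is" arbitrary: d) (auto simp: homogeneous_partial_deriv)

lemma eval_mpoly_homogeneous:
  assumes "f \<in> homogeneous d n"
  shows "eval_mpoly f x =
    (\<Sum>m\<in>monomials d n. Poly_Mapping.lookup f m * (\<Prod>i<n. x i ^ Poly_Mapping.lookup m i))"
proof -
  have "eval_mpoly f x =
      (\<Sum>m\<in>Poly_Mapping.keys f. Poly_Mapping.lookup f m * (\<Prod>i<n. x i ^ Poly_Mapping.lookup m i))"
    unfolding eval_mpoly_def
  proof (intro sum.cong refl arg_cong2[of _ _ _ _ "(*)"] prod.mono_neutral_left)
    fix m assume "m \<in> Poly_Mapping.keys f"
    then show "Poly_Mapping.keys m \<subseteq> {..<n}"
      using assms unfolding homogeneous_def monomials_def by auto
  qed (auto simp: in_keys_iff)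
  also have "\<dots> = (\<Sum>m\<in>monomials d n. Poly_Mapping.lookup f m * (\<Prod>i<n. x i ^ Poly_Mapping.lookup m i))"
    using assms finite_monomials unfolding homogeneous_def
    by (intro sum.mono_neutral_left) (auto simp: in_keys_iff)
  finally show ?thesis .
qed

lemma eval_mpoly_0:
  assumes "f \<in> homogeneous 0 n"
  shows "eval_mpoly f x = ncoeff f 0"
  unfolding eval_mpoly_homogeneous[OF assms] by (simp add: monomials_0 ncoeff_def mfact_def)

text \<open>Differentiating by a variable and multiplying by it again scales a monomial by its
  exponent there, and the exponents sum to the degree.\<close>

lemma Euler_identity:
  assumes f: "f \<in> homogeneous (Suc d) n"
  shows "real (Suc d) * eval_mpoly f x = (\<Sum>i<n. x i * eval_mpoly (partial_deriv i f) x)"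
proof -
  define X where "X m = (\<Prod>i<n. x i ^ Poly_Mapping.lookup m i)" for m
  define g where "g i m = real (Poly_Mapping.lookup m i) * (Poly_Mapping.lookup f m * X m)" for i m
  have X: "X (m + unit_mono i) = x i * X m" if "i < n" for i m
  proof -
    have "X (m + unit_mono i) = (\<Prod>j<n. (if j = i then x i else 1) * x j ^ Poly_Mapping.lookup m j)"
      unfolding X_def by (intro prod.cong refl) (simp add: lookup_add_unit_mono)
    then show ?thesis unfolding X_def using that by (simp add: prod.distrib)
  qed
  have "x i * eval_mpoly (partial_deriv i f) x = (\<Sum>m\<in>monomials (Suc d) n. g i m)" if i: "i < n" for i
  proof -
    have "x i * eval_mpoly (partial_deriv i f) x = (\<Sum>m\<in>monomials d n. g i (m + unit_mono i))"
      unfolding eval_mpoly_homogeneous[OF homogeneous_partial_deriv[OF f]] sum_distrib_left g_def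
        X[OF i] lookup_partial_deriv
      by (intro sum.cong refl) (simp add: X_def lookup_add_unit_mono)
    also have "\<dots> = (\<Sum>m\<in>(\<lambda>m. m + unit_mono i) ` monomials d n. g i m)"
      by (subst sum.reindex) (auto intro: inj_onI)
    also have "\<dots> = (\<Sum>m\<in>monomials (Suc d) n. g i m)"
    proof (rule sum.mono_neutral_left[OF finite_monomials])
      show "(\<lambda>m. m + unit_mono i) ` monomials d n \<subseteq> monomials (Suc d) n"
        using i by (auto simp: add_unit_mono_in_monomials)
      show "\<forall>m\<in>monomials (Suc d) n - (\<lambda>m. m + unit_mono i) ` monomials d n. g i m = 0"
      proof
        fix m assume m: "m \<in> monomials (Suc d) n - (\<lambda>m. m + unit_mono i) ` monomials d n"
        have "Poly_Mapping.lookup m i = 0"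
        proof (rule ccontr)
          assume "Poly_Mapping.lookup m i \<noteq> 0"
          from minus_unit_mono[OF this] m show False
            by (metis DiffE add_unit_mono_in_monomials imageI)
        qed
        then show "g i m = 0" by (simp add: g_def)
      qed
    qed
    finally show ?thesis .
  qed
  then have "(\<Sum>i<n. x i * eval_mpoly (partial_deriv i f) x)
      = (\<Sum>m\<in>monomials (Suc d) n. \<Sum>i<n. g i m)"
    by (subst sum.swap) simp
  also have "\<dots> = (\<Sum>m\<in>monomials (Suc d) n. real (Suc d) * (Poly_Mapping.lookup f m * X m))"
    unfolding g_def by (intro sum.cong refl)
      (simp add: in_monomials_iff flip: sum_distrib_right of_nat_sum)
  also have "\<dots> = real (Suc d) * eval_mpoly f x"
    unfolding eval_mpoly_homogeneous[OF f] X_def by (simp add: sum_distrib_left)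
  finally show ?thesis by simp
qed

text \<open>Euler's identity applied twice; the second derivatives of a quadratic polynomial are
  constant.\<close>

lemma eval_mpoly_quadratic:
  assumes q: "q \<in> homogeneous 2 n"
  shows "eval_mpoly q x = bform {..<n} (\<lambda>i j. ncoeff q (unit_mono i + unit_mono j)) x x / 2"
proof -
  have q2: "q \<in> homogeneous (Suc (Suc 0)) n" using q by (simp add: numeral_2_eq_2)
  have "eval_mpoly (partial_deriv i q) x = (\<Sum>j<n. ncoeff q (unit_mono i + unit_mono j) * x j)" for i
  proof -
    have 1: "partial_deriv i q \<in> homogeneous (Suc 0) n" by (rule homogeneous_partial_deriv[OF q2])
    have "eval_mpoly (partial_deriv i q) x = (\<Sum>j<n. x j * eval_mpoly (partial_deriv j (partial_deriv i q)) x)"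
      using Euler_identity[OF 1, of x] by simp
    also have "\<dots> = (\<Sum>j<n. ncoeff q (unit_mono i + unit_mono j) * x j)"
      by (simp add: eval_mpoly_0[OF homogeneous_partial_deriv[OF 1]] ncoeff_partial_deriv add.commute mult.commute)
    finally show ?thesis .
  qed
  then show ?thesis
    using Euler_identity[OF q2, of x] unfolding bform_rows by simp
qed

text \<open>The Hessian of the iterated derivative of \<open>f\<close> along \<open>is\<close>; it
  is constant if \<open>f\<close> is homogeneous of degree \<open>length is + 2\<close>.\<close>

definition hessian :: "mpoly \<Rightarrow> nat list \<Rightarrow> nat \<Rightarrow> nat \<Rightarrow> real" where
  "hessian f is i j = ncoeff f (unit_mono i + unit_mono j + mono_of_list is)"

lemma sym_on_hessian: "sym_on I (hessian f is)"
  unfolding sym_on_def hessian_def by (simp add: add.commute)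

lemma has_signature_iff_hyperbolic:
  assumes f: "f \<in> homogeneous (length is + 2) n"
    and u: "0 < bform {..<n} (hessian f is) u u"
  shows "has_signature n (foldr partial_deriv is f) 1 (n - 1) \<longleftrightarrow> hyperbolic {..<n} (hessian f is) u"
proof -
  let ?q = "foldr partial_deriv is f"
  have "?q \<in> homogeneous 2 n" using homogeneous_foldr_partial_deriv f by blast
  then have q: "eval_mpoly ?q x = bform {..<n} (hessian f is) x x / 2" for x
    by (simp add: eval_mpoly_quadratic ncoeff_foldr_partial_deriv hessian_def[abs_def])
  show ?thesis
    using has_signature_imp_hyperbolic[OF _ sym_on_hessian q u] hyperbolic_imp_has_signature[OF _ sym_on_hessian q]
    by blast
qed

section \<open>The multiaffine part of a strictly Lorentzian polynomial\<close>

lemma bform_restrict: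
  assumes "finite J" "I \<subseteq> J"
  shows "bform J M (\<lambda>i. if i \<in> I then x i else 0) (\<lambda>i. if i \<in> I then y i else 0) = bform I M x y"
proof -
  have "bform I M x y = bform I M (\<lambda>i. if i \<in> I then x i else 0) (\<lambda>i. if i \<in> I then y i else 0)"
    by (intro bform_cong) auto
  also have "\<dots> = bform J M (\<lambda>i. if i \<in> I then x i else 0) (\<lambda>i. if i \<in> I then y i else 0)"
    unfolding bform_rows using assms
    by (intro sum.mono_neutral_cong_left ballI arg_cong2[of _ _ _ _ "(*)"] refl) auto
  finally show ?thesis by simp
qed

lemma bform_pos:
  assumes "finite I" "k \<in> I" "l \<in> I" "0 < M k l * x k * y l"
    "\<And>i j. i \<in> I \<Longrightarrow> j \<in> I \<Longrightarrow> 0 \<le> M i j * x i * y j"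
  shows "0 < bform I M x y"
proof -
  have "0 < (\<Sum>j\<in>I. M k j * x k * y j)"
    using assms by (intro sum_pos2[of I l]) auto
  then show ?thesis
    unfolding bform_def by (rule sum_pos2[OF assms(1,2)]) (auto intro!: sum_nonneg assms(5))
qed

lemma card_ge_2E:
  assumes "2 \<le> card I"
  obtains k l where "k \<in> I" "l \<in> I" "k \<noteq> l"
proof -
  have "\<not> (\<forall>k\<in>I. \<forall>l\<in>I. k = l)"
    using assms card_le_Suc0_iff_eq[of I] card_ge_0_finite[of I] by force
  then show ?thesis using that by blast
qed

text \<open>Passing to the multiaffine part deletes the diagonal. If the off-diagonal form were
  nonnegative at an x orthogonal to the all-ones vector, it would be nonnegative on the span of
  both, and so would \<open>M\<close>, which adds a positive diagonal. But this plane contains a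
  nonzero vector that is \<open>M\<close>-orthogonal to the indicator of \<open>I\<close>, and there
  \<open>M\<close> is negative.\<close>

lemma hyperbolic_drop_diagonal:
  assumes J: "finite J" "I \<subseteq> J" "2 \<le> card I" and sym: "sym_on J M"
    and pos: "\<And>i j. i \<in> I \<Longrightarrow> j \<in> I \<Longrightarrow> 0 < M i j"
    and h: "hyperbolic J M (\<lambda>i. if i \<in> I then 1 else 0)"
  shows "hyperbolic I (\<lambda>i j. if i = j then 0 else M i j) (\<lambda>_. 1)"
proof -
  let ?L = "\<lambda>i j. if i = j then 0 else M i j" and ?u = "\<lambda>i. if i \<in> I then 1 else 0 :: real"
  have I: "finite I" using J finite_subset by blast
  have symL: "sym_on I ?L" using sym J unfolding sym_on_def by auto
  have diag: "bform I M x x = bform I ?L x x + (\<Sum>i\<in>I. M i i * (x i)\<^sup>2)" for x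
  proof -
    have "bform I M x x = (\<Sum>i\<in>I. \<Sum>j\<in>I. ?L i j * x i * x j + (if j = i then M i i * (x i)\<^sup>2 else 0))"
      unfolding bform_def by (intro sum.cong refl) (auto simp: power2_eq_square)
    then show ?thesis unfolding bform_def using I by (simp add: sum.distrib)
  qed
  obtain k l where kl: "k \<in> I" "l \<in> I" "k \<noteq> l" using J(3) by (rule card_ge_2E)
  have T: "0 < bform I ?L (\<lambda>_. 1) (\<lambda>_. 1)"
    using kl pos I less_imp_le[OF pos] by (intro bform_pos[of I k l]) auto
  show ?thesis
    unfolding hyperbolic_def
  proof (intro conjI allI impI T, rule ccontr)
    fix x assume nz: "\<exists>i\<in>I. x i \<noteq> 0" and 0: "bform I ?L (\<lambda>_. 1) x = 0"
      and neg: "\<not> bform I ?L x x < 0"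
    let ?x = "\<lambda>i. if i \<in> I then x i else 0"
    define a where "a = bform J M ?u ?u"
    define b where "b = bform J M ?u ?x"
    define y where "y = (\<lambda>i. a * x i + (- b) * 1)"
    have a: "a > 0" using h unfolding hyperbolic_def a_def by blast
    have y: "(\<lambda>i. if i \<in> I then y i else 0) = (\<lambda>i. a * ?x i + (- b) * ?u i)"
      unfolding y_def by auto
    have "\<exists>i\<in>I. y i \<noteq> 0"
    proof (rule ccontr)
      assume n: "\<not> ?thesis"
      then have xc: "x i = b / a" if "i \<in> I" for i
        using that a unfolding y_def by (auto simp: field_simps)
      then have "bform I ?L (\<lambda>_. 1) x = bform I ?L (\<lambda>_. 1) (\<lambda>i. (b / a) * 1)"
        by (intro bform_cong) auto
      then have "b = 0" using 0 T a unfolding bform_scale_right by simp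
      then show False using xc nz by auto
    qed
    then have "\<exists>i\<in>J. (if i \<in> I then y i else 0) \<noteq> 0" using J(2) by auto
    moreover have "bform J M ?u (\<lambda>i. if i \<in> I then y i else 0) = 0"
      unfolding y bform_lincomb_right a_def b_def by simp
    ultimately have "bform J M (\<lambda>i. if i \<in> I then y i else 0) (\<lambda>i. if i \<in> I then y i else 0) < 0"
      by (rule hypD[OF h])
    then have "bform I M y y < 0" using bform_restrict[OF J(1,2), of M y y] by linarith
    moreover have "bform I ?L y y = a\<^sup>2 * bform I ?L x x + b\<^sup>2 * bform I ?L (\<lambda>_. 1) (\<lambda>_. 1)"
      unfolding y_def using bform_lincomb[OF symL, of a x "- b" "\<lambda>_. 1"] 0 bform_commute[OF symL, of x "\<lambda>_. 1"]
      by simp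
    moreover have "0 \<le> a\<^sup>2 * bform I ?L x x + b\<^sup>2 * bform I ?L (\<lambda>_. 1) (\<lambda>_. 1)"
      using neg T by simp
    moreover have "0 \<le> (\<Sum>i\<in>I. M i i * (y i)\<^sup>2)"
      using pos by (intro sum_nonneg mult_nonneg_nonneg) (auto simp: less_imp_le)
    ultimately show False unfolding diag by linarith
  qed
qed

text \<open>The Hessian of the derivative along the variables in \<open>A\<close> of the multiaffine
  polynomial with coefficients \<open>c\<close>; multiaffinity makes the diagonal 0.\<close>

definition link_form :: "(nat set \<Rightarrow> real) \<Rightarrow> nat set \<Rightarrow> nat \<Rightarrow> nat \<Rightarrow> real" where
  "link_form c A i j = (if i = j then 0 else c (insert i (insert j A)))"

text \<open>
  The strictly Lorentzian condition within the multiaffine polynomials; \<open>c B\<close> is the coefficient of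
  the product of the variables in \<open>B\<close>.
\<close>

definition strict_Lor :: "nat set \<Rightarrow> nat \<Rightarrow> (nat set \<Rightarrow> real) \<Rightarrow> bool" where
  "strict_Lor E d c \<longleftrightarrow>
     (\<forall>B. B \<subseteq> E \<longrightarrow> card B = d \<longrightarrow> 0 < c B) \<and>
     (\<forall>A. A \<subseteq> E \<longrightarrow> card A + 2 = d \<longrightarrow> hyperbolic (E - A) (link_form c A) (\<lambda>_. 1))"

lemma strict_Lor_pos: "strict_Lor E d c \<Longrightarrow> B \<subseteq> E \<Longrightarrow> card B = d \<Longrightarrow> 0 < c B"
  unfolding strict_Lor_def by simp

lemma strict_Lor_hyperbolic:
  "strict_Lor E d c \<Longrightarrow> A \<subseteq> E \<Longrightarrow> card A + 2 = d \<Longrightarrow> hyperbolic (E - A) (link_form c A) (\<lambda>_. 1)"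
  unfolding strict_Lor_def by simp

lemma sym_on_link_form: "sym_on I (link_form c A)"
  unfolding sym_on_def link_form_def by (simp add: insert_commute)

lemma link_form_pos:
  assumes c: "\<And>B. B \<subseteq> E \<Longrightarrow> card B = d \<Longrightarrow> 0 < c B"
    and A: "finite E" "A \<subseteq> E" "card A + 2 = d" and ij: "i \<in> E - A" "j \<in> E - A" "i \<noteq> j"
  shows "0 < link_form c A i j"
proof -
  have "card (insert i (insert j A)) = d"
    using A ij finite_subset[OF A(2,1)] by simp
  then show ?thesis unfolding link_form_def using A ij by (auto intro!: c)
qed

lemma bform_link_form_ones_pos:
  assumes c: "\<And>B. B \<subseteq> E \<Longrightarrow> card B = d \<Longrightarrow> 0 < c B"
    and A: "finite E" "A \<subseteq> E" "card A + 2 = d" and d: "d \<le> card E"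
  shows "0 < bform (E - A) (link_form c A) (\<lambda>_. 1) (\<lambda>_. 1)"
proof -
  have "2 \<le> card (E - A)" using A d finite_subset[OF A(2,1)] by (simp add: card_Diff_subset)
  then obtain k l where "k \<in> E - A" "l \<in> E - A" "k \<noteq> l" by (rule card_ge_2E)
  moreover have "0 < link_form c A i j" if "i \<in> E - A" "j \<in> E - A" "i \<noteq> j" for i j
    by (rule link_form_pos[of E d, OF _ A that]) (rule c)
  moreover have "0 \<le> link_form c A i j" if "i \<in> E - A" "j \<in> E - A" for i j
    using calculation(4)[OF that] by (cases "i = j") (auto simp: link_form_def)
  ultimately show ?thesis
    using A by (intro bform_pos[of _ k l]) auto
qed

text \<open>Differentiating along the elements of \<open>A\<close> gives a Hessian on all n
  variables with positive entries. Its restriction to the complement of \<open>A\<close>, with the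
  diagonal deleted, is \<open>link_form\<close>.\<close>

lemma strictly_Lorentzian_imp_strict_Lor:
  assumes f: "strictly_Lorentzian d n f" and d: "d \<le> n"
  shows "strict_Lor {..<n} d (\<lambda>B. Poly_Mapping.lookup f (mono_of_set B))"
proof -
  let ?c = "\<lambda>B. Poly_Mapping.lookup f (mono_of_set B)"
  have pos: "0 < Poly_Mapping.lookup f m" if "m \<in> monomials d n" for m
    using f that unfolding strictly_Lorentzian_def by blast
  have "hyperbolic ({..<n} - A) (link_form ?c A) (\<lambda>_. 1)" if A: "A \<subseteq> {..<n}" "card A + 2 = d" for A
  proof -
    let ?I = "{..<n} - A"
    have fA: "finite A" using A finite_subset by blast
    define xs where "xs = sorted_list_of_set A"
    have xs: "set xs = A" "distinct xs" "length xs = card A"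
      unfolding xs_def using fA by auto
    have hf: "f \<in> homogeneous (length xs + 2) n"
      using f A xs unfolding strictly_Lorentzian_def by simp
    have hpos: "0 < hessian f xs i j" if "i < n" "j < n" for i j
    proof -
      have "mono_of_list (i # j # xs) \<in> monomials d n"
        using mono_of_list_in_monomials[of "i # j # xs" n] that xs A by simp
      then show ?thesis
        unfolding hessian_def ncoeff_def using pos mfact_pos by (simp add: add.assoc)
    qed
    have n2: "2 \<le> card ?I" using A d fA by (simp add: card_Diff_subset)
    then obtain k where k: "k \<in> ?I" by (rule card_ge_2E)
    have one: "0 < bform {..<n} (hessian f xs) (\<lambda>_. 1) (\<lambda>_. 1)"
      using k hpos by (intro bform_pos[of _ k k]) (auto simp: less_imp_le)
    have ind: "0 < bform {..<n} (hessian f xs) (\<lambda>i. if i \<in> ?I then 1 else 0) (\<lambda>i. if i \<in> ?I then 1 else 0)"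
      using k hpos by (intro bform_pos[of _ k k]) (auto simp: less_imp_le)
    have "has_signature n (foldr partial_deriv xs f) 1 (n - 1)"
      using f A xs unfolding strictly_Lorentzian_def by auto
    then have "hyperbolic {..<n} (hessian f xs) (\<lambda>_. 1)"
      using has_signature_iff_hyperbolic[OF hf one] by simp
    \<comment> \<open>The new reference vector is supported off \<open>A\<close>, as the restriction
      to that complement requires.\<close>
    then have "hyperbolic {..<n} (hessian f xs) (\<lambda>i. if i \<in> ?I then 1 else 0)"
      by (rule hyperbolic_change_reference[OF sym_on_hessian _ ind])
    then have H: "hyperbolic ?I (\<lambda>i j. if i = j then 0 else hessian f xs i j) (\<lambda>_. 1)"
      using n2 hpos sym_on_hessian by (intro hyperbolic_drop_diagonal[of "{..<n}"]) auto
    have eq: "(if i = j then 0 else hessian f xs i j) = link_form ?c A i j"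
      if "i \<in> ?I" "j \<in> ?I" for i j
    proof (cases "i = j")
      case False
      have "unit_mono i + unit_mono j + mono_of_list xs = mono_of_set (insert i (insert j A))"
        using that xs fA False by (simp add: mono_of_list_distinct mono_of_set_insert add.assoc)
      then show ?thesis
        using False fA by (simp add: hessian_def link_form_def ncoeff_def mfact_mono_of_set)
    qed (simp add: link_form_def)
    show ?thesis using H hyperbolic_cong[of ?I, OF eq] by simp
  qed
  moreover have "0 < ?c B" if "B \<subseteq> {..<n}" "card B = d" for B
    using pos mono_of_set_in_monomials that by blast
  ultimately show ?thesis unfolding strict_Lor_def by blast
qed

section \<open>Hyperbolicity of directional derivatives\<close>

text \<open>The coefficient at \<open>B\<close> of the derivative in direction \<open>v\<close> of
  the multiaffine polynomial with coefficients \<open>c\<close>.\<close>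

definition dderiv :: "nat set \<Rightarrow> (nat \<Rightarrow> real) \<Rightarrow> (nat set \<Rightarrow> real) \<Rightarrow> nat set \<Rightarrow> real" where
  "dderiv E v c B = (\<Sum>i\<in>E - B. v i * c (insert i B))"

lemma foldr_dderiv_Cons:
  "foldr (dderiv E) (v # vs) c B = (\<Sum>i\<in>E - B. v i * foldr (dderiv E) vs c (insert i B))"
  unfolding foldr.simps o_apply by (rule dderiv_def)

lemma dderiv_dderiv:
  assumes "finite E"
  shows "dderiv E v (dderiv E w c) B = bform (E - B) (link_form c B) v w"
  unfolding bform_rows
proof (subst dderiv_def, intro sum.cong refl arg_cong2[of _ _ _ _ "(*)"])
  fix i assume i: "i \<in> E - B"
  have "dderiv E w c (insert i B) = (\<Sum>j\<in>E - B - {i}. link_form c B i j * w j)"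
    unfolding dderiv_def by (intro sum.cong) (auto simp: link_form_def insert_commute)
  also have "\<dots> = (\<Sum>j\<in>E - B. link_form c B i j * w j)"
    using assms by (intro sum.mono_neutral_left) (auto simp: link_form_def)
  finally show "dderiv E w c (insert i B) = (\<Sum>j\<in>E - B. link_form c B i j * w j)" .
qed

lemma dderiv_commute:
  "finite E \<Longrightarrow> dderiv E v (dderiv E w c) = dderiv E w (dderiv E v c)"
  by (rule ext) (simp only: dderiv_dderiv bform_commute[OF sym_on_link_form, of _ _ _ v w])

text \<open>The partial derivative by variable k commutes with directional derivatives. After it, k
  no longer occurs, so the remaining sums run over \<open>E - {k}\<close>. This feeds the induction
  on the number of directions.\<close>

lemma foldr_dderiv_link:
  assumes "k \<in> E" "B \<subseteq> E - {k}"
  shows "foldr (dderiv E) vs c (insert k B) =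
    foldr (dderiv (E - {k})) vs (\<lambda>B. c (insert k B)) B"
  using assms(2)
proof (induction vs arbitrary: B)
  case (Cons v vs)
  have E: "E - insert k B = E - {k} - B" by blast
  have "foldr (dderiv E) vs c (insert i (insert k B)) =
      foldr (dderiv (E - {k})) vs (\<lambda>B. c (insert k B)) (insert i B)" if "i \<in> E - {k} - B" for i
    unfolding insert_commute[of i k] using Cons.prems that by (intro Cons.IH) auto
  then show ?case unfolding foldr_dderiv_Cons E by simp
qed simp

lemma foldr_dderiv_pos:
  assumes E: "finite E" and c: "\<And>B. B \<subseteq> E \<Longrightarrow> card B = d \<Longrightarrow> 0 < c B" and d: "d \<le> card E"
    and vs: "\<And>v i. v \<in> set vs \<Longrightarrow> i \<in> E \<Longrightarrow> 0 < v i" and B: "B \<subseteq> E" "card B + length vs = d"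
  shows "0 < foldr (dderiv E) vs c B"
  using vs B
proof (induction vs arbitrary: B)
  case (Cons v vs)
  have fB: "finite B" using Cons.prems E finite_subset by blast
  have pos: "0 < v i * foldr (dderiv E) vs c (insert i B)" if "i \<in> E - B" for i
    using Cons.prems that fB by (intro mult_pos_pos Cons.IH) auto
  have "card (E - B) \<noteq> 0"
    using Cons.prems d fB by (simp add: card_Diff_subset)
  then obtain i where "i \<in> E - B" by (metis all_not_in_conv card.empty)
  then show ?case
    unfolding foldr_dderiv_Cons using pos E less_imp_le[OF pos] by (intro sum_pos2[of _ i]) auto
qed (use c in simp)

lemma strict_Lor_link:
  assumes s: "strict_Lor E (Suc d) c" and E: "finite E" and k: "k \<in> E"
  shows "strict_Lor (E - {k}) d (\<lambda>B. c (insert k B))"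
  unfolding strict_Lor_def
proof (intro conjI allI impI)
  fix B assume B: "B \<subseteq> E - {k}" "card B = d"
  then have "card (insert k B) = Suc d"
    using E finite_subset[of B E] by (subst card_insert_disjoint) auto
  then show "0 < c (insert k B)" using B k by (intro strict_Lor_pos[OF s]) auto
next
  fix A assume A: "A \<subseteq> E - {k}" "card A + 2 = d"
  then have "card (insert k A) + 2 = Suc d"
    using E finite_subset[of A E] by (subst card_insert_disjoint) auto
  then have "hyperbolic (E - insert k A) (link_form c (insert k A)) (\<lambda>_. 1)"
    using A k by (intro strict_Lor_hyperbolic[OF s]) auto
  moreover have "E - insert k A = E - {k} - A" by blast
  moreover have "link_form c (insert k A) = link_form (\<lambda>B. c (insert k B)) A"
    unfolding link_form_def by (intro ext) (simp add: insert_commute)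
  ultimately show "hyperbolic (E - {k} - A) (link_form (\<lambda>B. c (insert k B)) A) (\<lambda>_. 1)" by simp
qed

text \<open>
  The passage from the links \<open>N k\<close> of a cubic form to the quadratic form \<open>M\<close>, by the Bochner method:
  after normalising \<open>M\<close> so that \<open>v\<close> becomes an eigenvector for the eigenvalue \<open>1\<close>, summing
  the reverse Cauchy-Schwarz inequalities of the links shows \<open>M \<le> M\<^sup>2\<close>, so every eigenvalue is
  at most \<open>0\<close> or at least \<open>1\<close>; only \<open>v\<close> itself has an eigenvalue that is at least \<open>1\<close>.
\<close>

lemma hyperbolic_from_links:
  fixes N :: "'b \<Rightarrow> 'b \<Rightarrow> 'b \<Rightarrow> real"
  assumes E: "finite E" "2 \<le> card E" and v: "\<And>k. k \<in> E \<Longrightarrow> 0 < v k"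
    and symN: "\<And>k. k \<in> E \<Longrightarrow> sym_on E (N k)" "\<And>i j k. N k i j = N i k j"
    and M: "\<And>i j. i \<in> E \<Longrightarrow> j \<in> E \<Longrightarrow> M i j = (\<Sum>k\<in>E. v k * N k i j)"
    and Mpos: "\<And>i j. i \<in> E \<Longrightarrow> j \<in> E \<Longrightarrow> i \<noteq> j \<Longrightarrow> 0 < M i j"
    and Mdiag: "\<And>i. i \<in> E \<Longrightarrow> M i i = 0"
    and Nvv: "\<And>k. k \<in> E \<Longrightarrow> 0 < bform E (N k) v v"
    and N: "\<And>k x. k \<in> E \<Longrightarrow> \<exists>i\<in>E - {k}. x i \<noteq> 0 \<Longrightarrow> bform E (N k) v x = 0 \<Longrightarrow> bform E (N k) x x < 0"
    and CS: "\<And>k x. k \<in> E \<Longrightarrow> bform E (N k) v v * bform E (N k) x x \<le> (bform E (N k) v x)\<^sup>2"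
    and N0: "\<And>k x. k \<in> E \<Longrightarrow> \<forall>i\<in>E - {k}. x i = 0 \<Longrightarrow> bform E (N k) x x = 0"
  shows "hyperbolic E M v"
proof -
  define row where "row x k = (\<Sum>j\<in>E. M k j * x j)" for x k
  have bfM: "bform E M x y = (\<Sum>k\<in>E. v k * bform E (N k) x y)" for x y
  proof -
    have "bform E M x y = (\<Sum>i\<in>E. \<Sum>j\<in>E. \<Sum>k\<in>E. v k * (N k i j * x i * y j))"
      unfolding bform_def using M by (intro sum.cong refl) (simp add: sum_distrib_right mult.assoc)
    also have "\<dots> = (\<Sum>i\<in>E. \<Sum>k\<in>E. \<Sum>j\<in>E. v k * (N k i j * x i * y j))"
      by (intro sum.cong refl sum.swap)
    also have "\<dots> = (\<Sum>k\<in>E. \<Sum>i\<in>E. \<Sum>j\<in>E. v k * (N k i j * x i * y j))"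
      by (rule sum.swap)
    finally show ?thesis unfolding bform_def by (simp add: sum_distrib_left)
  qed
  have row: "row x k = bform E (N k) v x" if k: "k \<in> E" for x k
  proof -
    have "row x k = (\<Sum>j\<in>E. \<Sum>l\<in>E. N k l j * v l * x j)"
      unfolding row_def
    proof (intro sum.cong refl)
      fix j assume j: "j \<in> E"
      show "M k j * x j = (\<Sum>l\<in>E. N k l j * v l * x j)"
        unfolding M[OF k j] sum_distrib_right
        by (intro sum.cong refl) (simp add: symN(2)[of _ k])
    qed
    then show ?thesis unfolding bform_def by (subst sum.swap) simp
  qed
  have bform_row: "bform E M x y = (\<Sum>k\<in>E. x k * row y k)" for x y
    unfolding bform_rows row_def by simp
  have symM: "sym_on E M"
    unfolding sym_on_def using M symN(1) by (auto simp: sym_on_def intro!: sum.cong)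
  \<comment> \<open>If all rows vanish on x, then x is orthogonal to \<open>v\<close> in every link,
    so its value there is at most 0, and below 0 in the link at some \<open>k0\<close> other than i.
    But the weighted sum of these values is the value of \<open>M\<close> at x, which is 0.\<close>
  have kernel: "x i = 0" if r: "\<And>k. k \<in> E \<Longrightarrow> row x k = 0" and i: "i \<in> E" for x i
  proof (rule ccontr)
    assume xi: "x i \<noteq> 0"
    obtain k l where kl: "k \<in> E" "l \<in> E" "k \<noteq> l" using E(2) by (rule card_ge_2E)
    define k0 where "k0 = (if k = i then l else k)"
    have k0: "k0 \<in> E" "k0 \<noteq> i" using kl unfolding k0_def by auto
    have le: "v k * bform E (N k) x x \<le> 0" if "k \<in> E" for k
    proof (cases "\<exists>i\<in>E - {k}. x i \<noteq> 0")
      case True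
      then have "bform E (N k) x x < 0"
        using r[OF that] row[OF that] by (intro N[OF that]) auto
      then show ?thesis using v[OF that] by (simp add: mult_le_0_iff)
    qed (use N0[OF that, of x] in auto)
    have "bform E (N k0) x x < 0"
      using r[OF k0(1)] row[OF k0(1)] xi i k0 by (intro N) auto
    then have "v k0 * bform E (N k0) x x < 0" using v[OF k0(1)] by (simp add: mult_less_0_iff)
    then have "(\<Sum>k\<in>E. v k * bform E (N k) x x) < (\<Sum>k\<in>E. 0)"
      using le k0(1) E(1) by (intro sum_strict_mono_ex1) auto
    then show False using bform_row[of x x] r unfolding bfM by simp
  qed
  define p where "p k = row v k / v k" for k
  have p: "p k > 0" if "k \<in> E" for k
    unfolding p_def row[OF that] using Nvv[OF that] v[OF that] by simp
  have pv: "row v k = p k * v k" if "k \<in> E" for k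
    unfolding p_def using v[OF that] by simp
  have bochner: "bform E M x x \<le> (\<Sum>k\<in>E. (row x k)\<^sup>2 / p k)" for x
    unfolding bfM
  proof (intro sum_mono)
    fix k assume k: "k \<in> E"
    have "bform E (N k) x x \<le> (row x k)\<^sup>2 / bform E (N k) v v"
      using CS[OF k, of x] Nvv[OF k] unfolding row[OF k] by (simp add: field_simps)
    then have "v k * bform E (N k) x x \<le> v k * ((row x k)\<^sup>2 / bform E (N k) v v)"
      using v[OF k] by (intro mult_left_mono) auto
    also have "\<dots> = (row x k)\<^sup>2 / p k"
      unfolding p_def row[OF k, of v] by simp
    finally show "v k * bform E (N k) x x \<le> (row x k)\<^sup>2 / p k" .
  qed
  \<comment> \<open>After division of x by \<open>v\<close>, the difference is the form of a
    weighted graph Laplacian. It is nonnegative and vanishes only on multiples of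
    \<open>v\<close>.\<close>
  have gap: "(\<Sum>k\<in>E. p k * (x k)\<^sup>2) - bform E M x x
      = (\<Sum>i\<in>E. \<Sum>j\<in>E. M i j * v i * v j * (x i / v i - x j / v j)\<^sup>2) / 2" for x
  proof -
    have "(\<Sum>i\<in>E. \<Sum>j\<in>E. M i j * v i * v j * (x i / v i - x j / v j)\<^sup>2)
        = (\<Sum>i\<in>E. \<Sum>j\<in>E. M i j * v j * ((x i)\<^sup>2 / v i) + M j i * v i * ((x j)\<^sup>2 / v j) - 2 * (M i j * x i * x j))"
    proof (intro sum.cong refl)
      fix i j assume "i \<in> E" "j \<in> E"
      then show "M i j * v i * v j * (x i / v i - x j / v j)\<^sup>2
          = M i j * v j * ((x i)\<^sup>2 / v i) + M j i * v i * ((x j)\<^sup>2 / v j) - 2 * (M i j * x i * x j)"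
        using v[of i] v[of j] symM unfolding sym_on_def
        by (simp add: power2_diff power_divide field_simps) (simp add: power2_eq_square field_simps)
    qed
    also have "\<dots> = (\<Sum>i\<in>E. \<Sum>j\<in>E. M i j * v j * ((x i)\<^sup>2 / v i))
        + (\<Sum>i\<in>E. \<Sum>j\<in>E. M j i * v i * ((x j)\<^sup>2 / v j)) - 2 * bform E M x x"
      unfolding bform_def by (simp add: sum.distrib sum_subtractf sum_distrib_left)
    also have "(\<Sum>i\<in>E. \<Sum>j\<in>E. M j i * v i * ((x j)\<^sup>2 / v j)) = (\<Sum>i\<in>E. \<Sum>j\<in>E. M i j * v j * ((x i)\<^sup>2 / v i))"
      by (rule sum.swap)
    also have "(\<Sum>i\<in>E. \<Sum>j\<in>E. M i j * v j * ((x i)\<^sup>2 / v i)) = (\<Sum>k\<in>E. p k * (x k)\<^sup>2)"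
      unfolding p_def row_def by (simp add: sum_distrib_right sum_divide_distrib)
    finally show ?thesis by simp
  qed
  \<comment> \<open>Rescaling by \<open>sqrt (p i)\<close> turns \<open>M\<close>, taken relative to
    the diagonal form \<open>p\<close>, into an ordinary symmetric matrix \<open>A\<close>, and
    \<open>v\<close> into its eigenvector \<open>w\<close> for the eigenvalue 1.\<close>
  define w where "w i = sqrt (p i) * v i" for i
  define A where "A i j = M i j / (sqrt (p i) * sqrt (p j))" for i j
  have symA: "sym_on E A"
    using symM unfolding sym_on_def A_def by (simp add: mult.commute)
  have rowA: "(\<Sum>a\<in>E. A b a * y a) = row (\<lambda>i. y i / sqrt (p i)) b / sqrt (p b)" for b y
    unfolding row_def A_def by (simp add: sum_divide_distrib mult_ac)
  have Aw: "(\<Sum>a\<in>E. A b a * w a) = 1 * w b" if b: "b \<in> E" for b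
  proof -
    have "row (\<lambda>i. w i / sqrt (p i)) b = row v b"
      unfolding row_def w_def using p by (intro sum.cong refl) (auto simp: less_imp_neq[symmetric])
    then show ?thesis
      unfolding rowA using pv[OF b] p[OF b] by (simp add: w_def field_simps flip: power2_eq_square)
  qed
  have bfA: "bform E A y y = bform E M (\<lambda>i. y i / sqrt (p i)) (\<lambda>i. y i / sqrt (p i))" for y
    unfolding bform_def A_def by simp
  obtain m \<phi> \<mu> where eb: "eigenbasis E A w m \<phi> \<mu>"
    using spectral_theorem[OF E(1) symA Aw] by blast
  note s1 = eigenbasisD(1)[OF eb] and s2 = eigenbasisD(2)[OF eb] and s3 = eigenbasisD(3)[OF eb]
  have neg: "\<mu> k < 0" if k: "k < m" for k
  proof -
    define x where "x i = \<phi> k i / sqrt (p i)" for i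
    have ss: "(\<Sum>b\<in>E. (\<phi> k b)\<^sup>2) = 1" using s2[OF k k] by (simp add: power2_eq_square)
    have nz: "\<exists>b\<in>E. \<phi> k b \<noteq> 0"
    proof (rule ccontr)
      assume "\<not> ?thesis"
      then have "(\<Sum>b\<in>E. (\<phi> k b)\<^sup>2) = 0" by (intro sum.neutral) auto
      then show False using ss by simp
    qed
    have rx: "row x b = \<mu> k * sqrt (p b) * \<phi> k b" if b: "b \<in> E" for b
      using s3[OF k b] p[OF b] unfolding rowA x_def[symmetric] by (simp add: field_simps)
    have Mx: "bform E M x x = \<mu> k"
    proof -
      have "bform E M x x = (\<Sum>b\<in>E. \<mu> k * (\<phi> k b)\<^sup>2)"
        unfolding bform_row using rx p
        by (intro sum.cong refl) (auto simp: x_def power2_eq_square less_imp_neq[symmetric])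
      then show ?thesis using ss by (simp flip: sum_distrib_left)
    qed
    have "(\<Sum>b\<in>E. (row x b)\<^sup>2 / p b) = (\<Sum>b\<in>E. (\<mu> k)\<^sup>2 * (\<phi> k b)\<^sup>2)"
      using rx p by (intro sum.cong refl) (auto simp: power_mult_distrib less_imp_neq[symmetric] less_imp_le)
    then have sq: "\<mu> k \<le> (\<mu> k)\<^sup>2"
      using bochner[of x] ss unfolding Mx by (simp flip: sum_distrib_left)
    have px: "(\<Sum>b\<in>E. p b * (x b)\<^sup>2) = 1"
    proof -
      have "(\<Sum>b\<in>E. p b * (x b)\<^sup>2) = (\<Sum>b\<in>E. (\<phi> k b)\<^sup>2)"
        using p by (intro sum.cong refl) (auto simp: x_def power_divide less_imp_neq[symmetric] less_imp_le)
      then show ?thesis using ss by simp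
    qed
    \<comment> \<open>Orthogonality to \<open>w\<close> excludes the multiples of \<open>v\<close>,
      so the Laplacian in \<open>gap\<close> is positive here.\<close>
    have lt1: "\<mu> k < 1"
    proof -
      have t: "0 \<le> M i j * v i * v j * (x i / v i - x j / v j)\<^sup>2" if "i \<in> E" "j \<in> E" for i j
        using that v[of i] v[of j] Mpos[of i j] Mdiag[of i] by (cases "i = j") (auto simp: less_imp_le)
      have "\<exists>i\<in>E. \<exists>j\<in>E. x i / v i \<noteq> x j / v j"
      proof (rule ccontr)
        assume n: "\<not> ?thesis"
        obtain i where i: "i \<in> E" "\<phi> k i \<noteq> 0" using nz by blast
        define t where "t = x i / v i"
        have "x j = t * v j" if "j \<in> E" for j
        proof -
          have "x j / v j = t" using n i(1) that unfolding t_def by metis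
          then show ?thesis using v[OF that] by (auto simp: field_simps)
        qed
        then have \<phi>: "\<phi> k j = t * w j" if "j \<in> E" for j
        proof -
          have "sqrt (p j) \<noteq> 0" using p[OF that] by simp
          then show ?thesis
            using \<open>\<And>j. j \<in> E \<Longrightarrow> x j = t * v j\<close>[OF that] unfolding x_def w_def by (simp add: field_simps)
        qed
        then have "(\<Sum>b\<in>E. w b * \<phi> k b) = t * (\<Sum>b\<in>E. (w b)\<^sup>2)"
          unfolding sum_distrib_left by (intro sum.cong refl) (simp add: power2_eq_square)
        moreover have "0 < (\<Sum>b\<in>E. (w b)\<^sup>2)"
          using v[OF i(1)] p[OF i(1)] unfolding w_def by (intro sum_pos2[OF E(1) i(1)]) auto
        ultimately have "t = 0" using s1[OF k] by simp
        then show False using \<phi> i by simp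
      qed
      then obtain i j where ij: "i \<in> E" "j \<in> E" "x i / v i \<noteq> x j / v j" by blast
      then have "i \<noteq> j" by auto
      then have "0 < M i j * v i * v j * (x i / v i - x j / v j)\<^sup>2"
        using ij Mpos v by (intro mult_pos_pos) auto
      then have "0 < (\<Sum>j\<in>E. M i j * v i * v j * (x i / v i - x j / v j)\<^sup>2)"
        using t ij by (intro sum_pos2[OF E(1) ij(2)]) auto
      then have "0 < (\<Sum>i\<in>E. \<Sum>j\<in>E. M i j * v i * v j * (x i / v i - x j / v j)\<^sup>2)"
        by (rule sum_pos2[OF E(1) ij(1)]) (auto intro!: sum_nonneg t)
      then show ?thesis using gap[of x] unfolding px Mx by linarith
    qed
    have "\<mu> k \<le> 0"
    proof (rule ccontr)
      assume "\<not> ?thesis"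
      then have "\<mu> k * \<mu> k < \<mu> k * 1" using lt1 by (intro mult_strict_left_mono) auto
      then show False using sq by (simp add: power2_eq_square)
    qed
    moreover have "\<mu> k \<noteq> 0"
    proof
      assume "\<mu> k = 0"
      then have "row x k = 0" if "k \<in> E" for k using rx[OF that] by simp
      then have "x i = 0" if "i \<in> E" for i by (rule kernel[OF _ that])
      then show False using nz p unfolding x_def by force
    qed
    ultimately show ?thesis by simp
  qed
  show ?thesis
    unfolding hyperbolic_def
  proof (intro conjI allI impI)
    obtain i where i: "i \<in> E" using E(2) by (rule card_ge_2E)
    have "0 < v k * row v k" if "k \<in> E" for k
      using pv[OF that] p[OF that] v[OF that] by simp
    then show "0 < bform E M v v"
      unfolding bform_row using i E(1) by (intro sum_pos2[of _ i]) (auto simp: less_imp_le)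
    fix x assume nz: "\<exists>i\<in>E. x i \<noteq> 0" and 0: "bform E M v x = 0"
    define y where "y i = sqrt (p i) * x i" for i
    have wy: "(\<Sum>b\<in>E. w b * y b) = 0"
    proof -
      have "(\<Sum>b\<in>E. w b * y b) = bform E M x v"
        unfolding bform_row using pv p
        by (intro sum.cong refl) (auto simp: w_def y_def less_imp_le)
      then show ?thesis using 0 bform_commute[OF symM, of x v] by simp
    qed
    have "bform E M x x = bform E A y y"
      unfolding bfA y_def using p by (intro bform_cong) (auto simp: less_imp_neq[symmetric])
    also have "\<dots> = (\<Sum>k<m. \<mu> k * (\<Sum>a\<in>E. \<phi> k a * y a)\<^sup>2)" by (rule eigenbasis_diagonal[OF eb symA wy])
    also have "\<dots> < (\<Sum>k<m. 0)"
    proof (intro sum_strict_mono_ex1)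
      show "\<forall>k\<in>{..<m}. \<mu> k * (\<Sum>a\<in>E. \<phi> k a * y a)\<^sup>2 \<le> 0"
        using neg by (auto simp: mult_le_0_iff less_imp_le)
      obtain i where i: "i \<in> E" "x i \<noteq> 0" using nz by blast
      have "0 < (\<Sum>b\<in>E. (y b)\<^sup>2)"
        using i p[OF i(1)] unfolding y_def by (intro sum_pos2[OF E(1) i(1)]) auto
      then have "(\<Sum>k<m. (\<Sum>a\<in>E. \<phi> k a * y a)\<^sup>2) \<noteq> 0" unfolding eigenbasis_Parseval[OF eb wy] by simp
      then have "\<not> (\<forall>k\<in>{..<m}. (\<Sum>a\<in>E. \<phi> k a * y a)\<^sup>2 = 0)"
        by (rule contrapos_nn) (rule sum.neutral)
      then obtain k where "k < m" "(\<Sum>a\<in>E. \<phi> k a * y a)\<^sup>2 \<noteq> 0" by blast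
      then show "\<exists>k\<in>{..<m}. \<mu> k * (\<Sum>a\<in>E. \<phi> k a * y a)\<^sup>2 < 0"
        using neg[of k] by (auto simp: mult_less_0_iff)
    qed simp
    finally show "bform E M x x < 0" by simp
  qed
qed

text \<open>Induction on the number of directions. After the directions \<open>vs\<close> the
  polynomial is cubic, and by \<open>foldr_dderiv_link\<close> its links are the derivatives along
  \<open>vs\<close> of the links of \<open>c\<close>. The induction hypothesis applies to these, and
  \<open>hyperbolic_from_links\<close> adds the last direction \<open>v\<close>.\<close>

lemma hyperbolic_foldr_dderiv:
  assumes "finite E" "strict_Lor E (length vs + 2) c" "length vs + 2 \<le> card E"
    and "\<And>v i. v \<in> set vs \<Longrightarrow> i \<in> E \<Longrightarrow> 0 < v i"
  shows "hyperbolic E (link_form (foldr (dderiv E) vs c) {}) (\<lambda>_. 1)"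
  using assms
proof (induction vs arbitrary: E c)
  case Nil
  then show ?case using strict_Lor_hyperbolic[OF Nil(2), of "{}"] by simp
next
  case (Cons v vs)
  define h where "h = foldr (dderiv E) vs c"
  \<comment> \<open>The third derivatives of the cubic polynomial. Row and column k of
    \<open>N k\<close> vanish, so \<open>N k\<close> is really a form on
    \<open>E - {k}\<close>.\<close>
  define N where "N k i j = (if k = i \<or> k = j \<or> i = j then 0 else h {k, i, j})" for k i j :: nat
  have v: "0 < v i" if "i \<in> E" for i using Cons.prems that by simp
  have cpos: "0 < c B" if "B \<subseteq> E" "card B = length vs + 3" for B
    using that by (intro strict_Lor_pos[OF Cons.prems(2)]) auto
  have hpos: "0 < h B" if "B \<subseteq> E" "card B = 3" for B
    unfolding h_def using Cons.prems cpos that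
    by (intro foldr_dderiv_pos[of E "length vs + 3"]) auto
  have Npos: "0 < N k i j" if "k \<in> E" "i \<in> E" "j \<in> E" "k \<noteq> i" "k \<noteq> j" "i \<noteq> j" for i j k
    unfolding N_def using that by (auto intro!: hpos)
  have Nnn: "0 \<le> N k i j" if "k \<in> E" "i \<in> E" "j \<in> E" for i j k
    using Npos[OF that] unfolding N_def by (auto simp: less_imp_le)
  let ?M = "link_form (foldr (dderiv E) (v # vs) c) {}"
  have M: "?M i j = (\<Sum>k\<in>E. v k * N k i j)" if "i \<in> E" "j \<in> E" for i j
  proof (cases "i = j")
    case False
    have "?M i j = (\<Sum>k\<in>E - {i, j}. v k * N k i j)"
      unfolding link_form_def foldr_dderiv_Cons h_def[symmetric]
      using False by (auto simp: N_def intro!: sum.cong)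
    also have "\<dots> = (\<Sum>k\<in>E. v k * N k i j)"
      using Cons.prems(1) by (intro sum.mono_neutral_left) (auto simp: N_def)
    finally show ?thesis .
  qed (simp add: link_form_def N_def)
  have Mpos: "0 < ?M i j" if ij: "i \<in> E" "j \<in> E" "i \<noteq> j" for i j
  proof -
    have "card (E - {i, j}) \<noteq> 0" using Cons.prems ij by (simp add: card_Diff_subset)
    then obtain k where "k \<in> E - {i, j}" by (metis all_not_in_conv card.empty)
    then show ?thesis
      unfolding M[OF ij(1,2)] using Npos[of k i j] v Nnn ij Cons.prems(1)
      by (intro sum_pos2[of _ k]) (auto simp: less_imp_le)
  qed
  have link: "hyperbolic (E - {k}) (N k) v" "bform (E - {k}) (N k) = bform E (N k)" if k: "k \<in> E" for k
  proof -
    have hk: "hyperbolic (E - {k}) (link_form (foldr (dderiv (E - {k})) vs (\<lambda>B. c (insert k B))) {}) (\<lambda>_. 1)"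
      using Cons.prems k strict_Lor_link[of E "length vs + 2" c k] by (intro Cons.IH) auto
    have eq: "link_form (foldr (dderiv (E - {k})) vs (\<lambda>B. c (insert k B))) {} i j = N k i j"
      if "i \<in> E - {k}" "j \<in> E - {k}" for i j
      using that k foldr_dderiv_link[OF k, of "{i, j}" vs c] by (auto simp: link_form_def N_def h_def)
    have H: "hyperbolic (E - {k}) (N k) (\<lambda>_. 1)"
      using hk hyperbolic_cong[of "E - {k}", OF eq] by simp
    have "2 \<le> card (E - {k})" using Cons.prems k by simp
    then obtain i j where ij: "i \<in> E - {k}" "j \<in> E - {k}" "i \<noteq> j" by (rule card_ge_2E)
    have "0 < bform (E - {k}) (N k) v v"
      using ij k v Npos Nnn Cons.prems(1)
      by (intro bform_pos[of _ i j] mult_pos_pos mult_nonneg_nonneg) (auto simp: less_imp_le)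
    then show "hyperbolic (E - {k}) (N k) v"
      using H by (intro hyperbolic_change_reference[OF _ H]) (auto simp: sym_on_def N_def insert_commute)
    show "bform (E - {k}) (N k) = bform E (N k)"
    proof (intro ext)
      fix x y
      show "bform (E - {k}) (N k) x y = bform E (N k) x y"
        unfolding bform_rows using Cons.prems(1)
        by (intro sum.mono_neutral_cong_left ballI arg_cong2[of _ _ _ _ "(*)"] refl
            sum.mono_neutral_left sum.neutral) (auto simp: N_def)
    qed
  qed
  have symN: "sym_on E (N k)" for k unfolding sym_on_def N_def by (auto simp: insert_commute)
  have "hyperbolic E ?M v"
  proof (rule hyperbolic_from_links[of E v N])
    show "2 \<le> card E" using Cons.prems by simp
    show "N k i j = N i k j" for i j k unfolding N_def by (auto simp: insert_commute)
    show "0 < bform E (N k) v v" if "k \<in> E" for k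
      using link[OF that] unfolding hyperbolic_def by simp
    show "bform E (N k) x x < 0" if "k \<in> E" "\<exists>i\<in>E - {k}. x i \<noteq> 0" "bform E (N k) v x = 0" for k x
      using hypD[OF link(1)[OF that(1)] that(2)] that(3) link(2)[OF that(1)] by simp
    show "bform E (N k) v v * bform E (N k) x x \<le> (bform E (N k) v x)\<^sup>2" if "k \<in> E" for k x
      unfolding link(2)[OF that, symmetric]
      using symN[of k] by (intro hyperbolic_reverse_Cauchy_Schwarz link(1)[OF that]) (auto simp: sym_on_def)
    show "bform E (N k) x x = 0" if "k \<in> E" "\<forall>i\<in>E - {k}. x i = 0" for k x
      unfolding link(2)[OF that(1), symmetric] bform_rows using that(2) by simp
  qed (use Cons.prems v M Mpos symN in \<open>auto simp: link_form_def\<close>)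
  moreover have "0 < bform E ?M (\<lambda>_. 1) (\<lambda>_. 1)"
  proof -
    have "2 \<le> card E" using Cons.prems by simp
    then obtain i j where "i \<in> E" "j \<in> E" "i \<noteq> j" by (rule card_ge_2E)
    moreover have "0 \<le> ?M i j" if "i \<in> E" "j \<in> E" for i j
      using Mpos[OF that] by (cases "i = j") (auto simp: link_form_def less_imp_le)
    ultimately show ?thesis using Mpos Cons.prems(1) by (intro bform_pos[of _ i j]) auto
  qed
  ultimately show ?case by (rule hyperbolic_change_reference[OF sym_on_link_form])
qed

section \<open>Lorentzian approximations of multiaffine polynomials\<close>

text \<open>By the chain rule, if \<epsilon> times the sum of all variables is added to each
  variable, the partial derivative by variable i becomes the derivative in this direction.\<close>

definition dirac :: "real \<Rightarrow> nat \<Rightarrow> nat \<Rightarrow> real" where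
  "dirac \<epsilon> i j = (if j = i then 1 else 0) + \<epsilon>"

text \<open>
  For \<open>length xs = d\<close>, this is the \<open>ncoeff\<close> at the monomial of \<open>xs\<close> of the polynomial that arises
  from the multiaffine polynomial with coefficients \<open>c\<close> by the substitution of
  \<open>w\<^sub>j + \<epsilon> (w\<^sub>1 + \<dots> + w\<^sub>n)\<close> for every \<open>w\<^sub>j\<close>.
\<close>

definition smear :: "nat set \<Rightarrow> (nat set \<Rightarrow> real) \<Rightarrow> real \<Rightarrow> nat list \<Rightarrow> nat set \<Rightarrow> real" where
  "smear E c \<epsilon> xs = foldr (dderiv E) (map (dirac \<epsilon>) xs) c"

text \<open>\<open>SOME\<close> may pick any list of the monomial, as directional derivatives
  commute (\<open>smear_permute\<close>).\<close>

definition smear_poly :: "nat \<Rightarrow> nat \<Rightarrow> (nat set \<Rightarrow> real) \<Rightarrow> real \<Rightarrow> mpoly" where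
  "smear_poly d n c \<epsilon> =
     (\<Sum>m\<in>monomials d n. Poly_Mapping.single m
        (smear {..<n} c \<epsilon> (SOME xs. mono_of_list xs = m) {} / mfact m))"

definition multiaffine_poly :: "nat \<Rightarrow> nat \<Rightarrow> (nat set \<Rightarrow> real) \<Rightarrow> mpoly" where
  "multiaffine_poly d n c =
     (\<Sum>B | B \<subseteq> {..<n} \<and> card B = d. Poly_Mapping.single (mono_of_set B) (c B))"

lemma smear_Cons: "smear E c \<epsilon> (i # xs) = dderiv E (dirac \<epsilon> i) (smear E c \<epsilon> xs)"
  unfolding smear_def by simp

lemma smear_permute:
  assumes "finite E" "mset xs = mset js"
  shows "smear E c \<epsilon> xs = smear E c \<epsilon> js"
proof -
  have "foldr (\<lambda>i. dderiv E (dirac \<epsilon> i)) xs = foldr (\<lambda>i. dderiv E (dirac \<epsilon> i)) js"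
    unfolding foldr_conv_fold
    using assms by (intro fold_multiset_equiv) (auto simp: dderiv_commute)
  then show ?thesis unfolding smear_def foldr_map comp_def by simp
qed


lemma smear_pos:
  assumes E: "finite E" and c: "strict_Lor E d c" "d \<le> card E" and \<epsilon>: "\<epsilon> > 0"
    and B: "B \<subseteq> E" "card B + length xs = d"
  shows "0 < smear E c \<epsilon> xs B"
  unfolding smear_def
proof (rule foldr_dderiv_pos[OF E _ c(2)])
  show "0 < c B" if "B \<subseteq> E" "card B = d" for B using c(1) that by (rule strict_Lor_pos)
  show "0 < v i" if "v \<in> set (map (dirac \<epsilon>) xs)" for v i
    using that \<epsilon> by (auto simp: dirac_def)
qed (use B in auto)

lemma lookup_smear_poly:
  "Poly_Mapping.lookup (smear_poly d n c \<epsilon>) m =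
    (if m \<in> monomials d n
     then smear {..<n} c \<epsilon> (SOME xs. mono_of_list xs = m) {} / mfact m else 0)"
  unfolding smear_poly_def by (simp add: lookup_sum lookup_single when_def finite_monomials)

lemma smear_poly_homogeneous: "smear_poly d n c \<epsilon> \<in> homogeneous d n"
  unfolding homogeneous_def by (auto simp: in_keys_iff lookup_smear_poly split: if_splits)

lemma ncoeff_smear_poly:
  assumes "length xs = d" "set xs \<subseteq> {..<n}"
  shows "ncoeff (smear_poly d n c \<epsilon>) (mono_of_list xs) = smear {..<n} c \<epsilon> xs {}"
proof -
  let ?m = "mono_of_list xs"
  have "mono_of_list (SOME js. mono_of_list js = ?m) = ?m" by (rule someI[of _ xs]) simp
  then have "smear {..<n} c \<epsilon> (SOME js. mono_of_list js = ?m) = smear {..<n} c \<epsilon> xs"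
    by (intro smear_permute) (auto simp: mono_of_list_eq_iff)
  moreover have "?m \<in> monomials d n" using assms mono_of_list_in_monomials by blast
  ultimately show ?thesis
    using mfact_pos[of ?m] by (simp add: ncoeff_def lookup_smear_poly)
qed

lemma bform_pullback:
  "bform E (\<lambda>i j. bform E M (u i) (u j)) x y =
    bform E M (\<lambda>a. \<Sum>i\<in>E. x i * u i a) (\<lambda>a. \<Sum>j\<in>E. y j * u j a)"
proof -
  have left: "bform E M (\<lambda>a. \<Sum>i\<in>E. x i * u i a) z = (\<Sum>i\<in>E. x i * bform E M (u i) z)" for z
  proof -
    have "bform E M (\<lambda>a. \<Sum>i\<in>E. x i * u i a) z
        = (\<Sum>a\<in>E. \<Sum>i\<in>E. x i * (u i a * (\<Sum>j\<in>E. M a j * z j)))"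
      unfolding bform_rows by (simp add: sum_distrib_right mult.assoc)
    also have "\<dots> = (\<Sum>i\<in>E. \<Sum>a\<in>E. x i * (u i a * (\<Sum>j\<in>E. M a j * z j)))"
      by (rule sum.swap)
    finally show ?thesis unfolding bform_rows by (simp add: sum_distrib_left)
  qed
  have right: "bform E M z (\<lambda>a. \<Sum>j\<in>E. y j * u j a) = (\<Sum>j\<in>E. bform E M z (u j) * y j)" for z
  proof -
    have "bform E M z (\<lambda>a. \<Sum>j\<in>E. y j * u j a)
        = (\<Sum>i\<in>E. \<Sum>a\<in>E. \<Sum>j\<in>E. M i a * z i * u j a * y j)"
      unfolding bform_def by (simp add: sum_distrib_left mult_ac)
    also have "\<dots> = (\<Sum>i\<in>E. \<Sum>j\<in>E. \<Sum>a\<in>E. M i a * z i * u j a * y j)"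
      by (intro sum.cong refl sum.swap)
    also have "\<dots> = (\<Sum>j\<in>E. \<Sum>i\<in>E. \<Sum>a\<in>E. M i a * z i * u j a * y j)"
      by (rule sum.swap)
    finally show ?thesis unfolding bform_def by (simp add: sum_distrib_right)
  qed
  show ?thesis unfolding left right bform_rows[of E "\<lambda>i j. bform E M (u i) (u j)"] ..
qed

text \<open>The Hessians are pullbacks of the forms from \<open>hyperbolic_foldr_dderiv\<close>
  under the map \<open>A\<close>, the identity plus \<epsilon> times the all-ones matrix. This map
  is injective and scales the all-ones vector, so hyperbolicity is kept with the same reference
  vector.\<close>

lemma smear_poly_strictly_Lorentzian:
  assumes c: "strict_Lor {..<n} d c" and d: "d \<le> n" and \<epsilon>: "\<epsilon> > 0"
  shows "strictly_Lorentzian d n (smear_poly d n c \<epsilon>)"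
  unfolding strictly_Lorentzian_def
proof (intro conjI allI impI ballI smear_poly_homogeneous)
  let ?E = "{..<n}" and ?g = "smear_poly d n c \<epsilon>"
  have pos: "0 < smear ?E c \<epsilon> xs B" if "B \<subseteq> ?E" "card B + length xs = d" for xs B
    using c d \<epsilon> that by (intro smear_pos[of _ d]) auto
  show "0 < Poly_Mapping.lookup ?g m" if m: "m \<in> monomials d n" for m
  proof -
    obtain xs where xs: "length xs = d" "set xs \<subseteq> ?E" "mono_of_list xs = m"
      using monomials_ex_list[OF m] by blast
    have "0 < ncoeff ?g m" using ncoeff_smear_poly[OF xs(1,2)] xs pos[of "{}" xs] by simp
    then show ?thesis unfolding ncoeff_def using mfact_pos[of m] by (simp add: zero_less_mult_iff)
  qed
  fix xs assume d2: "2 \<le> d" and xs: "length xs = d - 2 \<and> set xs \<subseteq> ?E"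
  define M where "M = link_form (smear ?E c \<epsilon> xs) {}"
  define A where "A x a = (\<Sum>i\<in>?E. x i * dirac \<epsilon> i a)" for x a
  have hess: "hessian ?g xs i j = bform ?E M (dirac \<epsilon> i) (dirac \<epsilon> j)" if "i < n" "j < n" for i j
  proof -
    have "hessian ?g xs i j = smear ?E c \<epsilon> (i # j # xs) {}"
      using ncoeff_smear_poly[of "i # j # xs" d n] that xs d2
      by (simp add: hessian_def add.assoc)
    then show ?thesis by (simp add: smear_Cons dderiv_dderiv M_def)
  qed
  have bfh: "bform ?E (hessian ?g xs) x y = bform ?E M (A x) (A y)" for x y
    unfolding A_def bform_pullback[symmetric] using hess by (intro bform_cong) auto
  have Aa: "A x a = x a + \<epsilon> * sum x ?E" if "a < n" for x a
    unfolding A_def dirac_def using that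
    by (simp add: algebra_simps sum.distrib sum_distrib_left if_distrib[of "\<lambda>t. _ * t"] cong: if_cong)
  have H: "hyperbolic ?E M (\<lambda>_. 1)"
  proof -
    have l: "length (map (dirac \<epsilon>) xs) + 2 = d" using xs d2 by simp
    show ?thesis
      unfolding M_def smear_def using c d \<epsilon>
      by (intro hyperbolic_foldr_dderiv) (use l in \<open>auto simp: dirac_def\<close>)
  qed
  have A1: "bform ?E M (A (\<lambda>_. 1)) z = (1 + \<epsilon> * n) * bform ?E M (\<lambda>_. 1) z" for z
  proof -
    have "bform ?E M (A (\<lambda>_. 1)) z = bform ?E M (\<lambda>a. (1 + \<epsilon> * n) * 1) z"
      by (intro bform_cong) (auto simp: Aa)
    then show ?thesis by (simp only: bform_scale_left)
  qed
  have one: "0 < bform ?E (hessian ?g xs) (\<lambda>_. 1) (\<lambda>_. 1)"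
  proof -
    have "bform ?E M (\<lambda>_. 1) (A (\<lambda>_. 1)) = (1 + \<epsilon> * n) * bform ?E M (\<lambda>_. 1) (\<lambda>_. 1)"
      using A1[of "\<lambda>_. 1"] bform_commute[of ?E M "A (\<lambda>_. 1)" "\<lambda>_. 1"]
      by (simp add: M_def sym_on_link_form)
    moreover have "0 < 1 + \<epsilon> * n" using \<epsilon> by (simp add: add_pos_nonneg)
    ultimately show ?thesis
      using H unfolding bfh A1 hyperbolic_def by simp
  qed
  have "hyperbolic ?E (hessian ?g xs) (\<lambda>_. 1)"
    unfolding hyperbolic_def
  proof (intro conjI allI impI one)
    fix x assume nz: "\<exists>i\<in>?E. x i \<noteq> 0" and 0: "bform ?E (hessian ?g xs) (\<lambda>_. 1) x = 0"
    have en: "0 < 1 + \<epsilon> * n" using \<epsilon> by (simp add: add_pos_nonneg)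
    have 0: "bform ?E M (\<lambda>_. 1) (A x) = 0" using 0 en unfolding bfh A1 by simp
    \<comment> \<open>Summing A x = 0 over the coordinates gives (1 + \<epsilon> n) sum x = 0, so
      the sum of x vanishes, and then x itself.\<close>
    have nz: "\<exists>i\<in>?E. A x i \<noteq> 0"
    proof (rule ccontr)
      assume "\<not> ?thesis"
      then have x: "x i = - \<epsilon> * sum x ?E" if "i < n" for i
        using that Aa[OF that, of x] by auto
      have "sum x ?E = (\<Sum>i<n. - \<epsilon> * sum x ?E)" by (rule sum.cong[OF refl x]) simp
      then have "sum x ?E - (\<Sum>i<n. - \<epsilon> * sum x ?E) = 0" by linarith
      then have "(1 + \<epsilon> * n) * sum x ?E = 0" by (simp add: algebra_simps)
      then have s: "sum x ?E = 0" using en by (simp only: mult_eq_0_iff) linarith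
      obtain i where i: "i < n" "x i \<noteq> 0" using nz by blast
      show False using x[OF i(1)] i(2) unfolding s by simp
    qed
    show "bform ?E (hessian ?g xs) x x < 0"
      unfolding bfh by (rule hypD[OF H nz 0])
  qed
  moreover have "?g \<in> homogeneous (length xs + 2) n"
  proof -
    have "length xs + 2 = d" using xs d2 by simp
    then show ?thesis using smear_poly_homogeneous[of d n c \<epsilon>] by metis
  qed
  ultimately show "has_signature n (foldr partial_deriv xs ?g) 1 (n - 1)"
    by (simp only: has_signature_iff_hyperbolic[OF _ one])
qed

lemma tendsto_smear: "((\<lambda>\<epsilon>. smear E c \<epsilon> xs B) \<longlongrightarrow> smear E c 0 xs B) (at_right 0)"
proof (induction xs arbitrary: B)
  case (Cons i xs)
  then show ?case
    unfolding smear_Cons dderiv_def dirac_def by (intro tendsto_intros)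
qed (simp add: smear_def)

text \<open>Differentiating twice by the same variable kills a multiaffine polynomial; this is where
  \<open>distinct\<close> comes from.\<close>

lemma smear_0:
  assumes "finite E" "set xs \<subseteq> E"
  shows "smear E c 0 xs B = (if distinct xs \<and> set xs \<inter> B = {} then c (set xs \<union> B) else 0)"
  using assms(2)
proof (induction xs arbitrary: B)
  case (Cons i xs)
  have "smear E c 0 (i # xs) B = (\<Sum>j\<in>E - B. if j = i then smear E c 0 xs (insert j B) else 0)"
    unfolding smear_Cons dderiv_def dirac_def by (intro sum.cong) auto
  also have "\<dots> = (if i \<notin> B then smear E c 0 xs (insert i B) else 0)"
    using assms(1) Cons.prems by simp
  finally show ?case using Cons by auto
qed (simp add: smear_def)

lemma lookup_multiaffine_poly:
  "Poly_Mapping.lookup (multiaffine_poly d n c) m =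
    (if \<exists>B. B \<subseteq> {..<n} \<and> card B = d \<and> m = mono_of_set B then c (Poly_Mapping.keys m) else 0)"
proof (cases "\<exists>B. B \<subseteq> {..<n} \<and> card B = d \<and> m = mono_of_set B")
  case True
  then obtain B where B: "B \<subseteq> {..<n}" "card B = d" "m = mono_of_set B" by blast
  have fin: "finite C" if "C \<subseteq> {..<n}" for C using that finite_subset by blast
  have inj: "mono_of_set C = mono_of_set B \<longleftrightarrow> C = B" if "C \<subseteq> {..<n}" for C
    using mono_of_set_inj fin[OF that] fin[OF B(1)] by blast
  have "Poly_Mapping.lookup (multiaffine_poly d n c) m =
      (\<Sum>C | C \<subseteq> {..<n} \<and> card C = d. if C = B then c B else 0)"
    unfolding multiaffine_poly_def lookup_sum lookup_single when_def B
    using inj by (intro sum.cong refl) auto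
  then show ?thesis using B True fin[OF B(1)] by (simp add: keys_mono_of_set)
next
  case False
  then show ?thesis
    unfolding multiaffine_poly_def lookup_sum lookup_single when_def
    by (auto intro!: sum.neutral)
qed

lemma multiaffine_poly_homogeneous: "multiaffine_poly d n c \<in> homogeneous d n"
  unfolding homogeneous_def
  by (auto simp: in_keys_iff lookup_multiaffine_poly mono_of_set_in_monomials split: if_splits)

lemma lookup_smear_poly_0:
  "Poly_Mapping.lookup (smear_poly d n c 0) m = Poly_Mapping.lookup (multiaffine_poly d n c) m"
proof (cases "m \<in> monomials d n")
  case True
  then obtain xs where xs: "length xs = d" "set xs \<subseteq> {..<n}" "mono_of_list xs = m"
    using monomials_ex_list by blast
  have nc: "ncoeff (smear_poly d n c 0) m = (if distinct xs then c (set xs) else 0)"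
    using ncoeff_smear_poly[OF xs(1,2), of c 0] xs(3) by (simp add: smear_0[OF finite_lessThan xs(2)])
  show ?thesis
  proof (cases "distinct xs")
    case True
    then have m: "m = mono_of_set (set xs)" using xs by (simp add: mono_of_list_distinct)
    have "set xs \<subseteq> {..<n} \<and> card (set xs) = d \<and> m = mono_of_set (set xs)"
      using xs m True by (simp add: distinct_card)
    then show ?thesis
      using nc True unfolding lookup_multiaffine_poly ncoeff_def
      by (auto simp: m mfact_mono_of_set keys_mono_of_set)
  next
    case False
    have "\<not> (\<exists>B. B \<subseteq> {..<n} \<and> card B = d \<and> m = mono_of_set B)"
    proof
      assume "\<exists>B. B \<subseteq> {..<n} \<and> card B = d \<and> m = mono_of_set B"
      then obtain B where B: "B \<subseteq> {..<n}" "m = mono_of_set B" by blast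
      then have "finite B" using finite_subset by blast
      then have "count (mset xs) i \<le> 1" for i
        using xs(3) B(2) lookup_mono_of_set[of B i] by (simp flip: lookup_mono_of_list)
      then show False using False
        by (metis count_eq_zero_iff distinct_count_atmost_1 le_antisym less_one linorder_not_less set_mset_mset)
    qed
    then show ?thesis
      using nc False mfact_pos[of m] unfolding lookup_multiaffine_poly ncoeff_def by auto
  qed
next
  case False
  then show ?thesis
    using homogeneousD[OF multiaffine_poly_homogeneous] by (auto simp: lookup_smear_poly)
qed

text \<open>The approximations are the polynomials \<open>smear_poly\<close> for \<epsilon> = 1 / (k
  + 1).\<close>

lemma strict_Lor_imp_Lorentzian:
  assumes c: "strict_Lor {..<n} d c" and d: "d \<le> n"
  shows "Lorentzian d n (multiaffine_poly d n c)"
  unfolding Lorentzian_def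
proof (intro conjI multiaffine_poly_homogeneous exI allI)
  show "strictly_Lorentzian d n (smear_poly d n c (inverse (real (Suc k))))" for k
    using c d by (intro smear_poly_strictly_Lorentzian) auto
  fix m
  have "((\<lambda>\<epsilon>. Poly_Mapping.lookup (smear_poly d n c \<epsilon>) m) \<longlongrightarrow> Poly_Mapping.lookup (smear_poly d n c 0) m) (at_right 0)"
    unfolding lookup_smear_poly divide_inverse
    by (cases "m \<in> monomials d n") (auto intro!: tendsto_intros tendsto_smear)
  moreover have "filterlim (\<lambda>k. inverse (real (Suc k))) (at_right 0) sequentially"
    using LIMSEQ_inverse_real_of_nat by (auto simp: filterlim_at)
  ultimately show "(\<lambda>k. Poly_Mapping.lookup (smear_poly d n c (inverse (real (Suc k)))) m)
      \<longlonglongrightarrow> Poly_Mapping.lookup (multiaffine_poly d n c) m"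
    unfolding lookup_smear_poly_0[symmetric] by (rule filterlim_compose)
qed

text \<open>A diagonal choice of strict approximations with errors below 1 / (k + 1); only finitely
  many coefficients are involved.\<close>

lemma Lorentzian_limit:
  assumes f: "f \<in> homogeneous d n" and g: "\<And>k :: nat. Lorentzian d n (g k)"
    and lim: "\<And>m. (\<lambda>k. Poly_Mapping.lookup (g k) m) \<longlonglongrightarrow> Poly_Mapping.lookup f m"
  shows "Lorentzian d n f"
proof -
  have "\<exists>h. strictly_Lorentzian d n h \<and>
      (\<forall>m\<in>monomials d n. dist (Poly_Mapping.lookup h m) (Poly_Mapping.lookup (g k) m) < inverse (Suc k))" for k
  proof -
    obtain h where h: "\<And>j. strictly_Lorentzian d n (h j)"
      "\<And>m. (\<lambda>j. Poly_Mapping.lookup (h j) m) \<longlonglongrightarrow> Poly_Mapping.lookup (g k) m"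
      using g[of k] unfolding Lorentzian_def by auto
    have "\<forall>\<^sub>F j in sequentially. \<forall>m\<in>monomials d n.
        dist (Poly_Mapping.lookup (h j) m) (Poly_Mapping.lookup (g k) m) < inverse (Suc k)"
      using h(2) by (intro eventually_ball_finite finite_monomials ballI tendstoD) auto
    then show ?thesis using h(1) by (auto dest!: eventually_happens)
  qed
  then obtain h where h: "\<And>k. strictly_Lorentzian d n (h k)"
    "\<And>k m. m \<in> monomials d n \<Longrightarrow> dist (Poly_Mapping.lookup (h k) m) (Poly_Mapping.lookup (g k) m) < inverse (Suc k)"
    by metis
  have "(\<lambda>k. Poly_Mapping.lookup (h k) m) \<longlonglongrightarrow> Poly_Mapping.lookup f m" for m
  proof (cases "m \<in> monomials d n")
    case True
    have "(\<lambda>k. Poly_Mapping.lookup (h k) m - Poly_Mapping.lookup (g k) m) \<longlonglongrightarrow> 0"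
      using h(2)[OF True]
      by (intro Lim_null_comparison[OF _ LIMSEQ_inverse_real_of_nat] always_eventually)
         (auto simp: dist_norm less_imp_le)
    from tendsto_add[OF this lim[of m]] show ?thesis by simp
  next
    case False
    then have "Poly_Mapping.lookup (h k) m = 0" for k
      using h(1)[of k] homogeneousD unfolding strictly_Lorentzian_def by blast
    moreover have "Poly_Mapping.lookup f m = 0" using f homogeneousD False by blast
    ultimately show ?thesis by simp
  qed
  then show ?thesis unfolding Lorentzian_def using f h(1) by blast
qed

section \<open>The symmetric exclusion process\<close>

definition ksubsets :: "nat \<Rightarrow> nat \<Rightarrow> nat set set" where
  "ksubsets n d = {B. B \<subseteq> {..<n} \<and> card B = d}"

abbreviation swap_image :: "nat \<Rightarrow> nat \<Rightarrow> nat set \<Rightarrow> nat set" where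
  "swap_image a b B \<equiv> Transposition.transpose a b ` B"

text \<open>The sum runs over ordered pairs, so each transposition counts twice and the pairs with a
  = b contribute 0. The factor 2 only rescales time.\<close>

definition exclusion :: "nat \<Rightarrow> (nat set \<Rightarrow> real) \<Rightarrow> nat set \<Rightarrow> real" where
  "exclusion n c B = (\<Sum>a<n. \<Sum>b<n. c (swap_image a b B) - c B)"

lemma finite_ksubsets: "finite (ksubsets n d)"
  unfolding ksubsets_def by simp

lemma transpose_lessThan: "a < n \<Longrightarrow> b < n \<Longrightarrow> i < n \<Longrightarrow> Transposition.transpose a b i < n"
  by (simp add: Transposition.transpose_def)

lemma swap_image_ksubsets:
  assumes "a < n" "b < n" "B \<in> ksubsets n d"
  shows "swap_image a b B \<in> ksubsets n d"
  using assms unfolding ksubsets_def by (auto simp: card_image transpose_lessThan)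

lemma swap_image_one:
  assumes "a \<in> B" "b \<notin> B"
  shows "swap_image a b B = insert b (B - {a})"
  using assms by (auto simp: Transposition.transpose_def image_iff)

lemma swap_image_none:
  "a \<in> B \<longleftrightarrow> b \<in> B \<Longrightarrow> swap_image a b B = B"
  by (auto simp: Transposition.transpose_def image_iff split: if_splits)

text \<open>Exchanging an element of \<open>B\<close> outside \<open>B0\<close> with an element of
  \<open>B0\<close> that \<open>B\<close> lacks brings \<open>B\<close> closer to \<open>B0\<close>,
  so transpositions connect all d-subsets. Both the positivity of the flow and the spectral gap rest
  on this.\<close>

lemma ksubsets_swap_induct:
  assumes B: "B \<in> ksubsets n d" "B0 \<in> ksubsets n d" and base: "P B0"
    and step: "\<And>B a b. B \<in> ksubsets n d \<Longrightarrow> a < n \<Longrightarrow> b < n \<Longrightarrow> P (swap_image a b B) \<Longrightarrow> P B"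
  shows "P B"
  using B(1)
proof (induction "card (B - B0)" arbitrary: B rule: less_induct)
  case less
  have fin: "finite B" "finite B0" "card B = card B0"
    using less.prems B(2) finite_subset[of _ "{..<n}"] by (auto simp: ksubsets_def)
  show ?case
  proof (cases "B = B0")
    case False
    have "\<not> B \<subseteq> B0" "\<not> B0 \<subseteq> B" using False fin card_subset_eq by metis+
    then obtain a b where ab: "a \<in> B" "a \<notin> B0" "b \<in> B0" "b \<notin> B" by blast
    have abn: "a < n" "b < n" using ab less.prems B(2) by (auto simp: ksubsets_def)
    have "swap_image a b B - B0 \<subset> B - B0"
      unfolding swap_image_one[OF ab(1,4)] using ab by auto
    then have "card (swap_image a b B - B0) < card (B - B0)"
      using fin by (intro psubset_card_mono) auto
    then have "P (swap_image a b B)"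
      using less.prems abn by (intro less.hyps swap_image_ksubsets) auto
    then show ?thesis by (rule step[OF less.prems abn])
  qed (use base in simp)
qed

lemma bform_reindex:
  assumes "bij_betw f I J"
  shows "bform J M x y = bform I (\<lambda>i j. M (f i) (f j)) (x \<circ> f) (y \<circ> f)"
  unfolding bform_def
  by (simp add: sum.reindex_bij_betw[OF assms, symmetric])

text \<open>The state in which a form could first degenerate: the coefficients are positive and all
  forms are still weakly hyperbolic.\<close>

context
  fixes n d :: nat and c :: "nat set \<Rightarrow> real"
  assumes d: "d \<le> n"
    and pos: "\<And>B. B \<in> ksubsets n d \<Longrightarrow> 0 < c B"
    and weak: "\<And>A. A \<subseteq> {..<n} \<Longrightarrow> card A + 2 = d \<Longrightarrow> weak_hyperbolic ({..<n} - A) (link_form c A)"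
begin

lemma link_form_entry_pos:
  assumes A: "A \<subseteq> {..<n}" "card A + 2 = d" and ij: "i \<in> {..<n} - A" "j \<in> {..<n} - A" "i \<noteq> j"
  shows "0 < link_form c A i j"
proof (rule link_form_pos[OF _ finite_lessThan A ij])
  show "0 < c B" if "B \<subseteq> {..<n}" "card B = d" for B
    using that by (intro pos) (simp add: ksubsets_def)
qed

lemma link_form_total_pos:
  assumes A: "A \<subseteq> {..<n}" "card A + 2 = d"
  shows "0 < bform ({..<n} - A) (link_form c A) (\<lambda>_. 1) (\<lambda>_. 1)"
proof (rule bform_link_form_ones_pos[OF _ finite_lessThan A])
  show "0 < c B" if "B \<subseteq> {..<n}" "card B = d" for B
    using that by (intro pos) (simp add: ksubsets_def)
qed (use d in simp)

text \<open>The transposition turns row b of the form at \<open>A\<close> into row a of the form at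
  the swapped set, so the coordinate vector at a is orthogonal to the moved y. This vector is
  isotropic, because the diagonal is 0, and \<open>weak_hyperbolic_orthogonal\<close>
  applies.\<close>

lemma kernel_swap_nonpos:
  assumes A: "A \<subseteq> {..<n}" "card A + 2 = d"
    and ker: "\<And>z. bform ({..<n} - A) (link_form c A) y z = 0"
    and a: "a \<in> A" and b: "b \<in> {..<n} - A"
  shows "bform ({..<n} - swap_image a b A) (link_form c (swap_image a b A))
    (y \<circ> Transposition.transpose a b) (y \<circ> Transposition.transpose a b) \<le> 0"
proof -
  let ?A = "swap_image a b A" and ?x = "y \<circ> Transposition.transpose a b"
  let ?I = "{..<n} - A" and ?J = "{..<n} - swap_image a b A"
  let ?M = "link_form c ?A" and ?e = "\<lambda>i. if i = a then 1 else 0 :: real"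
  have fA: "finite A" using A finite_subset by blast
  have A': "?A = insert b (A - {a})" using a b by (intro swap_image_one) auto
  have cA: "?A \<subseteq> {..<n}" "card ?A + 2 = d"
    using A a b by (auto simp: A') (metis A' One_nat_def card_image inj_on_transpose)
  have aJ: "a \<in> ?J" using a b A unfolding A' by auto
  have J: "?J = insert a (?I - {b})" using a b A unfolding A' by auto
  have T: "0 < bform ?J ?M (\<lambda>_. 1) (\<lambda>_. 1)" by (rule link_form_total_pos[OF cA])
  have unit: "bform ?J ?M ?e z = (\<Sum>j\<in>?J. ?M a j * z j)" for z
    using aJ by (intro bform_unit_left) auto
  have "bform ?J ?M ?e ?x = 0"
  proof -
    have "bform ?J ?M ?e ?x = (\<Sum>j\<in>?I - {b}. ?M a j * ?x j)"
      using a unfolding unit unfolding J by (subst sum.insert) (auto simp: link_form_def)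
    also have "\<dots> = (\<Sum>j\<in>?I - {b}. link_form c A b j * y j)"
    proof (intro sum.cong refl arg_cong2[of _ _ _ _ "(*)"])
      fix j assume j: "j \<in> ?I - {b}"
      have "insert a (insert j ?A) = insert b (insert j A)" using a unfolding A' by auto
      then show "?M a j = link_form c A b j" using j a by (auto simp: link_form_def)
      show "?x j = y j" using j a by (auto simp: Transposition.transpose_def)
    qed
    also have "\<dots> = (\<Sum>j\<in>?I. link_form c A b j * y j)"
      by (intro sum.mono_neutral_left) (auto simp: link_form_def)
    also have "\<dots> = bform ?I (link_form c A) (\<lambda>i. if i = b then 1 else 0) y"
      using b by (intro bform_unit_left[symmetric]) auto
    also have "\<dots> = 0" using ker bform_commute[OF sym_on_link_form, of ?I c A _ y] by simp
    finally show ?thesis .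
  qed
  moreover have "bform ?J ?M ?e ?e = 0"
    unfolding unit using aJ by (simp add: if_distrib[of "\<lambda>t. _ * t"] link_form_def cong: if_cong)
  moreover have "0 < bform ?J ?M ?e (\<lambda>_. 1)"
  proof -
    have "card ?J = n - card ?A" using cA(1) finite_subset[OF cA(1)] by (simp add: card_Diff_subset)
    then have "2 \<le> card ?J" using d cA(2) by simp
    then obtain k l where kl: "k \<in> ?J" "l \<in> ?J" "k \<noteq> l" by (rule card_ge_2E)
    define m where "m = (if k = a then l else k)"
    have m: "m \<in> ?J" "m \<noteq> a" using kl unfolding m_def by auto
    have Mp: "0 < ?M a j" if "j \<in> ?J" "j \<noteq> a" for j
      using that by (intro link_form_entry_pos[OF cA aJ]) auto
    have "0 \<le> ?M a j" if "j \<in> ?J" for j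
      using Mp[OF that] by (cases "j = a") (auto simp: link_form_def)
    then show ?thesis unfolding unit using m Mp[OF m] by (intro sum_pos2[of _ m]) auto
  qed
  then have "bform ?J ?M (\<lambda>_. 1) ?e \<noteq> 0"
    using bform_commute[OF sym_on_link_form, of ?J c ?A "?e" "\<lambda>_. 1"] by simp
  ultimately show ?thesis
    using weak_hyperbolic_orthogonal[OF sym_on_link_form weak[OF cA] T, of ?e ?x] by simp
qed

text \<open>The generator yields the sum of the values \<open>R a b\<close> of the swapped forms at
  the moved y; the subtracted terms vanish on the kernel. No \<open>R a b\<close> is positive, and
  one is negative, for some a and b outside \<open>A\<close> at which y differs.\<close>

lemma exclusion_neg_on_kernel:
  assumes A: "A \<subseteq> {..<n}" "card A + 2 = d"
    and ker: "\<And>z. bform ({..<n} - A) (link_form c A) y z = 0"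
    and nz: "\<exists>i\<in>{..<n} - A. y i \<noteq> 0"
  shows "bform ({..<n} - A) (link_form (exclusion n c) A) y y < 0"
proof -
  let ?I = "{..<n} - A" and ?t = "Transposition.transpose"
  let ?M = "link_form c A"
  define R where "R a b = bform ({..<n} - swap_image a b A) (link_form c (swap_image a b A))
    (y \<circ> ?t a b) (y \<circ> ?t a b)" for a b
  have R: "R a b = bform ?I (\<lambda>i j. if i = j then 0 else c (swap_image a b (insert i (insert j A)))) y y"
    if ab: "a < n" "b < n" for a b
  proof -
    have bij: "bij_betw (?t a b) ?I ({..<n} - swap_image a b A)"
    proof -
      have "?t a b ` {..<n} = {..<n}"
        using ab by (intro swap_image_none) auto
      then have "?t a b ` ?I = {..<n} - swap_image a b A"
        by (simp add: image_set_diff)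
      then show ?thesis by (intro bij_betw_imageI) auto
    qed
    have "R a b = bform ?I (\<lambda>i j. link_form c (swap_image a b A) (?t a b i) (?t a b j))
        ((y \<circ> ?t a b) \<circ> ?t a b) ((y \<circ> ?t a b) \<circ> ?t a b)"
      unfolding R_def by (rule bform_reindex[OF bij])
    also have "\<dots> = bform ?I (\<lambda>i j. if i = j then 0 else c (swap_image a b (insert i (insert j A)))) y y"
      by (intro bform_cong) (auto simp: link_form_def dest: injD[OF bij_is_inj[OF bij_transpose]])
    finally show ?thesis .
  qed
  have expand: "bform ?I (link_form (exclusion n c) A) y y = (\<Sum>a<n. \<Sum>b<n. R a b)"
  proof -
    have "bform ?I (link_form (exclusion n c) A) y y
        = (\<Sum>i\<in>?I. \<Sum>j\<in>?I. \<Sum>a<n. \<Sum>b<n.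
            ((if i = j then 0 else c (swap_image a b (insert i (insert j A)))) - ?M i j) * y i * y j)"
      unfolding bform_def by (intro sum.cong refl) (auto simp: link_form_def exclusion_def sum_distrib_right)
    also have "\<dots> = (\<Sum>i\<in>?I. \<Sum>a<n. \<Sum>j\<in>?I. \<Sum>b<n.
            ((if i = j then 0 else c (swap_image a b (insert i (insert j A)))) - ?M i j) * y i * y j)"
      by (intro sum.cong refl sum.swap)
    also have "\<dots> = (\<Sum>a<n. \<Sum>i\<in>?I. \<Sum>j\<in>?I. \<Sum>b<n.
            ((if i = j then 0 else c (swap_image a b (insert i (insert j A)))) - ?M i j) * y i * y j)"
      by (rule sum.swap)
    also have "\<dots> = (\<Sum>a<n. \<Sum>i\<in>?I. \<Sum>b<n. \<Sum>j\<in>?I.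
            ((if i = j then 0 else c (swap_image a b (insert i (insert j A)))) - ?M i j) * y i * y j)"
      by (intro sum.cong refl sum.swap)
    also have "\<dots> = (\<Sum>a<n. \<Sum>b<n. \<Sum>i\<in>?I. \<Sum>j\<in>?I.
            ((if i = j then 0 else c (swap_image a b (insert i (insert j A)))) - ?M i j) * y i * y j)"
      by (intro sum.cong refl sum.swap)
    also have "\<dots> = (\<Sum>a<n. \<Sum>b<n. R a b - bform ?I ?M y y)"
      using R by (intro sum.cong refl) (simp add: bform_def left_diff_distrib sum_subtractf)
    finally show ?thesis using ker[of y] by simp
  qed
  \<comment> \<open>Here the transposition changes y by a multiple of the difference of two
    coordinate vectors. As y is in the kernel, only the quadratic term of this change
    remains.\<close>
  have out: "R a b = - 2 * (y a - y b)\<^sup>2 * ?M a b" if a: "a \<in> ?I" and b: "b \<in> ?I" for a b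
  proof -
    define e where "e k i = (if i = k then 1 else 0 :: real)" for k i :: nat
    define z where "z i = 1 * e a i + (- 1) * e b i" for i
    have A': "swap_image a b A = A" using a b by (intro swap_image_none) auto
    have unit: "bform ?I ?M (e k) x = (\<Sum>j\<in>?I. ?M k j * x j)" if "k \<in> ?I" for k x
      unfolding e_def using that by (intro bform_unit_left) auto
    have ee: "bform ?I ?M (e k) (e l) = ?M k l" if "k \<in> ?I" "l \<in> ?I" for k l
      unfolding unit[OF that(1)] e_def using that
      by (simp add: if_distrib[of "\<lambda>t. _ * t"] cong: if_cong)
    have zz: "bform ?I ?M z z = - 2 * ?M a b"
      unfolding z_def bform_lincomb[OF sym_on_link_form] ee[OF a a] ee[OF a b] ee[OF b b]
      by (simp add: link_form_def)
    have yt: "(y \<circ> ?t a b) i = 1 * y i + (- (y a - y b)) * z i" for i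
      by (auto simp: Transposition.transpose_def z_def e_def)
    have "R a b = bform ?I ?M (\<lambda>i. 1 * y i + (- (y a - y b)) * z i) (\<lambda>i. 1 * y i + (- (y a - y b)) * z i)"
      unfolding R_def A' by (intro bform_cong refl yt)
    then show ?thesis
      unfolding bform_lincomb[OF sym_on_link_form] zz using ker[of y] ker[of z]
      by (simp add: power2_commute)
  qed
  have Mnn: "0 \<le> ?M a b" if "a \<in> ?I" "b \<in> ?I" for a b
    using link_form_entry_pos[OF A that] by (cases "a = b") (auto simp: link_form_def)
  have Rle: "R a b \<le> 0" if ab: "a < n" "b < n" for a b
  proof -
    consider "a \<in> A" "b \<in> A" | "a \<in> A" "b \<notin> A" | "a \<notin> A" "b \<in> A" | "a \<notin> A" "b \<notin> A" by blast
    then show ?thesis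
    proof cases
      case 1
      then have A': "swap_image a b A = A" by (intro swap_image_none) simp
      have "R a b = bform ?I ?M y y"
        unfolding R_def A' using 1 by (intro bform_cong) (auto simp: Transposition.transpose_def)
      then show ?thesis using ker by simp
    next
      case 2
      then show ?thesis unfolding R_def using ab by (intro kernel_swap_nonpos[OF A ker]) auto
    next
      case 3
      then have "R b a \<le> 0" unfolding R_def using ab by (intro kernel_swap_nonpos[OF A ker]) auto
      then show ?thesis unfolding R_def by (simp add: Transposition.transpose_commute)
    next
      case 4
      then show ?thesis using out[of a b] Mnn[of a b] ab by simp
    qed
  qed
  \<comment> \<open>A nonzero constant is not in the kernel, as the all-ones vector has positive
    value.\<close>
  have "\<exists>a\<in>?I. \<exists>b\<in>?I. y a \<noteq> y b"
  proof (rule ccontr)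
    assume n: "\<not> ?thesis"
    obtain i where i: "i \<in> ?I" "y i \<noteq> 0" using nz by blast
    have "y j = y i" if "j \<in> ?I" for j using n i(1) that by blast
    then have "bform ?I ?M y (\<lambda>_. 1) = bform ?I ?M (\<lambda>_. y i * 1) (\<lambda>_. 1)" by (intro bform_cong) auto
    then have "bform ?I ?M (\<lambda>_. 1) (\<lambda>_. 1) = 0" using ker i(2) unfolding bform_scale_left by simp
    then show False using link_form_total_pos[OF A] by simp
  qed
  then obtain a b where ab: "a \<in> ?I" "b \<in> ?I" "y a \<noteq> y b" by blast
  then have "0 < ?M a b" by (intro link_form_entry_pos[OF A]) auto
  then have neg: "R a b < 0" using out[OF ab(1,2)] ab(3) by simp
  have "(\<Sum>b<n. R a b) < (\<Sum>b<n. 0)"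
    using Rle neg ab by (intro sum_strict_mono_ex1) auto
  moreover have "(\<Sum>b<n. R k b) \<le> 0" if "k < n" for k using Rle that by (intro sum_nonpos) auto
  ultimately have "(\<Sum>a<n. \<Sum>b<n. R a b) < (\<Sum>a<n. 0)"
    using ab by (intro sum_strict_mono_ex1) auto
  then show ?thesis unfolding expand by simp
qed

end

section \<open>Openness of strictness and closedness of weak hyperbolicity\<close>

lemma strict_Lor_eventually:
  assumes s: "strict_Lor {..<n} d c0"
    and lim: "\<And>B. B \<in> ksubsets n d \<Longrightarrow> ((\<lambda>r. c r B) \<longlongrightarrow> c0 B) F"
  shows "\<forall>\<^sub>F r in F. strict_Lor {..<n} d (c r)"
proof -
  have "\<forall>\<^sub>F r in F. \<forall>B\<in>ksubsets n d. 0 < c r B"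
  proof (intro eventually_ball_finite finite_ksubsets ballI)
    fix B assume B: "B \<in> ksubsets n d"
    then have "0 < c0 B" using s by (auto simp: ksubsets_def intro: strict_Lor_pos)
    then show "\<forall>\<^sub>F r in F. 0 < c r B" using lim[OF B] by (rule order_tendstoD(1)[rotated])
  qed
  moreover have "\<forall>\<^sub>F r in F. \<forall>A\<in>{A. A \<subseteq> {..<n} \<and> card A + 2 = d}.
      hyperbolic ({..<n} - A) (link_form (c r) A) (\<lambda>_. 1)"
  proof (intro eventually_ball_finite ballI)
    fix A assume "A \<in> {A. A \<subseteq> {..<n} \<and> card A + 2 = d}"
    then have A: "A \<subseteq> {..<n}" "card A + 2 = d" by auto
    show "\<forall>\<^sub>F r in F. hyperbolic ({..<n} - A) (link_form (c r) A) (\<lambda>_. 1)"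
    proof (rule hyperbolic_eventually[OF _ sym_on_link_form sym_on_link_form strict_Lor_hyperbolic[OF s A]])
      fix i j assume "i \<in> {..<n} - A" "j \<in> {..<n} - A"
      then have "insert i (insert j A) \<in> ksubsets n d" if "i \<noteq> j"
        using that A finite_subset[OF A(1)] by (auto simp: ksubsets_def)
      then show "((\<lambda>r. link_form (c r) A i j) \<longlongrightarrow> link_form c0 A i j) F"
        using lim by (auto simp: link_form_def)
    qed simp
  qed simp
  ultimately show ?thesis
    by eventually_elim (auto simp: strict_Lor_def ksubsets_def)
qed

lemma weak_hyperbolic_link_limit:
  assumes A: "A \<subseteq> {..<n}" "card A + 2 = d" and F: "F \<noteq> bot"
    and ev: "\<forall>\<^sub>F r in F. weak_hyperbolic ({..<n} - A) (link_form (c r) A)"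
    and lim: "\<And>B. B \<in> ksubsets n d \<Longrightarrow> ((\<lambda>r. c r B) \<longlongrightarrow> c0 B) F"
  shows "weak_hyperbolic ({..<n} - A) (link_form c0 A)"
  unfolding weak_hyperbolic_def
proof
  fix x
  let ?I = "{..<n} - A"
  have L: "((\<lambda>r. link_form (c r) A i j) \<longlongrightarrow> link_form c0 A i j) F" if "i \<in> ?I" "j \<in> ?I" for i j
  proof -
    have "insert i (insert j A) \<in> ksubsets n d" if "i \<noteq> j"
      using that \<open>i \<in> ?I\<close> \<open>j \<in> ?I\<close> A finite_subset[OF A(1)] by (auto simp: ksubsets_def)
    then show ?thesis using lim by (auto simp: link_form_def)
  qed
  have B: "((\<lambda>r. bform ?I (link_form (c r) A) u v) \<longlongrightarrow> bform ?I (link_form c0 A) u v) F" for u v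
    unfolding bform_def by (intro tendsto_intros L)
  show "bform ?I (link_form c0 A) (\<lambda>_. 1) (\<lambda>_. 1) * bform ?I (link_form c0 A) x x
      \<le> (bform ?I (link_form c0 A) (\<lambda>_. 1) x)\<^sup>2"
  proof (rule tendsto_le[OF F])
    show "((\<lambda>r. (bform ?I (link_form (c r) A) (\<lambda>_. 1) x)\<^sup>2) \<longlongrightarrow> (bform ?I (link_form c0 A) (\<lambda>_. 1) x)\<^sup>2) F"
      by (intro tendsto_intros B)
    show "((\<lambda>r. bform ?I (link_form (c r) A) (\<lambda>_. 1) (\<lambda>_. 1) * bform ?I (link_form (c r) A) x x)
        \<longlongrightarrow> bform ?I (link_form c0 A) (\<lambda>_. 1) (\<lambda>_. 1) * bform ?I (link_form c0 A) x x) F"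
      by (intro tendsto_intros B)
    show "\<forall>\<^sub>F r in F. bform ?I (link_form (c r) A) (\<lambda>_. 1) (\<lambda>_. 1) * bform ?I (link_form (c r) A) x x
        \<le> (bform ?I (link_form (c r) A) (\<lambda>_. 1) x)\<^sup>2"
      using ev by eventually_elim (simp add: weak_hyperbolic_def)
  qed
qed

text \<open>Any differentiable solution of the linear system; explicit ones are supplied by
  \<open>exclusion_flow_coefs\<close>.\<close>

locale exclusion_flow =
  fixes n d :: nat and \<gamma> :: "real \<Rightarrow> nat set \<Rightarrow> real"
  assumes d: "d \<le> n"
    and deriv: "\<And>B s. B \<in> ksubsets n d \<Longrightarrow>
      ((\<lambda>s. \<gamma> s B) has_real_derivative exclusion n (\<gamma> s) B) (at s)"
begin

lemma flow_tendsto: "B \<in> ksubsets n d \<Longrightarrow> ((\<lambda>s. \<gamma> s B) \<longlongrightarrow> \<gamma> s B) (at s within S)"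
  using DERIV_isCont[OF deriv] by (auto simp: isCont_def intro: tendsto_within_subset)

lemma flow_continuous: "B \<in> ksubsets n d \<Longrightarrow> continuous_on S (\<lambda>s. \<gamma> s B)"
  unfolding continuous_on_def using flow_tendsto by blast

text \<open>A minimum principle: at a set with the least coefficient, all terms of the generator are
  nonnegative.\<close>

lemma flow_nonneg:
  assumes nn: "\<And>B. B \<in> ksubsets n d \<Longrightarrow> 0 \<le> \<gamma> 0 B" and s: "0 \<le> s" and B: "B \<in> ksubsets n d"
  shows "0 \<le> \<gamma> s B"
proof -
  have "0 \<le> \<gamma> s B + \<epsilon> * (1 + s)" if \<epsilon>: "\<epsilon> > 0" for \<epsilon>
  proof (rule ccontr)
    assume neg: "\<not> ?thesis"
    \<comment> \<open>The slope \<epsilon> makes the derivative at a minimum positive, and the added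
      value \<epsilon> at time 0 keeps a negative minimum away from the initial time.\<close>
    define h where "h r B = \<gamma> r B + \<epsilon> * (1 + r)" for r B
    have "\<exists>r\<in>{0..s}. \<forall>q\<in>{0..s}. h r B \<le> h q B" if "B \<in> ksubsets n d" for B
    proof (rule continuous_attains_inf)
      show "continuous_on {0..s} (\<lambda>q. h q B)"
        unfolding h_def by (intro continuous_intros flow_continuous[OF that])
    qed (use s in auto)
    then obtain r where r: "\<And>B. B \<in> ksubsets n d \<Longrightarrow> r B \<in> {0..s}"
      "\<And>B q. B \<in> ksubsets n d \<Longrightarrow> q \<in> {0..s} \<Longrightarrow> h (r B) B \<le> h q B"
      by metis
    obtain C where "is_arg_min (\<lambda>B. h (r B) B) (\<lambda>B. B \<in> ksubsets n d) C"
      using ex_is_arg_min_if_finite[OF finite_ksubsets[of n d], of "\<lambda>B. h (r B) B"] B by blast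
    then have C: "C \<in> ksubsets n d" "\<And>B. B \<in> ksubsets n d \<Longrightarrow> h (r C) C \<le> h (r B) B"
      by (auto simp: is_arg_min_linorder)
    have min: "h (r C) C \<le> h q B" if "B \<in> ksubsets n d" "q \<in> {0..s}" for q B
      using C(2)[OF that(1)] r(2)[OF that] by linarith
    have hC: "h (r C) C < 0" using min[OF B, of s] neg s by (simp add: h_def)
    have r0: "r C > 0"
    proof (rule ccontr)
      assume "\<not> r C > 0"
      then have "r C = 0" using r(1)[OF C(1)] by simp
      then show False using hC nn[OF C(1)] \<epsilon> by (simp add: h_def)
    qed
    have "0 \<le> exclusion n (\<gamma> (r C)) C"
      unfolding exclusion_def
    proof (intro sum_nonneg)
      fix a b assume "a \<in> {..<n}" "b \<in> {..<n}"
      then have "h (r C) C \<le> h (r C) (swap_image a b C)"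
        using C(1) r(1)[OF C(1)] by (intro min swap_image_ksubsets) auto
      then show "0 \<le> \<gamma> (r C) (swap_image a b C) - \<gamma> (r C) C" by (simp add: h_def)
    qed
    then have "0 < exclusion n (\<gamma> (r C)) C + \<epsilon>" using \<epsilon> by simp
    moreover have "((\<lambda>q. h q C) has_real_derivative exclusion n (\<gamma> (r C)) C + \<epsilon>) (at (r C))"
      unfolding h_def by (auto intro!: derivative_eq_intros deriv C(1))
    ultimately obtain \<delta> where \<delta>: "\<delta> > 0" "\<And>q. 0 < q \<Longrightarrow> q < \<delta> \<Longrightarrow> h (r C - q) C < h (r C) C"
      using DERIV_pos_inc_left by blast
    define q where "q = min (\<delta> / 2) (r C)"
    have q: "0 < q" "q < \<delta>" "q \<le> r C" using \<delta>(1) r0 unfolding q_def by auto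
    then have "h (r C) C \<le> h (r C - q) C" using r(1)[OF C(1)] by (intro min C(1)) auto
    then show False using \<delta>(2)[OF q(1,2)] by simp
  qed
  then have lim: "0 \<le> \<gamma> s B + \<epsilon> * (1 + s)" if "\<epsilon> > 0" for \<epsilon> using that by blast
  have "\<gamma> s B \<ge> 0"
  proof (rule ccontr)
    assume "\<not> ?thesis"
    then have "0 < (- \<gamma> s B / 2) / (1 + s)" using s by (intro divide_pos_pos) auto
    moreover have "x / (1 + s) * (1 + s) = x" for x using s by simp
    ultimately have "0 \<le> \<gamma> s B + (- \<gamma> s B / 2)" using lim by metis
    then show False using \<open>\<not> 0 \<le> \<gamma> s B\<close> by simp
  qed
  then show ?thesis .
qed

text \<open>The generator is the sum over all swaps minus n^2 times the identity, and the
  integrating factor exp (n^2 r) removes the second term. A coefficient then grows strictly while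
  one of its neighbours is positive, so positivity spreads along transpositions.\<close>

lemma flow_pos:
  assumes nn: "\<And>B. B \<in> ksubsets n d \<Longrightarrow> 0 \<le> \<gamma> 0 B" and B0: "B0 \<in> ksubsets n d" "0 < \<gamma> 0 B0"
    and s: "0 < s" and B: "B \<in> ksubsets n d"
  shows "0 < \<gamma> s B"
proof -
  define h where "h B r = exp (real n * real n * r) * \<gamma> r B" for B r
  define D where "D B r = exp (real n * real n * r) * (\<Sum>a<n. \<Sum>b<n. \<gamma> r (swap_image a b B))" for B r
  have nn': "0 \<le> \<gamma> r B" if "0 \<le> r" "B \<in> ksubsets n d" for r B
    using nn that by (rule flow_nonneg)
  have dh: "(h B has_real_derivative D B r) (at r)" if "B \<in> ksubsets n d" for B r
  proof -
    have "D B r = exp (real n * real n * r) * exclusion n (\<gamma> r) B + exp (real n * real n * r) * (real n * real n) * \<gamma> r B"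
      unfolding D_def exclusion_def by (simp add: sum_subtractf algebra_simps)
    then show ?thesis
      unfolding h_def by (auto intro!: derivative_eq_intros deriv that simp: mult_ac)
  qed
  have D_ge: "exp (real n * real n * r) * \<gamma> r (swap_image a b B) \<le> D B r"
    if "0 \<le> r" "B \<in> ksubsets n d" "a < n" "b < n" for r B a b
  proof -
    have t: "0 \<le> \<gamma> r (swap_image a b B)" if "a < n" "b < n" for a b
      using \<open>0 \<le> r\<close> \<open>B \<in> ksubsets n d\<close> that by (intro nn' swap_image_ksubsets)
    have "\<gamma> r (swap_image a b B) \<le> (\<Sum>b<n. \<gamma> r (swap_image a b B))"
      using that t by (intro member_le_sum) auto
    also have "\<dots> \<le> (\<Sum>a<n. \<Sum>b<n. \<gamma> r (swap_image a b B))"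
      using that t by (intro member_le_sum[of a]) (auto intro!: sum_nonneg)
    finally show ?thesis unfolding D_def by simp
  qed
  have D_nn: "0 \<le> D B r" if "0 \<le> r" "B \<in> ksubsets n d" for r B
    unfolding D_def using that by (intro mult_nonneg_nonneg sum_nonneg nn' swap_image_ksubsets) auto
  have base: "0 < \<gamma> r B0" if "0 < r" for r
  proof -
    have "h B0 0 \<le> h B0 r"
    proof (rule DERIV_nonneg_imp_nondecreasing[of 0 r "h B0"])
      show "\<exists>y. (h B0 has_real_derivative y) (at q) \<and> 0 \<le> y" if "0 \<le> q" "q \<le> r" for q
        using dh[OF B0(1), of q] D_nn[OF that(1) B0(1)] by blast
    qed (use that in simp)
    then have "0 < h B0 r" using B0(2) by (simp add: h_def)
    then show ?thesis by (simp add: h_def zero_less_mult_iff)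
  qed
  have step: "0 < \<gamma> r B" if B: "B \<in> ksubsets n d" and r: "0 < r" and ab: "a < n" "b < n"
    and p: "\<And>r. 0 < r \<Longrightarrow> 0 < \<gamma> r (swap_image a b B)" for B a b r
  proof -
    \<comment> \<open>The interval starts at r / 2, since the neighbour is known to be positive only
      at positive times.\<close>
    have "h B (r / 2) < h B r"
    proof (rule DERIV_pos_imp_increasing[of "r / 2" r "h B"])
      show "r / 2 < r" using r by simp
      fix q assume q: "r / 2 \<le> q" "q \<le> r"
      then have "0 < exp (real n * real n * q) * \<gamma> q (swap_image a b B)" using r by (simp add: p)
      then have "0 < D B q" using D_ge[OF _ B ab, of q] q r by simp
      then show "\<exists>y. (h B has_real_derivative y) (at q) \<and> 0 < y" using dh[OF B] by blast
    qed
    moreover have "0 \<le> h B (r / 2)" unfolding h_def using r B nn' by simp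
    ultimately have "0 < h B r" by linarith
    then show ?thesis by (simp add: h_def zero_less_mult_iff)
  qed
  have "\<forall>r>0. 0 < \<gamma> r B"
  proof (rule ksubsets_swap_induct[OF B B0(1)])
    show "\<forall>r>0. 0 < \<gamma> r B0" using base by blast
    show "\<forall>r>0. 0 < \<gamma> r B"
      if "B \<in> ksubsets n d" "a < n" "b < n" "\<forall>r>0. 0 < \<gamma> r (swap_image a b B)" for B a b
      using step[OF that(1) _ that(2,3)] that(4) by blast
  qed
  then show ?thesis using s by blast
qed

text \<open>
  If one of the forms degenerated at time \<open>s0\<close>, it would decrease on its kernel vector, and so would
  already have been too large there shortly before.
\<close>

lemma flow_strict_Lor_at:
  assumes \<delta>: "\<delta> > 0" and pos: "\<And>B. B \<in> ksubsets n d \<Longrightarrow> 0 < \<gamma> s0 B"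
    and weak: "\<And>r A. s0 - \<delta> < r \<Longrightarrow> r \<le> s0 \<Longrightarrow> A \<subseteq> {..<n} \<Longrightarrow> card A + 2 = d \<Longrightarrow>
      weak_hyperbolic ({..<n} - A) (link_form (\<gamma> r) A)"
  shows "strict_Lor {..<n} d (\<gamma> s0)"
proof (rule ccontr)
  assume "\<not> ?thesis"
  then obtain A where A: "A \<subseteq> {..<n}" "card A + 2 = d"
    and nh: "\<not> hyperbolic ({..<n} - A) (link_form (\<gamma> s0) A) (\<lambda>_. 1)"
    using pos unfolding strict_Lor_def ksubsets_def by auto
  let ?I = "{..<n} - A"
  have weak0: "weak_hyperbolic ({..<n} - A) (link_form (\<gamma> s0) A)" if "A \<subseteq> {..<n}" "card A + 2 = d" for A
    using weak[of s0 A] \<delta> that by simp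
  define T where "T r = bform ?I (link_form (\<gamma> r) A) (\<lambda>_. 1) (\<lambda>_. 1)" for r
  have T: "T s0 > 0" unfolding T_def by (rule link_form_total_pos[OF d pos weak0 A])
  obtain y where nz: "\<exists>i\<in>?I. y i \<noteq> 0" and ker: "\<And>z. bform ?I (link_form (\<gamma> s0) A) y z = 0"
    using weak_hyperbolic_degenerate[OF sym_on_link_form weak0[OF A] T[unfolded T_def] nh] by blast
  have neg: "bform ?I (link_form (exclusion n (\<gamma> s0)) A) y y < 0"
    by (rule exclusion_neg_on_kernel[OF d pos weak0 A ker nz])
  have db: "((\<lambda>r. bform ?I (link_form (\<gamma> r) A) u v) has_real_derivative
      bform ?I (link_form (exclusion n (\<gamma> s0)) A) u v) (at s0)" for u v
    unfolding bform_def
  proof (intro DERIV_sum DERIV_cmult_right)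
    fix i j assume ij: "i \<in> ?I" "j \<in> ?I"
    show "((\<lambda>r. link_form (\<gamma> r) A i j) has_real_derivative link_form (exclusion n (\<gamma> s0)) A i j) (at s0)"
    proof (cases "i = j")
      case False
      then have "insert i (insert j A) \<in> ksubsets n d"
        using ij A finite_subset[OF A(1)] by (auto simp: ksubsets_def)
      then show ?thesis using False deriv by (simp add: link_form_def)
    qed (simp add: link_form_def)
  qed
  \<comment> \<open>The defect in \<open>weak_hyperbolic\<close>, so nonpositive shortly before
    \<open>s0\<close>. It vanishes at \<open>s0\<close>, and its derivative there is
    \<open>T s0\<close> times the value from \<open>neg\<close>: the other terms contain the form at
    y and drop out.\<close>
  define f where "f r = T r * bform ?I (link_form (\<gamma> r) A) y y - (bform ?I (link_form (\<gamma> r) A) (\<lambda>_. 1) y)\<^sup>2" for r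
  have y1: "bform ?I (link_form (\<gamma> s0) A) (\<lambda>_. 1) y = 0"
    using ker bform_commute[OF sym_on_link_form, of ?I "\<gamma> s0" A "\<lambda>_. 1" y] by simp
  have "(f has_real_derivative T s0 * bform ?I (link_form (exclusion n (\<gamma> s0)) A) y y) (at s0)"
    unfolding f_def T_def by (rule derivative_eq_intros db refl)+ (simp add: ker y1)
  moreover have "T s0 * bform ?I (link_form (exclusion n (\<gamma> s0)) A) y y < 0"
    using T neg by (simp add: mult_less_0_iff)
  ultimately obtain \<eta> where \<eta>: "\<eta> > 0" "\<And>q. 0 < q \<Longrightarrow> q < \<eta> \<Longrightarrow> f s0 < f (s0 - q)"
    using DERIV_neg_dec_left by blast
  define q where "q = min \<eta> \<delta> / 2"
  have q: "0 < q" "q < \<eta>" "q < \<delta>" using \<eta>(1) \<delta> unfolding q_def by auto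
  have "f s0 = 0" unfolding f_def using ker y1 by simp
  then have "0 < f (s0 - q)" using \<eta>(2)[OF q(1,2)] by simp
  moreover have "f (s0 - q) \<le> 0"
    using weak[of "s0 - q" A] q A unfolding weak_hyperbolic_def f_def T_def by simp
  ultimately show False by simp
qed

text \<open>At the infimum t of the times of failure, openness shows that the condition fails,
  whereas limits from the left give weak hyperbolicity; \<open>flow_strict_Lor_at\<close> excludes
  this.\<close>

lemma flow_strict_Lor:
  assumes s0: "strict_Lor {..<n} d (\<gamma> 0)" and s: "0 \<le> s"
  shows "strict_Lor {..<n} d (\<gamma> s)"
proof (rule ccontr)
  assume bad: "\<not> ?thesis"
  define X where "X = {s. 0 \<le> s \<and> \<not> strict_Lor {..<n} d (\<gamma> s)}"
  have X: "s \<in> X" "bdd_below X" using s bad unfolding X_def by (auto intro: bdd_belowI[of _ 0])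
  define t where "t = Inf X"
  have below: "strict_Lor {..<n} d (\<gamma> r)" if "0 \<le> r" "r < t" for r
    using that X(2) cInf_lower[of r X] unfolding t_def X_def by (force simp: not_le)
  have open_at: "\<exists>\<eta>>0. \<forall>q. dist q r < \<eta> \<longrightarrow> strict_Lor {..<n} d (\<gamma> q)" if "strict_Lor {..<n} d (\<gamma> r)" for r
  proof -
    have "\<forall>\<^sub>F q in nhds r. strict_Lor {..<n} d (\<gamma> q)"
      using DERIV_isCont[OF deriv] that
      by (intro strict_Lor_eventually) (auto simp: continuous_within intro: tendsto_at_iff_tendsto_nhds[THEN iffD1])
    then show ?thesis by (auto simp: eventually_nhds_metric)
  qed
  have not_strict_Lor: "\<not> strict_Lor {..<n} d (\<gamma> t)" if "0 \<le> t"
  proof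
    assume "strict_Lor {..<n} d (\<gamma> t)"
    then obtain \<eta> where \<eta>: "\<eta> > 0" "\<And>q. dist q t < \<eta> \<Longrightarrow> strict_Lor {..<n} d (\<gamma> q)"
      using open_at by blast
    have "t + \<eta> \<le> x" if "x \<in> X" for x
    proof (rule ccontr)
      assume "\<not> ?thesis"
      moreover have "t \<le> x" unfolding t_def using X that by (intro cInf_lower)
      ultimately have "dist x t < \<eta>" by (simp add: dist_real_def)
      then show False using \<eta>(2) that unfolding X_def by blast
    qed
    then have "t + \<eta> \<le> t" using X unfolding t_def by (intro cInf_greatest) auto
    then show False using \<eta>(1) by simp
  qed
  have "0 \<le> t" unfolding t_def using X by (intro cInf_greatest) (auto simp: X_def)
  then have t: "0 < t" using not_strict_Lor s0 by (cases "t = 0") auto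
  have nn: "0 \<le> \<gamma> 0 B" if "B \<in> ksubsets n d" for B
    using strict_Lor_pos[OF s0, of B] that by (auto simp: ksubsets_def)
  have "{..<d} \<in> ksubsets n d" using d by (auto simp: ksubsets_def)
  moreover have "0 < \<gamma> 0 {..<d}" using d by (intro strict_Lor_pos[OF s0]) auto
  ultimately have pos: "0 < \<gamma> t B" if "B \<in> ksubsets n d" for B
    using flow_pos nn t that by blast
  have weak_below: "weak_hyperbolic ({..<n} - A) (link_form (\<gamma> r) A)"
    if "0 \<le> r" "r < t" "A \<subseteq> {..<n}" "card A + 2 = d" for r A
    using strict_Lor_hyperbolic[OF below[OF that(1,2)] that(3,4)] hyperbolic_imp_weak[OF sym_on_link_form] by blast
  have "weak_hyperbolic ({..<n} - A) (link_form (\<gamma> t) A)" if A: "A \<subseteq> {..<n}" "card A + 2 = d" for A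
  proof (rule weak_hyperbolic_link_limit[OF A, of "at_left t" \<gamma>])
    show "\<forall>\<^sub>F r in at_left t. weak_hyperbolic ({..<n} - A) (link_form (\<gamma> r) A)"
      using t weak_below A by (auto simp: eventually_at_left intro!: exI[of _ 0])
    show "((\<lambda>r. \<gamma> r B) \<longlongrightarrow> \<gamma> t B) (at_left t)" if "B \<in> ksubsets n d" for B
      using that by (rule flow_tendsto)
  qed simp
  then have "strict_Lor {..<n} d (\<gamma> t)"
    using t pos weak_below by (intro flow_strict_Lor_at[of t]) (auto simp: le_less)
  then show False using not_strict_Lor t by simp
qed

end

section \<open>Contractive flows and balls\<close>

definition fin_space :: "nat \<Rightarrow> (nat \<Rightarrow> real) set" where
  "fin_space k = {x. \<forall>i\<ge>k. x i = 0}"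

lemma closed_unit_ball_eq:
  "closed_unit_ball k = top_of_set {x \<in> fin_space k. (\<Sum>i<k. (x i)\<^sup>2) \<le> 1}"
  unfolding closed_unit_ball_def Euclidean_space_def euclidean_product_topology subtopology_subtopology
    fin_space_def by (rule arg_cong[where f = top_of_set]) auto

lemma closed_fin_space: "closed (fin_space k)"
proof -
  have "fin_space k = (\<Inter>i\<in>{k..}. {x. x i = 0})" unfolding fin_space_def by auto
  moreover have "closed {x :: nat \<Rightarrow> real. x i = 0}" for i
    by (intro closed_Collect_eq continuous_on_coordinate continuous_on_const)
  ultimately show ?thesis by auto
qed

text \<open>Every proper contraction moves \<open>K\<close> into the relatively open set
  \<open>U\<close>. Hence each ray leaves \<open>K\<close> exactly once, and the Minkowski
  functional is continuous.\<close>

locale strictly_starlike =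
  fixes k :: nat and K U :: "(nat \<Rightarrow> real) set"
  assumes K: "K \<subseteq> fin_space k" "compact K" and UK: "U \<subseteq> K"
    and U: "openin (top_of_set (fin_space k)) U"
    and star: "\<And>x t. x \<in> K \<Longrightarrow> 0 \<le> t \<Longrightarrow> t < 1 \<Longrightarrow> (\<lambda>i. t * x i) \<in> U"
    and ne: "K \<noteq> {}"
begin

definition gauge :: "(nat \<Rightarrow> real) \<Rightarrow> real" where
  "gauge x = Inf {t. 0 < t \<and> (\<lambda>i. 1 / t * x i) \<in> K}"

lemma scale_fin_space: "x \<in> fin_space k \<Longrightarrow> (\<lambda>i. t * x i) \<in> fin_space k"
  unfolding fin_space_def by simp

lemma zero_in_U: "(\<lambda>_. 0) \<in> U"
  using ne star[of _ 0] by auto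

lemma open_scale:
  assumes x: "x \<in> fin_space k" and t: "(\<lambda>i. t * x i) \<in> U"
  shows "\<exists>e>0. \<forall>s. \<bar>s - t\<bar> < e \<longrightarrow> (\<lambda>i. s * x i) \<in> U"
proof -
  obtain T where T: "open T" "U = fin_space k \<inter> T" using U by (auto simp: openin_open)
  have "continuous_on UNIV (\<lambda>s. (\<lambda>i. s * x i))"
    by (intro continuous_on_coordinatewise_then_product continuous_intros)
  then have "open ((\<lambda>s. (\<lambda>i. s * x i)) -` T)" using T(1) by (intro open_vimage)
  moreover have "t \<in> (\<lambda>s. (\<lambda>i. s * x i)) -` T" using t T by auto
  ultimately obtain e where "e > 0" "\<And>s. dist s t < e \<Longrightarrow> s \<in> (\<lambda>s. (\<lambda>i. s * x i)) -` T"
    unfolding open_dist by blast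
  then show ?thesis using T x scale_fin_space by (auto simp: dist_real_def)
qed

lemma scale_down:
  assumes "(\<lambda>i. s * x i) \<in> K" "0 \<le> t" "t < s"
  shows "(\<lambda>i. t * x i) \<in> U"
proof -
  have "(\<lambda>i. t / s * (s * x i)) \<in> U" using assms by (intro star) auto
  then show ?thesis using assms by simp
qed

lemma gauge_set: "x \<in> fin_space k \<Longrightarrow> {t. 0 < t \<and> (\<lambda>i. 1 / t * x i) \<in> K} \<noteq> {}"
  "bdd_below {t. 0 < t \<and> (\<lambda>i. 1 / t * x i) \<in> K}"
proof -
  assume x: "x \<in> fin_space k"
  obtain e where e: "e > 0" "\<And>s. \<bar>s - 0\<bar> < e \<Longrightarrow> (\<lambda>i. s * x i) \<in> U"
    using open_scale[OF x, of 0] zero_in_U by auto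
  have "1 / (2 / e) = e / 2" by simp
  moreover have "(\<lambda>i. e / 2 * x i) \<in> U" using e(1) by (intro e(2)) auto
  ultimately have "(\<lambda>i. 1 / (2 / e) * x i) \<in> K" using UK by (simp only: subset_iff)
  then have "0 < 2 / e \<and> (\<lambda>i. 1 / (2 / e) * x i) \<in> K" using e(1) by (intro conjI divide_pos_pos) simp
  then show "{t. 0 < t \<and> (\<lambda>i. 1 / t * x i) \<in> K} \<noteq> {}" by blast
qed (auto intro: bdd_belowI[of _ 0])

lemma gauge_nonneg: "x \<in> fin_space k \<Longrightarrow> 0 \<le> gauge x"
  unfolding gauge_def using gauge_set by (intro cInf_greatest) auto

text \<open>The strict sublevel sets are dilates of the open set \<open>U\<close>; by
  \<open>gauge_le_iff\<close>, the non-strict ones are dilates of the closed set \<open>K\<close>.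
  Together they give the two halves of continuity.\<close>

lemma gauge_less_iff:
  assumes x: "x \<in> fin_space k" and t: "0 < t"
  shows "gauge x < t \<longleftrightarrow> (\<lambda>i. 1 / t * x i) \<in> U"
proof
  assume "gauge x < t"
  then obtain s where s: "0 < s" "(\<lambda>i. 1 / s * x i) \<in> K" "s < t"
    unfolding gauge_def using cInf_lessD[OF gauge_set(1)[OF x]] by blast
  then show "(\<lambda>i. 1 / t * x i) \<in> U"
    using t by (intro scale_down[OF s(2)]) (auto simp: field_simps)
next
  assume "(\<lambda>i. 1 / t * x i) \<in> U"
  then obtain e where e: "e > 0" "\<And>s. \<bar>s - 1 / t\<bar> < e \<Longrightarrow> (\<lambda>i. s * x i) \<in> U"
    using open_scale[OF x] by blast
  \<comment> \<open>Chosen such that 1 / s exceeds 1 / t by e / 2, which is still within the range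
    of \<open>e\<close>.\<close>
  define s where "s = 1 / (1 / t + e / 2)"
  have s: "0 < s" "s < t" unfolding s_def using t e(1) by (auto simp: field_simps add_pos_pos)
  have "1 / s = 1 / t + e / 2" unfolding s_def by simp
  then have "(\<lambda>i. 1 / s * x i) \<in> K" using e(2)[of "1 / s"] e(1) UK by auto
  then have "gauge x \<le> s" unfolding gauge_def using s gauge_set(2) by (intro cInf_lower) auto
  then show "gauge x < t" using s by simp
qed

lemma gauge_le_iff:
  assumes x: "x \<in> fin_space k" and t: "0 < t"
  shows "gauge x \<le> t \<longleftrightarrow> (\<lambda>i. 1 / t * x i) \<in> K"
proof
  assume le: "gauge x \<le> t"
  have cont: "continuous_on UNIV (\<lambda>s. (\<lambda>i. s * x i))"
    by (intro continuous_on_coordinatewise_then_product continuous_intros)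
  have "closed ((\<lambda>s. (\<lambda>i. s * x i)) -` K)"
    using compact_imp_closed[OF K(2)] cont by (intro closed_vimage)
  \<comment> \<open>The levels t + 1 / (m + 1) lie above the gauge, so \<open>gauge_less_iff\<close>
    applies to them, and \<open>K\<close> is closed.\<close>
  moreover have "1 / (t + 1 / real (Suc m)) \<in> (\<lambda>s. (\<lambda>i. s * x i)) -` K" for m
  proof -
    have "gauge x < t + 1 / real (Suc m)" using le by (simp add: add_strict_increasing2 less_add_same_cancel1 le_less_trans)
    then show ?thesis using gauge_less_iff[OF x, of "t + 1 / real (Suc m)"] t UK by (auto simp: add_pos_pos)
  qed
  moreover have "(\<lambda>m. 1 / (t + 1 / real (Suc m))) \<longlonglongrightarrow> 1 / (t + 0)"
    using t by (intro tendsto_intros LIMSEQ_Suc[OF lim_1_over_n]) auto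
  ultimately have "1 / (t + 0) \<in> (\<lambda>s. (\<lambda>i. s * x i)) -` K" by (rule closed_sequentially)
  then show "(\<lambda>i. 1 / t * x i) \<in> K" by simp
next
  assume "(\<lambda>i. 1 / t * x i) \<in> K"
  then show "gauge x \<le> t" unfolding gauge_def using t gauge_set(2) by (intro cInf_lower) auto
qed

lemma continuous_map_gauge: "continuous_map (top_of_set (fin_space k)) euclideanreal gauge"
  unfolding continuous_map_upper_lower_semicontinuous_lt
proof (intro allI conjI)
  have cont: "continuous_on (fin_space k) (\<lambda>x. (\<lambda>i. t * x i))" for t :: real
    by (intro continuous_on_coordinatewise_then_product continuous_intros continuous_on_coordinate)
  have le_closed: "closedin (top_of_set (fin_space k)) {x \<in> fin_space k. gauge x \<le> t}" if "t > 0" for t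
  proof -
    have "closedin (top_of_set (fin_space k)) (fin_space k \<inter> (\<lambda>x. (\<lambda>i. 1 / t * x i)) -` K)"
      using compact_imp_closed[OF K(2)] cont by (rule continuous_closedin_preimage[rotated])
    moreover have "fin_space k \<inter> (\<lambda>x. (\<lambda>i. 1 / t * x i)) -` K = {x \<in> fin_space k. gauge x \<le> t}"
      using gauge_le_iff that by auto
    ultimately show ?thesis by simp
  qed
  fix a
  show "openin (top_of_set (fin_space k)) {x \<in> topspace (top_of_set (fin_space k)). gauge x < a}"
  proof (cases "a > 0")
    case True
    have "openin (top_of_set (fin_space k)) {x \<in> topspace (top_of_set (fin_space k)). (\<lambda>i. 1 / a * x i) \<in> U}"
    proof (rule openin_continuous_map_preimage[OF _ U])
      show "continuous_map (top_of_set (fin_space k)) (top_of_set (fin_space k)) (\<lambda>x i. 1 / a * x i)"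
        unfolding continuous_map_subtopology_eu using cont scale_fin_space by blast
    qed
    moreover have "{x \<in> topspace (top_of_set (fin_space k)). (\<lambda>i. 1 / a * x i) \<in> U}
        = {x \<in> topspace (top_of_set (fin_space k)). gauge x < a}"
      using gauge_less_iff True by auto
    ultimately show ?thesis by simp
  next
    case False
    then have "{x \<in> topspace (top_of_set (fin_space k)). gauge x < a} = {}"
      using gauge_nonneg by force
    then show ?thesis by (simp only: openin_empty)
  qed
  show "openin (top_of_set (fin_space k)) {x \<in> topspace (top_of_set (fin_space k)). a < gauge x}"
  proof (cases "a \<ge> 0")
    case True
    \<comment> \<open>Closedness is known for positive levels only, so the level a is approached
      from above.\<close>
    have *: "{x \<in> fin_space k. a < gauge x} = (\<Union>t\<in>{a<..}. fin_space k - {x \<in> fin_space k. gauge x \<le> t})"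
    proof (rule Set.set_eqI, rule iffI)
      fix x assume "x \<in> {x \<in> fin_space k. a < gauge x}"
      then obtain t where "a < t" "t < gauge x" "x \<in> fin_space k" using dense by blast
      then show "x \<in> (\<Union>t\<in>{a<..}. fin_space k - {x \<in> fin_space k. gauge x \<le> t})"
        by (intro UN_I[of t]) auto
    qed auto
    have "openin (top_of_set (fin_space k)) (fin_space k - {x \<in> fin_space k. gauge x \<le> t})" if "t > a" for t
      using le_closed[of t] that True by (auto simp: closedin_def)
    then have "openin (top_of_set (fin_space k)) (\<Union>t\<in>{a<..}. fin_space k - {x \<in> fin_space k. gauge x \<le> t})"
      by (intro openin_Union) (simp only: image_iff greaterThan_iff, blast)
    then show ?thesis by (simp only: topspace_euclidean_subtopology *)
  next
    case False
    then have "{x \<in> topspace (top_of_set (fin_space k)). a < gauge x} = fin_space k"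
      using gauge_nonneg by force
    then show ?thesis by (metis openin_topspace topspace_euclidean_subtopology)
  qed
qed

lemma continuous_on_gauge: "continuous_on (fin_space k) gauge"
  using continuous_map_gauge by simp

lemma gauge_scale:
  assumes x: "x \<in> fin_space k" and c: "0 < c"
  shows "gauge (\<lambda>i. c * x i) = c * gauge x"
proof -
  have iff: "gauge (\<lambda>i. c * x i) \<le> t \<longleftrightarrow> c * gauge x \<le> t" if "t > 0" for t
  proof -
    have "gauge (\<lambda>i. c * x i) \<le> t \<longleftrightarrow> (\<lambda>i. 1 / t * (c * x i)) \<in> K"
      using that x scale_fin_space by (intro gauge_le_iff) auto
    also have "(\<lambda>i. 1 / t * (c * x i)) = (\<lambda>i. 1 / (t / c) * x i)"
      by (simp add: field_simps)
    also have "\<dots> \<in> K \<longleftrightarrow> gauge x \<le> t / c" using that x c by (intro gauge_le_iff[symmetric]) auto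
    finally show ?thesis using c by (simp add: field_simps)
  qed
  have nn: "0 \<le> gauge (\<lambda>i. c * x i)" "0 \<le> c * gauge x"
    using gauge_nonneg x c scale_fin_space by auto
  show ?thesis
  proof (rule antisym; rule field_le_epsilon)
    fix e :: real assume e: "e > 0"
    show "gauge (\<lambda>i. c * x i) \<le> c * gauge x + e" using iff[of "c * gauge x + e"] nn e by simp
    show "c * gauge x \<le> gauge (\<lambda>i. c * x i) + e" using iff[of "gauge (\<lambda>i. c * x i) + e"] nn e by simp
  qed
qed

lemma gauge_eq_0_imp:
  assumes x: "x \<in> fin_space k" and g: "gauge x = 0"
  shows "x = (\<lambda>_. 0)"
proof
  fix i
  have "compact ((\<lambda>y. y i) ` K)"
    by (intro compact_continuous_image continuous_on_coordinate K)
  from compact_imp_bounded[OF this] obtain b where "\<forall>y\<in>(\<lambda>y. y i) ` K. norm y \<le> b"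
    unfolding bounded_iff by blast
  then have b: "\<bar>y i\<bar> \<le> b" if "y \<in> K" for y using that by auto
  show "x i = 0"
  proof (rule ccontr)
    assume xi: "x i \<noteq> 0"
    \<comment> \<open>Division by t scales coordinate i to |b| + 1 in absolute value, beyond the
      bound b on \<open>K\<close>.\<close>
    define t where "t = \<bar>x i\<bar> / (\<bar>b\<bar> + 1)"
    have t: "t > 0" unfolding t_def using xi by (intro divide_pos_pos) auto
    have "(\<lambda>i. 1 / t * x i) \<in> K" using gauge_le_iff[OF x t] g t by simp
    then have "\<bar>1 / t * x i\<bar> \<le> b" by (rule b)
    moreover have "\<bar>1 / t * x i\<bar> = \<bar>b\<bar> + 1" unfolding t_def using xi by (simp add: abs_mult)
    ultimately show False by linarith
  qed
qed

lemma gauge_0: "gauge (\<lambda>_. 0) = 0"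
proof -
  have "gauge (\<lambda>i. 2 * 0) = 2 * gauge (\<lambda>_. 0)"
    by (rule gauge_scale) (auto simp: fin_space_def)
  then show ?thesis by simp
qed

text \<open>Moves points along rays such that the gauge becomes the Euclidean norm. At the origin,
  division by zero gives 0, the right value.\<close>

definition radial :: "(nat \<Rightarrow> real) \<Rightarrow> nat \<Rightarrow> real" where
  "radial x = (\<lambda>i. gauge x / L2_set x {..<k} * x i)"

lemma L2_scale: "L2_set (\<lambda>i. c * x i) {..<k} = \<bar>c\<bar> * L2_set x {..<k}" for c :: real
  unfolding L2_set_def by (simp add: power_mult_distrib real_sqrt_mult flip: sum_distrib_left)

lemma L2_eq_0: "x \<in> fin_space k \<Longrightarrow> L2_set x {..<k} = 0 \<longleftrightarrow> x = (\<lambda>_. 0)"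
  unfolding fin_space_def by (auto simp: L2_set_eq_0_iff fun_eq_iff) (metis lessThan_iff not_le)

lemma L2_radial:
  assumes x: "x \<in> fin_space k"
  shows "L2_set (radial x) {..<k} = gauge x"
proof (cases "x = (\<lambda>_. 0)")
  case True
  then show ?thesis by (simp add: radial_def gauge_0 L2_set_def)
next
  case False
  then have "L2_set x {..<k} \<noteq> 0" using L2_eq_0[OF x] by simp
  then show ?thesis unfolding radial_def L2_scale using gauge_nonneg[OF x] by simp
qed

lemma continuous_on_L2: "continuous_on S (\<lambda>x. L2_set x {..<k})"
  unfolding L2_set_def by (intro continuous_intros continuous_on_coordinate)

lemma continuous_on_radial: "continuous_on (fin_space k) radial"
proof (intro continuous_on_coordinatewise_then_product)
  fix i
  show "continuous_on (fin_space k) (\<lambda>x. radial x i)"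
    unfolding continuous_on_def
  proof
    fix x assume x: "x \<in> fin_space k"
    show "((\<lambda>x. radial x i) \<longlongrightarrow> radial x i) (at x within fin_space k)"
    proof (cases "x = (\<lambda>_. 0)")
      case True
      \<comment> \<open>At the origin the quotient has no limit to work with, but the coordinates
        are bounded by the gauge, which tends to 0.\<close>
      have "\<bar>radial y i\<bar> \<le> gauge y" if y: "y \<in> fin_space k" for y
      proof (cases "i < k")
        case True
        then have "\<bar>radial y i\<bar> \<le> L2_set (\<lambda>i. \<bar>radial y i\<bar>) {..<k}"
          by (intro member_le_L2_set) auto
        then show ?thesis using L2_radial[OF y] by (simp add: L2_set_def)
      next
        case False
        then show ?thesis using y gauge_nonneg[OF y] by (simp add: radial_def fin_space_def)
      qed
      moreover have "(gauge \<longlongrightarrow> 0) (at x within fin_space k)"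
      proof -
        have "(gauge \<longlongrightarrow> gauge x) (at x within fin_space k)"
          using continuous_on_gauge x unfolding continuous_on_def by blast
        then show ?thesis unfolding True gauge_0 .
      qed
      ultimately have "((\<lambda>x. radial x i) \<longlongrightarrow> 0) (at x within fin_space k)"
        by (intro Lim_null_comparison[of "\<lambda>x. radial x i" gauge])
          (simp_all add: eventually_at_filter)
      then show ?thesis using True by (simp add: radial_def)
    next
      case False
      then have "L2_set x {..<k} \<noteq> 0" using L2_eq_0[OF x] by simp
      then show ?thesis
        unfolding radial_def using continuous_on_gauge x continuous_on_L2[of "fin_space k"]
          continuous_on_coordinate[of "fin_space k" i]
        by (intro tendsto_intros) (auto simp: continuous_on_def)
    qed
  qed
qed

lemma homeomorphic_ball: "top_of_set K homeomorphic_space closed_unit_ball k"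
proof -
  let ?B = "{x \<in> fin_space k. (\<Sum>i<k. (x i)\<^sup>2) \<le> 1}"
  have B: "x \<in> ?B \<longleftrightarrow> x \<in> fin_space k \<and> L2_set x {..<k} \<le> 1" for x
    unfolding L2_set_def by simp
  have KR: "x \<in> K \<Longrightarrow> x \<in> fin_space k" for x using K(1) by blast
  have K1: "x \<in> K \<longleftrightarrow> gauge x \<le> 1" if "x \<in> fin_space k" for x
    using gauge_le_iff[OF that, of 1] by simp
  have rad: "radial x \<in> fin_space k" if "x \<in> fin_space k" for x
    unfolding radial_def by (rule scale_fin_space[OF that])
  have "radial ` K = ?B"
  proof
    show "radial ` K \<subseteq> ?B"
    proof (intro image_subsetI B[THEN iffD2] conjI)
      fix x assume x: "x \<in> K"
      show "radial x \<in> fin_space k" using rad KR[OF x] by blast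
      show "L2_set (radial x) {..<k} \<le> 1" using L2_radial[OF KR[OF x]] K1[OF KR[OF x]] x by simp
    qed
    show "?B \<subseteq> radial ` K"
    proof
      fix z assume "z \<in> ?B"
      then have z: "z \<in> fin_space k" "L2_set z {..<k} \<le> 1" using B by auto
      show "z \<in> radial ` K"
      proof (cases "z = (\<lambda>_. 0)")
        case True
        then have "radial z = z" by (simp add: radial_def)
        then show ?thesis using True zero_in_U UK by (metis image_eqI subsetD)
      next
        case False
        define N where "N = L2_set z {..<k}"
        have N: "N > 0" using L2_eq_0[OF z(1)] False L2_set_nonneg[of z "{..<k}"] unfolding N_def by linarith
        have g: "gauge z > 0" using gauge_eq_0_imp[OF z(1)] gauge_nonneg[OF z(1)] False by force
        \<comment> \<open>The point on the ray of z whose gauge is the norm of z.\<close>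
        define x where "x = (\<lambda>i. N / gauge z * z i)"
        have x: "x \<in> fin_space k" unfolding x_def by (rule scale_fin_space[OF z(1)])
        have gx: "gauge x = N"
          unfolding x_def using gauge_scale[OF z(1), of "N / gauge z"] N g by simp
        have Nx: "L2_set x {..<k} = N / gauge z * N"
          unfolding x_def L2_scale using N g by (simp add: N_def)
        have "x \<in> K" using K1[OF x] gx z(2) N_def by simp
        moreover have "radial x = z"
          unfolding radial_def gx Nx unfolding x_def using N g by simp
        ultimately show ?thesis by blast
      qed
    qed
  qed
  moreover have "inj_on radial K"
  proof (rule inj_onI)
    fix x y assume xy: "x \<in> K" "y \<in> K" and eq: "radial x = radial y"
    have R: "x \<in> fin_space k" "y \<in> fin_space k" using xy KR by auto
    have gg: "gauge x = gauge y" using L2_radial[OF R(1)] L2_radial[OF R(2)] eq by simp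
    show "x = y"
    proof (cases "gauge x = 0")
      case True
      then show ?thesis using gauge_eq_0_imp[OF R(1)] gauge_eq_0_imp[OF R(2)] gg by simp
    next
      case False
      then have nz: "x \<noteq> (\<lambda>_. 0)" "y \<noteq> (\<lambda>_. 0)" using gauge_0 gg by auto
      define a where "a = L2_set x {..<k}"
      define b where "b = L2_set y {..<k}"
      have ab: "a > 0" "b > 0"
        using L2_eq_0[OF R(1)] L2_eq_0[OF R(2)] nz L2_set_nonneg[of x "{..<k}"] L2_set_nonneg[of y "{..<k}"]
        unfolding a_def b_def by linarith+
      have y: "y = (\<lambda>i. b / a * x i)"
      proof
        fix i
        have "gauge x / a * x i = gauge x / b * y i"
          using fun_cong[OF eq, of i] gg unfolding radial_def a_def b_def by simp
        then show "y i = b / a * x i" using False ab by (simp add: field_simps)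
      qed
      then have "gauge x = b / a * gauge x"
        using gauge_scale[OF R(1), of "b / a"] ab gg by simp
      then have "b / a = 1" using False by (metis mult_cancel_right1)
      then show ?thesis using y by simp
    qed
  qed
  moreover have "continuous_on K radial"
    using continuous_on_radial K(1) continuous_on_subset by blast
  ultimately have "homeomorphic_map (top_of_set K) (top_of_set ?B) radial"
    using K(2) by (intro continuous_imp_homeomorphic_map) (auto simp: compact_space_subtopology Hausdorff_space_subtopology)
  then show ?thesis
    unfolding closed_unit_ball_eq by (rule homeomorphic_map_imp_homeomorphic_space)
qed

end

text \<open>The odd extension of the power: the sign of t times the a-th power of |t|. As a
  difference of two powers it is visibly continuous.\<close>

definition signed_powr :: "real \<Rightarrow> real \<Rightarrow> real" where
  "signed_powr a t = max t 0 powr a - max (- t) 0 powr a"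

lemma continuous_on_signed_powr:
  assumes "a > 0" "continuous_on S f"
  shows "continuous_on S (\<lambda>x. signed_powr a (f x))"
  unfolding signed_powr_def using assms
  by (intro continuous_intros continuous_on_powr') auto

lemma signed_powr_inverse: "a > 0 \<Longrightarrow> signed_powr (1 / a) (signed_powr a t) = t"
  unfolding signed_powr_def
  by (cases "t \<ge> 0") (auto simp: max_def powr_powr)

lemma signed_powr_0: "signed_powr a 0 = 0"
  by (simp add: signed_powr_def)

lemma signed_powr_scale:
  assumes "c > 0"
  shows "signed_powr a (c * t) = c powr a * signed_powr a t"
proof -
  have "max (c * t) 0 = c * max t 0" "max (- (c * t)) 0 = c * max (- t) 0"
    using assms by (auto simp: max_def mult_le_0_iff zero_le_mult_iff)
  then show ?thesis
    unfolding signed_powr_def using assms by (simp add: powr_mult algebra_simps)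
qed

text \<open>The substitution by signed powers turns the flow into uniform scaling.\<close>

lemma contractive_diagonal_flow_ball:
  fixes \<kappa> :: "nat \<Rightarrow> real"
  assumes \<kappa>: "\<And>i. i < k \<Longrightarrow> 0 < \<kappa> i"
    and K: "K \<subseteq> fin_space k" "compact K" "K \<noteq> {}" and UK: "U \<subseteq> K"
    and U: "openin (top_of_set (fin_space k)) U" "(\<lambda>_. 0) \<in> U"
    and flow: "\<And>x s. x \<in> K \<Longrightarrow> 0 < s \<Longrightarrow> (\<lambda>i. exp (- \<kappa> i * s) * x i) \<in> U"
  shows "top_of_set K homeomorphic_space closed_unit_ball k"
proof -
  define P where "P x i = (if i < k then signed_powr (1 / \<kappa> i) (x i) else 0)" for x i
  define Q where "Q x i = (if i < k then signed_powr (\<kappa> i) (x i) else 0)" for x i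
  have PR: "P x \<in> fin_space k" and QR: "Q x \<in> fin_space k" for x
    unfolding P_def Q_def fin_space_def by auto
  have QP: "Q (P x) = x" and PQ: "P (Q x) = x" if "x \<in> fin_space k" for x
    using that \<kappa> signed_powr_inverse[of "1 / \<kappa> _"]
    by (auto simp: P_def Q_def fin_space_def fun_eq_iff signed_powr_inverse)
  have cP: "continuous_on S P" for S
  proof (intro continuous_on_coordinatewise_then_product)
    fix i show "continuous_on S (\<lambda>x. P x i)"
      using \<kappa>[of i] by (cases "i < k") (auto simp: P_def intro!: continuous_on_signed_powr continuous_on_coordinate)
  qed
  have cQ: "continuous_on S Q" for S
  proof (intro continuous_on_coordinatewise_then_product)
    fix i show "continuous_on S (\<lambda>x. Q x i)"
      using \<kappa>[of i] by (cases "i < k") (auto simp: Q_def intro!: continuous_on_signed_powr continuous_on_coordinate)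
  qed
  have UR: "U \<subseteq> fin_space k" using UK K by blast
  have "strictly_starlike k (P ` K) (P ` U)"
  proof
    show "P ` K \<subseteq> fin_space k" using PR by blast
    show "compact (P ` K)" by (intro compact_continuous_image cP K)
    show "P ` U \<subseteq> P ` K" using UK by blast
    have "P ` U = {x \<in> topspace (top_of_set (fin_space k)). Q x \<in> U}"
      using PR QP PQ UR by (auto simp: image_iff) (metis subsetD)
    moreover have "openin (top_of_set (fin_space k)) {x \<in> topspace (top_of_set (fin_space k)). Q x \<in> U}"
      using cQ QR U by (intro openin_continuous_map_preimage[of _ "top_of_set (fin_space k)"]) auto
    ultimately show "openin (top_of_set (fin_space k)) (P ` U)" by simp
    show "P ` K \<noteq> {}" using K by blast
    show "(\<lambda>i. t * x i) \<in> P ` U" if x: "x \<in> P ` K" and t: "0 \<le> t" "t < 1" for x t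
    proof (cases "t = 0")
      \<comment> \<open>Scaling by 0 would take the flow infinite time, so this case rests on
        \<open>U(2)\<close>.\<close>
      case True
      have "P (\<lambda>_. 0) = (\<lambda>_. 0)" unfolding P_def by (simp add: signed_powr_0 fun_eq_iff)
      then have "(\<lambda>i. t * x i) = P (\<lambda>_. 0)" using True by simp
      then show ?thesis using U(2) by (simp only: image_eqI)
    next
      case False
      obtain y where y: "y \<in> K" "x = P y" using x by blast
      \<comment> \<open>In time s the flow multiplies coordinate i by
        \<open>exp (- \<kappa> i * s)\<close>, which the power \<open>1 / \<kappa> i\<close> turns
        into exp (- s) = t for every i.\<close>
      define s where "s = - ln t"
      have s: "s > 0" "exp (- s) = t" unfolding s_def using t False by auto
      have "P (\<lambda>i. exp (- \<kappa> i * s) * y i) = (\<lambda>i. t * x i)"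
      proof
        fix i
        show "P (\<lambda>i. exp (- \<kappa> i * s) * y i) i = t * x i"
        proof (cases "i < k")
          case True
          then have "exp (- \<kappa> i * s) powr (1 / \<kappa> i) = t"
            using \<kappa>[OF True] s by (simp add: powr_def)
          then show ?thesis using True by (simp add: P_def y signed_powr_scale)
        qed (simp add: P_def y)
      qed
      then show ?thesis using imageI[OF flow[OF y(1) s(1)], of P] by simp
    qed
  qed
  then have ball: "top_of_set (P ` K) homeomorphic_space closed_unit_ball k"
    by (rule strictly_starlike.homeomorphic_ball)
  have hP: "homeomorphic_map (top_of_set K) (top_of_set (P ` K)) P"
  proof -
    have "inj_on P K" by (rule inj_on_inverseI[of _ Q]) (use QP K in auto)
    then show ?thesis
      using K cP by (intro continuous_imp_homeomorphic_map)
        (auto simp: compact_space_subtopology Hausdorff_space_subtopology)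
  qed
  show ?thesis
    by (rule homeomorphic_space_trans[OF homeomorphic_map_imp_homeomorphic_space[OF hP] ball])
qed

section \<open>Coordinates with respect to an eigenbasis\<close>

definition exclusion_matrix :: "nat \<Rightarrow> nat set \<Rightarrow> nat set \<Rightarrow> real" where
  "exclusion_matrix n B C =
     (\<Sum>a<n. \<Sum>b<n. (if swap_image a b B = C then 1 else 0) - (if B = C then 1 else 0))"

lemma swap_image_involutory: "swap_image a b (swap_image a b B) = B"
  by (simp add: image_image)

lemma sym_on_exclusion_matrix: "sym_on I (exclusion_matrix n)"
proof -
  have "swap_image a b B = C \<longleftrightarrow> swap_image a b C = B" for a b B C
    using swap_image_involutory by blast
  then have "exclusion_matrix n B C = exclusion_matrix n C B" for B C
    unfolding exclusion_matrix_def by (intro sum.cong refl arg_cong2[of _ _ _ _ "(-)"]) auto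
  then show ?thesis unfolding sym_on_def by blast
qed

lemma exclusion_matrix_row:
  assumes B: "B \<in> ksubsets n d"
  shows "(\<Sum>C\<in>ksubsets n d. exclusion_matrix n B C * c C) = exclusion n c B"
proof -
  have "(\<Sum>C\<in>ksubsets n d. exclusion_matrix n B C * c C)
      = (\<Sum>C\<in>ksubsets n d. \<Sum>a<n. \<Sum>b<n. (if swap_image a b B = C then c C else 0) - (if B = C then c C else 0))"
    unfolding exclusion_matrix_def sum_distrib_right by (intro sum.cong refl) auto
  also have "\<dots> = (\<Sum>a<n. \<Sum>C\<in>ksubsets n d. \<Sum>b<n. (if swap_image a b B = C then c C else 0) - (if B = C then c C else 0))"
    by (rule sum.swap)
  also have "\<dots> = (\<Sum>a<n. \<Sum>b<n. \<Sum>C\<in>ksubsets n d. (if swap_image a b B = C then c C else 0) - (if B = C then c C else 0))"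
    by (intro sum.cong refl sum.swap)
  also have "\<dots> = exclusion n c B"
    unfolding exclusion_def using B swap_image_ksubsets[OF _ _ B]
    by (intro sum.cong refl) (simp add: sum_subtractf finite_ksubsets)
  finally show ?thesis .
qed

text \<open>Each swap permutes the d-subsets, so the two pure squares have the same sum and the
  squared difference reduces to a mixed term.\<close>

lemma exclusion_dirichlet:
  "bform (ksubsets n d) (exclusion_matrix n) x x
     = - (\<Sum>a<n. \<Sum>b<n. \<Sum>B\<in>ksubsets n d. (x (swap_image a b B) - x B)\<^sup>2) / 2"
proof -
  let ?S = "ksubsets n d"
  have sq: "(\<Sum>B\<in>?S. (x (swap_image a b B) - x B)\<^sup>2)
      = - 2 * (\<Sum>B\<in>?S. x B * (x (swap_image a b B) - x B))" if ab: "a < n" "b < n" for a b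
  proof -
    have bij: "bij_betw (swap_image a b) ?S ?S"
      using swap_image_ksubsets[OF ab] swap_image_involutory
      by (intro bij_betwI[of _ _ _ "swap_image a b"]) auto
    have "(\<Sum>B\<in>?S. (x (swap_image a b B))\<^sup>2) = (\<Sum>B\<in>?S. (x B)\<^sup>2)"
      by (rule sum.reindex_bij_betw[OF bij])
    moreover have "(\<Sum>B\<in>?S. (x (swap_image a b B) - x B)\<^sup>2)
        = (\<Sum>B\<in>?S. (x (swap_image a b B))\<^sup>2) + (\<Sum>B\<in>?S. (x B)\<^sup>2) - 2 * (\<Sum>B\<in>?S. x B * x (swap_image a b B))"
      by (simp add: power2_diff sum.distrib sum_subtractf sum_distrib_left mult_ac)
    moreover have "(\<Sum>B\<in>?S. x B * (x (swap_image a b B) - x B))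
        = (\<Sum>B\<in>?S. x B * x (swap_image a b B)) - (\<Sum>B\<in>?S. (x B)\<^sup>2)"
      by (simp add: right_diff_distrib sum_subtractf power2_eq_square)
    ultimately show ?thesis by simp
  qed
  have "bform ?S (exclusion_matrix n) x x = (\<Sum>B\<in>?S. \<Sum>a<n. \<Sum>b<n. x B * (x (swap_image a b B) - x B))"
    unfolding bform_rows using exclusion_matrix_row[of _ n d x]
    by (intro sum.cong refl) (simp add: exclusion_def sum_distrib_left)
  also have "\<dots> = (\<Sum>a<n. \<Sum>B\<in>?S. \<Sum>b<n. x B * (x (swap_image a b B) - x B))"
    by (rule sum.swap)
  also have "\<dots> = (\<Sum>a<n. \<Sum>b<n. \<Sum>B\<in>?S. x B * (x (swap_image a b B) - x B))"
    by (intro sum.cong refl sum.swap)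
  also have "\<dots> = (\<Sum>a<n. \<Sum>b<n. - (\<Sum>B\<in>?S. (x (swap_image a b B) - x B)\<^sup>2) / 2)"
    using sq by (intro sum.cong refl) simp
  also have "\<dots> = - (\<Sum>a<n. \<Sum>b<n. \<Sum>B\<in>?S. (x (swap_image a b B) - x B)\<^sup>2) / 2"
    by (simp add: sum_negf sum_divide_distrib)
  finally show ?thesis .
qed

text \<open>If the Dirichlet form is 0, then x is invariant under all swaps, hence constant by
  connectedness, and a constant with zero sum is 0.\<close>

lemma exclusion_spectral_gap:
  assumes x: "sum x (ksubsets n d) = 0" and nz: "\<exists>B\<in>ksubsets n d. x B \<noteq> 0"
  shows "bform (ksubsets n d) (exclusion_matrix n) x x < 0"
proof (rule ccontr)
  assume "\<not> ?thesis"
  moreover have nn: "0 \<le> (\<Sum>b<n. \<Sum>B\<in>ksubsets n d. (x (swap_image a b B) - x B)\<^sup>2)" for a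
    by (intro sum_nonneg) auto
  ultimately have "(\<Sum>a<n. \<Sum>b<n. \<Sum>B\<in>ksubsets n d. (x (swap_image a b B) - x B)\<^sup>2) = 0"
    unfolding exclusion_dirichlet by (intro antisym sum_nonneg) auto
  then have "(x (swap_image a b B) - x B)\<^sup>2 = 0" if "a < n" "b < n" "B \<in> ksubsets n d" for a b B
    using that nn by (simp add: sum_nonneg_eq_0_iff sum_nonneg finite_ksubsets)
  then have inv: "x (swap_image a b B) = x B" if "a < n" "b < n" "B \<in> ksubsets n d" for a b B
    using that by simp
  obtain B0 where B0: "B0 \<in> ksubsets n d" "x B0 \<noteq> 0" using nz by blast
  have "x B = x B0" if "B \<in> ksubsets n d" for B
  proof (rule ksubsets_swap_induct[OF that B0(1), of "\<lambda>B. x B = x B0"])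
    show "x B = x B0" if "B \<in> ksubsets n d" "a < n" "b < n" "x (swap_image a b B) = x B0" for B a b
      using inv[OF that(2,3,1)] that(4) by simp
  qed simp
  then have "sum x (ksubsets n d) = real (card (ksubsets n d)) * x B0" by simp
  then show False using x B0 finite_ksubsets[of n d] by (auto simp: card_eq_0_iff)
qed

section \<open>Scaling, and the elementary symmetric polynomial as an interior point\<close>

lemma strict_Lor_cong:
  assumes "\<And>B. B \<in> ksubsets n d \<Longrightarrow> c B = c' B"
  shows "strict_Lor {..<n} d c \<longleftrightarrow> strict_Lor {..<n} d c'"
proof -
  have "hyperbolic ({..<n} - A) (link_form c A) (\<lambda>_. 1) \<longleftrightarrow> hyperbolic ({..<n} - A) (link_form c' A) (\<lambda>_. 1)"
    if A: "A \<subseteq> {..<n}" "card A + 2 = d" for A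
  proof (rule hyperbolic_cong)
    fix i j assume "i \<in> {..<n} - A" "j \<in> {..<n} - A"
    then have "insert i (insert j A) \<in> ksubsets n d" if "i \<noteq> j"
      using that A finite_subset[OF A(1)] by (auto simp: ksubsets_def)
    then show "link_form c A i j = link_form c' A i j"
      using assms by (auto simp: link_form_def)
  qed
  then show ?thesis unfolding strict_Lor_def using assms by (auto simp: ksubsets_def)
qed

lemma strict_Lor_scale:
  assumes c: "strict_Lor E d c" and t: "t > 0"
  shows "strict_Lor E d (\<lambda>B. t * c B)"
  unfolding strict_Lor_def
proof (intro conjI allI impI)
  show "0 < t * c B" if "B \<subseteq> E" "card B = d" for B using strict_Lor_pos[OF c that] t by simp
  fix A assume A: "A \<subseteq> E" "card A + 2 = d"
  have eq: "bform (E - A) (link_form (\<lambda>B. t * c B) A) x y = t * bform (E - A) (link_form c A) x y" for x y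
    unfolding bform_def sum_distrib_left by (intro sum.cong refl) (simp add: link_form_def)
  show "hyperbolic (E - A) (link_form (\<lambda>B. t * c B) A) (\<lambda>_. 1)"
    using strict_Lor_hyperbolic[OF c A] t unfolding hyperbolic_def eq by (simp add: mult_less_0_iff)
qed

text \<open>The form is t times (sum x)(sum y) - x.y. Orthogonality to the all-ones vector forces
  sum x = 0, as at least two indices remain, and only - x.x is left. Equal coefficients will be the
  origin of the coordinates.\<close>

lemma strict_Lor_const:
  assumes d: "d \<le> n" and t: "t > 0"
  shows "strict_Lor {..<n} d (\<lambda>_. t)"
  unfolding strict_Lor_def
proof (intro conjI allI impI)
  show "0 < t" by (rule t)
  fix A assume A: "A \<subseteq> {..<n}" "card A + 2 = d"
  let ?I = "{..<n} - A"
  have form: "bform ?I (link_form (\<lambda>_. t) A) x y = t * (sum x ?I * sum y ?I - (\<Sum>i\<in>?I. x i * y i))" for x y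
  proof -
    have "bform ?I (link_form (\<lambda>_. t) A) x y
        = (\<Sum>i\<in>?I. \<Sum>j\<in>?I. t * (x i * y j) - (if j = i then t * (x i * y i) else 0))"
      unfolding bform_def by (intro sum.cong refl) (auto simp: link_form_def)
    then show ?thesis
      unfolding sum_product by (simp add: sum_subtractf sum_distrib_left right_diff_distrib)
  qed
  have "card ?I = n - card A" using A finite_subset[OF A(1)] by (simp add: card_Diff_subset)
  then have m: "2 \<le> card ?I" using A d by simp
  have pos: "0 < bform ?I (link_form (\<lambda>_. t) A) (\<lambda>_. 1) (\<lambda>_. 1)"
    using m t unfolding form by simp
  show "hyperbolic ?I (link_form (\<lambda>_. t) A) (\<lambda>_. 1)"
    unfolding hyperbolic_def
  proof (intro conjI allI impI pos)
    fix x assume nz: "\<exists>i\<in>?I. x i \<noteq> 0" and 0: "bform ?I (link_form (\<lambda>_. t) A) (\<lambda>_. 1) x = 0"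
    have "(real (card ?I) - 1) * sum x ?I = 0"
      using 0 t unfolding form by (simp add: left_diff_distrib)
    then have s: "sum x ?I = 0" using m by (simp only: mult_eq_0_iff) linarith
    obtain i where i: "i \<in> ?I" "x i \<noteq> 0" using nz by blast
    have "0 < (\<Sum>i\<in>?I. x i * x i)"
      by (rule sum_pos2[OF _ i(1)]) (use i in \<open>auto simp: zero_less_mult_iff linorder_neq_iff\<close>)
    then show "bform ?I (link_form (\<lambda>_. t) A) x x < 0" using t unfolding form s by simp
  qed
qed

section \<open>Multiaffine polynomials from their coefficients, and the coefficient topology\<close>

lemma lookup_multiaffine_poly_set:
  assumes "B \<in> ksubsets n d"
  shows "Poly_Mapping.lookup (multiaffine_poly d n c) (mono_of_set B) = c B"
proof -
  have "finite B" using assms finite_subset unfolding ksubsets_def by blast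
  then show ?thesis
    using assms unfolding lookup_multiaffine_poly ksubsets_def by (auto simp: keys_mono_of_set)
qed

lemma eval_multiaffine_poly:
  "eval_mpoly (multiaffine_poly d n c) (\<lambda>_. 1) = sum c (ksubsets n d)"
proof -
  have inj: "inj_on mono_of_set (ksubsets n d)"
    using mono_of_set_inj finite_subset[of _ "{..<n}"] by (intro inj_onI) (auto simp: ksubsets_def)
  have "eval_mpoly (multiaffine_poly d n c) (\<lambda>_. 1)
      = (\<Sum>m\<in>monomials d n. Poly_Mapping.lookup (multiaffine_poly d n c) m)"
    by (simp add: eval_mpoly_homogeneous[OF multiaffine_poly_homogeneous])
  also have "\<dots> = (\<Sum>m\<in>mono_of_set ` ksubsets n d. Poly_Mapping.lookup (multiaffine_poly d n c) m)"
  proof (rule sum.mono_neutral_right[OF finite_monomials])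
    show "mono_of_set ` ksubsets n d \<subseteq> monomials d n"
      using mono_of_set_in_monomials by (auto simp: ksubsets_def)
    show "\<forall>m\<in>monomials d n - mono_of_set ` ksubsets n d. Poly_Mapping.lookup (multiaffine_poly d n c) m = 0"
      by (auto simp: lookup_multiaffine_poly ksubsets_def)
  qed
  also have "\<dots> = sum c (ksubsets n d)"
    unfolding sum.reindex[OF inj] by (simp add: lookup_multiaffine_poly_set)
  finally show ?thesis .
qed

lemma multiaffine_multiaffine_poly: "multiaffine (multiaffine_poly d n c)"
  unfolding multiaffine_def
proof (intro ballI allI)
  fix m i assume "m \<in> Poly_Mapping.keys (multiaffine_poly d n c)"
  then obtain B where "B \<subseteq> {..<n}" "m = mono_of_set B"
    by (auto simp: in_keys_iff lookup_multiaffine_poly split: if_splits)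
  then show "Poly_Mapping.lookup m i \<le> 1"
    using finite_subset[of B "{..<n}"] by (auto simp: lookup_mono_of_set)
qed

lemma multiaffine_eq_multiaffine_poly:
  assumes f: "f \<in> homogeneous d n" "multiaffine f"
  shows "f = multiaffine_poly d n (\<lambda>B. Poly_Mapping.lookup f (mono_of_set B))"
proof (rule poly_mapping_eqI)
  fix m
  show "Poly_Mapping.lookup f m =
      Poly_Mapping.lookup (multiaffine_poly d n (\<lambda>B. Poly_Mapping.lookup f (mono_of_set B))) m"
  proof (cases "\<exists>B. B \<subseteq> {..<n} \<and> card B = d \<and> m = mono_of_set B")
    case True
    then obtain B where B: "B \<in> ksubsets n d" "m = mono_of_set B" by (auto simp: ksubsets_def)
    then show ?thesis by (simp add: lookup_multiaffine_poly_set)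
  next
    case False
    have "Poly_Mapping.lookup f m = 0"
    proof (rule ccontr)
      assume nz: "Poly_Mapping.lookup f m \<noteq> 0"
      then have m: "m \<in> monomials d n" by (rule homogeneousD[OF f(1)])
      have eq: "m = mono_of_set (Poly_Mapping.keys m)"
        using f(2) nz by (intro multiaffine_monomial) (auto simp: multiaffine_def in_keys_iff)
      have "Poly_Mapping.keys m \<subseteq> {..<n}" using m by (simp add: monomials_def)
      then show False using False eq m mono_of_set_in_monomials by metis
    qed
    then show ?thesis
      by (subst lookup_multiaffine_poly) (simp only: if_not_P[OF False])
  qed
qed

lemma continuous_map_into_coeff_topology:
  assumes "\<And>m. continuous_map X euclideanreal (\<lambda>x. Poly_Mapping.lookup (f x) m)"
  shows "continuous_map X coeff_topology f"
  unfolding coeff_topology_def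
  by (rule continuous_map_pullback') (use assms in \<open>auto simp: continuous_map_componentwise_UNIV o_def\<close>)

lemma continuous_map_lookup: "continuous_map coeff_topology euclideanreal (\<lambda>f. Poly_Mapping.lookup f m)"
proof -
  have "continuous_map (powertop_real UNIV) euclideanreal (\<lambda>x. x m)"
    by (rule continuous_map_product_projection) simp
  then have "continuous_map coeff_topology euclideanreal ((\<lambda>x. x m) \<circ> Poly_Mapping.lookup)"
    unfolding coeff_topology_def by (rule continuous_map_pullback)
  then show ?thesis by (simp add: o_def)
qed

lemma tendsto_fun_componentwise:
  fixes f :: "'c \<Rightarrow> 'a \<Rightarrow> 'b :: topological_space"
  shows "(f \<longlongrightarrow> l) F \<longleftrightarrow> (\<forall>i. ((\<lambda>x. f x i) \<longlongrightarrow> l i) F)"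
  using limitin_componentwise[of "\<lambda>_. euclidean" UNIV f l F]
  by (simp add: euclidean_product_topology)

text \<open>The eigenvalues carry a minus sign so that the numbers \<kappa> are the decay rates of
  the flow.\<close>

locale exclusion_eigenbasis =
  fixes n d m :: nat and \<phi> :: "nat \<Rightarrow> nat set \<Rightarrow> real" and \<kappa> :: "nat \<Rightarrow> real"
  assumes d: "d \<le> n"
    and eb: "eigenbasis (ksubsets n d) (exclusion_matrix n) (\<lambda>_. 1) m \<phi> (\<lambda>k. - \<kappa> k)"
begin

abbreviation "S \<equiv> ksubsets n d"

lemma ones: "k < m \<Longrightarrow> sum (\<phi> k) S = 0"
  using eigenbasisD(1)[OF eb] by simp

lemmas orth = eigenbasisD(2)[OF eb]
  and eigen = eigenbasisD(3)[OF eb]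

lemma S_ne: "{..<d} \<in> S" using d by (auto simp: ksubsets_def)

lemma card_S: "0 < card S"
  using S_ne finite_ksubsets card_gt_0_iff by blast

lemma \<kappa>_pos:
  assumes k: "k < m"
  shows "0 < \<kappa> k"
proof -
  have "\<exists>B\<in>S. \<phi> k B \<noteq> 0"
  proof (rule ccontr)
    assume "\<not> ?thesis"
    then have "(\<Sum>B\<in>S. \<phi> k B * \<phi> k B) = 0" by (intro sum.neutral) auto
    then show False using orth[OF k k] by simp
  qed
  then have "bform S (exclusion_matrix n) (\<phi> k) (\<phi> k) < 0"
    by (rule exclusion_spectral_gap[OF ones[OF k]])
  then show ?thesis
    using bform_eigenvector[OF eigen[OF k], of "\<phi> k"] orth[OF k k] by simp
qed

text \<open>The origin stands for equal coefficients of sum 1, a fixed point of the flow; the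
  zero-sum eigenvectors do not change the sum.\<close>

definition coefs :: "(nat \<Rightarrow> real) \<Rightarrow> nat set \<Rightarrow> real" where
  "coefs y B = 1 / card S + (\<Sum>k<m. y k * \<phi> k B)"

definition coords :: "(nat set \<Rightarrow> real) \<Rightarrow> nat \<Rightarrow> real" where
  "coords c k = (if k < m then \<Sum>B\<in>S. \<phi> k B * c B else 0)"

definition flow :: "real \<Rightarrow> (nat \<Rightarrow> real) \<Rightarrow> nat \<Rightarrow> real" where
  "flow s y k = exp (- \<kappa> k * s) * y k"

definition U :: "(nat \<Rightarrow> real) set" where
  "U = {y \<in> fin_space m. strict_Lor {..<n} d (coefs y)}"

lemma coords_fin_space: "coords c \<in> fin_space m"
  unfolding coords_def fin_space_def by simp

lemma sum_coefs: "sum (coefs y) S = 1"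
proof -
  have "(\<Sum>B\<in>S. \<Sum>k<m. y k * \<phi> k B) = (\<Sum>k<m. y k * sum (\<phi> k) S)"
    by (subst sum.swap) (simp add: sum_distrib_left)
  then show ?thesis
    using ones card_S unfolding coefs_def by (simp add: sum.distrib)
qed

lemma coords_coefs:
  assumes "y \<in> fin_space m"
  shows "coords (coefs y) = y"
proof
  fix k
  show "coords (coefs y) k = y k"
  proof (cases "k < m")
    case True
    have "(\<Sum>B\<in>S. \<phi> k B * coefs y B)
        = (1 / card S) * sum (\<phi> k) S + (\<Sum>B\<in>S. \<Sum>l<m. y l * (\<phi> k B * \<phi> l B))"
      unfolding coefs_def by (simp add: algebra_simps sum.distrib sum_distrib_left sum_divide_distrib)
    also have "(\<Sum>B\<in>S. \<Sum>l<m. y l * (\<phi> k B * \<phi> l B)) = (\<Sum>l<m. y l * (\<Sum>B\<in>S. \<phi> k B * \<phi> l B))"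
      by (subst sum.swap) (simp add: sum_distrib_left)
    also have "\<dots> = y k"
      using orth True by (simp add: if_distrib[of "\<lambda>t. _ * t"] cong: if_cong)
    finally show ?thesis using ones[OF True] True by (simp add: coords_def)
  qed (use assms in \<open>auto simp: coords_def fin_space_def\<close>)
qed

lemma coefs_coords:
  assumes c: "sum c S = 1" and B: "B \<in> S"
  shows "coefs (coords c) B = c B"
proof -
  define x where "x B = c B - 1 / card S" for B
  have x: "sum x S = 0" unfolding x_def using c card_S by (simp add: sum_subtractf)
  have "(\<Sum>C\<in>S. \<phi> k C * x C) = coords c k" if k: "k < m" for k
  proof -
    have "(\<Sum>C\<in>S. \<phi> k C * x C) = (\<Sum>C\<in>S. \<phi> k C * c C) - sum (\<phi> k) S * (1 / card S)"
      unfolding x_def by (simp add: right_diff_distrib sum_subtractf sum_divide_distrib)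
    then show ?thesis using ones[OF k] k by (simp add: coords_def)
  qed
  then have "x B = (\<Sum>k<m. coords c k * \<phi> k B)"
    using eigenbasisD(4)[OF eb, of x B] x B by simp
  then show ?thesis unfolding coefs_def x_def by simp
qed

lemma tendsto_coefs:
  "(\<And>k. ((\<lambda>z. f z k) \<longlongrightarrow> y k) F) \<Longrightarrow> ((\<lambda>z. coefs (f z) B) \<longlongrightarrow> coefs y B) F"
  unfolding coefs_def by (intro tendsto_intros)

lemma exclusion_coefs:
  assumes B: "B \<in> S"
  shows "exclusion n (coefs y) B = (\<Sum>k<m. y k * (- \<kappa> k * \<phi> k B))"
proof -
  have const: "(\<Sum>C\<in>S. exclusion_matrix n B C * (1 / card S)) = 0"
    unfolding exclusion_matrix_row[OF B] by (simp add: exclusion_def)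
  have "exclusion n (coefs y) B = (\<Sum>C\<in>S. exclusion_matrix n B C * (1 / card S))
      + (\<Sum>C\<in>S. \<Sum>k<m. y k * (exclusion_matrix n B C * \<phi> k C))"
    unfolding exclusion_matrix_row[OF B, symmetric] coefs_def
    by (simp add: distrib_left sum.distrib sum_distrib_left mult_ac)
  also have "\<dots> = (\<Sum>k<m. y k * (\<Sum>C\<in>S. exclusion_matrix n B C * \<phi> k C))"
    unfolding const by (subst sum.swap) (simp add: sum_distrib_left)
  also have "\<dots> = (\<Sum>k<m. y k * (- \<kappa> k * \<phi> k B))"
    using eigen B by (intro sum.cong refl) simp
  finally show ?thesis .
qed

lemma exclusion_flow_coefs: "exclusion_flow n d (\<lambda>s. coefs (flow s y))"
proof
  show "d \<le> n" by (rule d)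
  fix B s assume B: "B \<in> S"
  show "((\<lambda>s. coefs (flow s y) B) has_real_derivative exclusion n (coefs (flow s y)) B) (at s)"
    unfolding exclusion_coefs[OF B] coefs_def flow_def
    by (auto intro!: derivative_eq_intros sum.cong simp: sum_distrib_right mult_ac)
qed

lemma flow_0: "flow 0 y = y"
  unfolding flow_def by simp

lemma flow_fin_space: "y \<in> fin_space m \<Longrightarrow> flow s y \<in> fin_space m"
  unfolding flow_def fin_space_def by simp

lemma zero_in_U: "(\<lambda>_. 0) \<in> U"
  using strict_Lor_const[OF d, of "1 / card S"] card_S
  by (simp add: U_def fin_space_def coefs_def[abs_def])

lemma openin_U: "openin (top_of_set (fin_space m)) U"
proof (subst openin_subopen, intro ballI)
  fix y assume y: "y \<in> U"
  have "\<forall>\<^sub>F z in nhds y. strict_Lor {..<n} d (coefs z)"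
  proof (rule strict_Lor_eventually)
    show "strict_Lor {..<n} d (coefs y)" using y by (simp add: U_def)
    have "((\<lambda>z. z) \<longlongrightarrow> y) (nhds y)" by (rule filterlim_ident)
    then show "((\<lambda>z. coefs z B) \<longlongrightarrow> coefs y B) (nhds y)" for B
      unfolding tendsto_fun_componentwise by (intro tendsto_coefs) blast
  qed
  then obtain T where "open T" "y \<in> T" "\<And>z. z \<in> T \<Longrightarrow> strict_Lor {..<n} d (coefs z)"
    unfolding eventually_nhds by blast
  then show "\<exists>T. openin (top_of_set (fin_space m)) T \<and> y \<in> T \<and> T \<subseteq> U"
    using y by (intro exI[of _ "fin_space m \<inter> T"]) (auto simp: U_def openin_open)
qed

lemma closure_U:
  assumes "y \<in> closure U"
  obtains z :: "nat \<Rightarrow> nat \<Rightarrow> real" where "\<And>j. z j \<in> U" "\<And>k. (\<lambda>j. z j k) \<longlonglongrightarrow> y k"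
proof -
  from assms obtain z where "\<And>j. z j \<in> U" "z \<longlonglongrightarrow> y"
    unfolding closure_sequential by blast
  then show ?thesis using that unfolding tendsto_fun_componentwise by blast
qed

lemma closure_U_fin_space: "closure U \<subseteq> fin_space m"
  using closed_fin_space by (intro closure_minimal) (auto simp: U_def)

lemma closure_U_nonneg:
  assumes y: "y \<in> closure U" and B: "B \<in> S"
  shows "0 \<le> coefs y B"
proof -
  obtain z where z: "\<And>j. z j \<in> U" "\<And>k. (\<lambda>j. z j k) \<longlonglongrightarrow> y k" using closure_U[OF y] by blast
  have "0 \<le> coefs (z j) B" for j
    using z(1)[of j] B strict_Lor_pos[of "{..<n}" d "coefs (z j)" B] by (auto simp: U_def ksubsets_def)
  then show ?thesis
    by (intro LIMSEQ_le_const[OF tendsto_coefs[OF z(2)]]) auto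
qed

text \<open>A coordinate pairs nonnegative coefficients of sum 1 with an eigenvector whose entries
  are at most 1 in absolute value, so it is bounded by 1.\<close>

lemma compact_closure_U: "compact (closure U)"
proof -
  have "\<bar>y k\<bar> \<le> 1" if y: "y \<in> closure U" and k: "k < m" for y k
  proof -
    have \<phi>: "\<bar>\<phi> k B\<bar> \<le> 1" if "B \<in> S" for B
    proof -
      have "\<phi> k B * \<phi> k B \<le> (\<Sum>B\<in>S. \<phi> k B * \<phi> k B)"
        using that finite_ksubsets by (intro member_le_sum[of B S "\<lambda>B. \<phi> k B * \<phi> k B"]) auto
      then have "(\<phi> k B)\<^sup>2 \<le> 1" using orth[OF k k] by (simp add: power2_eq_square)
      then show ?thesis by (simp add: abs_square_le_1)
    qed
    have "y \<in> fin_space m" using y closure_U_fin_space by blast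
    from fun_cong[OF coords_coefs[OF this], of k] have "y k = (\<Sum>B\<in>S. \<phi> k B * coefs y B)"
      using k by (simp add: coords_def)
    then have "\<bar>y k\<bar> \<le> (\<Sum>B\<in>S. \<bar>\<phi> k B * coefs y B\<bar>)" by simp
    also have "\<dots> \<le> (\<Sum>B\<in>S. 1 * coefs y B)"
    proof (rule sum_mono)
      fix B assume B: "B \<in> S"
      show "\<bar>\<phi> k B * coefs y B\<bar> \<le> 1 * coefs y B"
        using \<phi>[OF B] closure_U_nonneg[OF y B] unfolding abs_mult by (intro mult_mono) auto
    qed
    also have "\<dots> = 1" using sum_coefs[of y] by simp
    finally show ?thesis .
  qed
  then have "{y. (\<forall>k\<in>{..<m}. \<bar>y k\<bar> \<le> 1) \<and> (\<forall>k. k \<notin> {..<m} \<longrightarrow> y k = 0)} \<inter> closure U = closure U"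
    using closure_U_fin_space by (auto simp: fin_space_def)
  then show ?thesis using compact_Int_closed[OF compact_box[of "{..<m}" 1] closed_closure, of U] by simp
qed

text \<open>Approximations from \<open>U\<close> stay strict along the flow, so the limit flow is
  weakly hyperbolic at all times r \<ge> 0. As the coefficients of y sum to 1, one of them is
  positive, and so all are at time s. Then \<open>flow_strict_Lor_at\<close> excludes
  degeneracy.\<close>

lemma flow_into_U:
  assumes y: "y \<in> closure U" and s: "0 < s"
  shows "flow s y \<in> U"
proof -
  interpret F: exclusion_flow n d "\<lambda>s. coefs (flow s y)" by (rule exclusion_flow_coefs)
  obtain z where z: "\<And>j. z j \<in> U" "\<And>k. (\<lambda>j. z j k) \<longlonglongrightarrow> y k" using closure_U[OF y] by blast
  have strict_Lor_z: "strict_Lor {..<n} d (coefs (flow r (z j)))" if "0 \<le> r" for r j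
    using exclusion_flow.flow_strict_Lor[OF exclusion_flow_coefs[of "z j"] _ that] z(1)[of j]
    by (simp add: flow_0 U_def)
  have lim: "(\<lambda>j. coefs (flow r (z j)) B) \<longlonglongrightarrow> coefs (flow r y) B" for r B
    unfolding flow_def by (intro tendsto_coefs tendsto_intros z(2))
  have weak: "weak_hyperbolic ({..<n} - A) (link_form (coefs (flow r y)) A)"
    if "0 \<le> r" "A \<subseteq> {..<n}" "card A + 2 = d" for r A
  proof (rule weak_hyperbolic_link_limit[OF that(2,3) _ _ lim])
    show "\<forall>\<^sub>F j in sequentially. weak_hyperbolic ({..<n} - A) (link_form (coefs (flow r (z j))) A)"
      using strict_Lor_hyperbolic[OF strict_Lor_z[OF that(1)] that(2,3)] hyperbolic_imp_weak[OF sym_on_link_form]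
      by (intro always_eventually allI) blast
  qed simp
  have "\<exists>B\<in>S. 0 < coefs y B"
  proof (rule ccontr)
    assume "\<not> ?thesis"
    then have "sum (coefs y) S \<le> 0" by (intro sum_nonpos) (auto simp: not_less)
    then show False using sum_coefs[of y] by simp
  qed
  then obtain B0 where B0: "B0 \<in> S" "0 < coefs y B0" by blast
  have pos: "0 < coefs (flow s y) B" if "B \<in> S" for B
  proof (rule F.flow_pos[OF _ B0(1) _ s that])
    show "0 \<le> coefs (flow 0 y) B" if "B \<in> S" for B
      using closure_U_nonneg[OF y that] by (simp add: flow_0)
    show "0 < coefs (flow 0 y) B0" using B0(2) by (simp add: flow_0)
  qed
  \<comment> \<open>The past interval has length s: weak hyperbolicity holds all the way back to
    time 0.\<close>
  have "strict_Lor {..<n} d (coefs (flow s y))"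
    using s pos weak by (intro F.flow_strict_Lor_at[of s]) auto
  then show ?thesis
    unfolding U_def using flow_fin_space closure_U_fin_space y by blast
qed

lemma closure_U_ball: "top_of_set (closure U) homeomorphic_space closed_unit_ball m"
proof (rule contractive_diagonal_flow_ball[of m \<kappa> "closure U" U])
  show "0 < \<kappa> k" if "k < m" for k using that by (rule \<kappa>_pos)
  show "closure U \<noteq> {}" using zero_in_U closure_subset by blast
  show "(\<lambda>k. exp (- \<kappa> k * s) * y k) \<in> U" if "y \<in> closure U" "0 < s" for y s
    using flow_into_U[OF that] by (simp add: flow_def[abs_def])
qed (use closure_U_fin_space compact_closure_U closure_subset openin_U zero_in_U in auto)

section \<open>The homeomorphism between polynomials and coordinates\<close>

definition poly_of :: "(nat \<Rightarrow> real) \<Rightarrow> mpoly" where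
  "poly_of y = multiaffine_poly d n (coefs y)"

definition coords_of :: "mpoly \<Rightarrow> nat \<Rightarrow> real" where
  "coords_of f = coords (\<lambda>B. Poly_Mapping.lookup f (mono_of_set B))"

lemma poly_of_PL:
  assumes y: "y \<in> closure U"
  shows "poly_of y \<in> PL_set d n"
proof -
  obtain z where z: "\<And>j. z j \<in> U" "\<And>k. (\<lambda>j. z j k) \<longlonglongrightarrow> y k" using closure_U[OF y] by blast
  have "Lorentzian d n (poly_of y)"
  proof (rule Lorentzian_limit[of _ d n "\<lambda>j. poly_of (z j)"])
    show "Lorentzian d n (poly_of (z j))" for j
      unfolding poly_of_def using z(1)[of j] d by (intro strict_Lor_imp_Lorentzian) (auto simp: U_def)
    show "(\<lambda>j. Poly_Mapping.lookup (poly_of (z j)) m') \<longlonglongrightarrow> Poly_Mapping.lookup (poly_of y) m'" for m'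
    proof (cases "\<exists>B. B \<subseteq> {..<n} \<and> card B = d \<and> m' = mono_of_set B")
      case True
      show ?thesis
        unfolding poly_of_def lookup_multiaffine_poly if_P[OF True] by (rule tendsto_coefs[OF z(2)])
    next
      case False
      show ?thesis
        unfolding poly_of_def lookup_multiaffine_poly if_not_P[OF False] by (rule tendsto_const)
    qed
  qed (simp add: poly_of_def multiaffine_poly_homogeneous)
  then show ?thesis
    unfolding PL_set_def poly_of_def
    by (simp add: multiaffine_multiaffine_poly eval_multiaffine_poly sum_coefs)
qed

lemma coords_of_poly_of: "y \<in> fin_space m \<Longrightarrow> coords_of (poly_of y) = y"
proof -
  assume y: "y \<in> fin_space m"
  have "coords_of (poly_of y) = coords (coefs y)"
    unfolding coords_of_def coords_def poly_of_def
    by (intro ext) (simp add: lookup_multiaffine_poly_set)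
  then show ?thesis using coords_coefs[OF y] by simp
qed

lemma PL_set_sum:
  assumes "f \<in> PL_set d n"
  shows "f = multiaffine_poly d n (\<lambda>B. Poly_Mapping.lookup f (mono_of_set B))"
    "(\<Sum>B\<in>S. Poly_Mapping.lookup f (mono_of_set B)) = 1"
proof -
  show f: "f = multiaffine_poly d n (\<lambda>B. Poly_Mapping.lookup f (mono_of_set B))"
    using assms by (intro multiaffine_eq_multiaffine_poly) (auto simp: PL_set_def Lorentzian_def)
  have "eval_mpoly f (\<lambda>_. 1) = 1" using assms by (simp add: PL_set_def)
  then show "(\<Sum>B\<in>S. Poly_Mapping.lookup f (mono_of_set B)) = 1"
    using eval_multiaffine_poly[of d n "\<lambda>B. Poly_Mapping.lookup f (mono_of_set B)"] f by simp
qed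

lemma poly_of_coords_of:
  assumes f: "f \<in> PL_set d n"
  shows "poly_of (coords_of f) = f"
proof -
  let ?c = "\<lambda>B. Poly_Mapping.lookup f (mono_of_set B)"
  have "poly_of (coords_of f) = multiaffine_poly d n ?c"
    unfolding poly_of_def coords_of_def multiaffine_poly_def
    using coefs_coords[OF PL_set_sum(2)[OF f]]
    by (intro sum.cong refl) (auto simp: ksubsets_def)
  then show ?thesis using PL_set_sum(1)[OF f] by simp
qed

lemma coords_of_PL:
  assumes f: "f \<in> PL_set d n"
  shows "coords_of f \<in> closure U"
proof -
  define c where "c g B = Poly_Mapping.lookup g (mono_of_set B)" for g :: mpoly and B
  obtain g where g: "\<And>j :: nat. strictly_Lorentzian d n (g j)"
    "\<And>m'. (\<lambda>j. Poly_Mapping.lookup (g j) m') \<longlonglongrightarrow> Poly_Mapping.lookup f m'"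
    using f unfolding PL_set_def Lorentzian_def by auto
  have strict_Lor: "strict_Lor {..<n} d (c (g j))" for j
    unfolding c_def[abs_def] by (rule strictly_Lorentzian_imp_strict_Lor[OF g(1) d])
  have pos: "0 < sum (c (g j)) S" for j
  proof (rule sum_pos[OF finite_ksubsets])
    show "0 < c (g j) B" if "B \<in> S" for B
      using that by (intro strict_Lor_pos[OF strict_Lor]) (auto simp: ksubsets_def)
  qed (use S_ne in auto)
  \<comment> \<open>The strict approximations of f are neither multiaffine nor normalised in
    general. Their squarefree coefficients are rescaled to sum 1; the factors tend to 1, as the sum
    for f is 1.\<close>
  define e where "e j B = inverse (sum (c (g j)) S) * c (g j) B" for j B
  have sum_e: "sum (e j) S = 1" for j
    unfolding e_def sum_distrib_left[symmetric] using pos[of j] by simp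
  have "coords (e j) \<in> U" for j
  proof -
    have "strict_Lor {..<n} d (e j)"
      unfolding e_def[abs_def] using pos[of j] by (intro strict_Lor_scale strict_Lor) simp
    then have "strict_Lor {..<n} d (coefs (coords (e j)))"
      using strict_Lor_cong[of n d "coefs (coords (e j))" "e j"] coefs_coords[OF sum_e] by simp
    then show ?thesis unfolding U_def using coords_fin_space by simp
  qed
  moreover have "(\<lambda>j. coords (e j)) \<longlonglongrightarrow> coords_of f"
    unfolding tendsto_fun_componentwise
  proof
    fix k
    have cl: "(\<lambda>j. c (g j) B) \<longlonglongrightarrow> c f B" for B unfolding c_def by (rule g(2))
    have "sum (c f) S = 1" using PL_set_sum(2)[OF f] by (simp add: c_def)
    moreover have "(\<lambda>j. sum (c (g j)) S) \<longlonglongrightarrow> sum (c f) S" by (intro tendsto_sum cl)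
    ultimately have "(\<lambda>j. inverse (sum (c (g j)) S)) \<longlonglongrightarrow> inverse 1"
      by (intro tendsto_inverse) simp_all
    then have "(\<lambda>j. e j B) \<longlonglongrightarrow> inverse 1 * c f B" for B
      unfolding e_def by (intro tendsto_mult cl)
    then have el: "(\<lambda>j. e j B) \<longlonglongrightarrow> c f B" for B by simp
    show "(\<lambda>j. coords (e j) k) \<longlonglongrightarrow> coords_of f k"
      unfolding coords_def coords_of_def c_def[symmetric]
      by (cases "k < m") (auto intro!: tendsto_intros el)
  qed
  ultimately show ?thesis
    unfolding closure_sequential by (intro exI[of _ "\<lambda>j. coords (e j)"]) simp
qed

lemma PL_space_homeomorphic: "PL_space d n homeomorphic_space top_of_set (closure U)"
  unfolding homeomorphic_space_def
proof (intro exI)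
  show "homeomorphic_maps (PL_space d n) (top_of_set (closure U)) coords_of poly_of"
    unfolding homeomorphic_maps_def
  proof (intro conjI ballI)
    have top: "topspace (PL_space d n) = PL_set d n"
      unfolding PL_space_def coeff_topology_def
      by (simp add: topspace_subtopology topspace_pullback_topology)
    have "continuous_map coeff_topology euclideanreal (\<lambda>f. coords_of f k)" for k
      unfolding coords_of_def coords_def
      by (cases "k < m")
        (auto intro!: continuous_map_sum continuous_map_real_mult continuous_map_lookup finite_ksubsets)
    then have "continuous_map coeff_topology euclidean coords_of"
      unfolding euclidean_product_topology[symmetric] by (simp add: continuous_map_componentwise_UNIV)
    then show "continuous_map (PL_space d n) (top_of_set (closure U)) coords_of"
      unfolding continuous_map_in_subtopology top using coords_of_PL
      by (auto simp: PL_space_def intro: continuous_map_from_subtopology)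
    have "continuous_on (closure U) (\<lambda>y. coefs y B)" for B
      unfolding coefs_def by (intro continuous_intros continuous_on_coordinate)
    then have "continuous_map (top_of_set (closure U)) coeff_topology poly_of"
      by (intro continuous_map_into_coeff_topology)
        (auto simp: poly_of_def lookup_multiaffine_poly)
    then show "continuous_map (top_of_set (closure U)) (PL_space d n) poly_of"
      unfolding PL_space_def continuous_map_in_subtopology using poly_of_PL by auto
    show "poly_of (coords_of f) = f" if "f \<in> topspace (PL_space d n)" for f
      using that poly_of_coords_of top by simp
    show "coords_of (poly_of y) = y" if "y \<in> topspace (top_of_set (closure U))" for y
      using that coords_of_poly_of closure_U_fin_space by auto
  qed
qed

end

theorem theorem3p2:
  fixes d n :: nat
  assumes "d \<le> n"
  shows "\<exists>k. PL_space d n homeomorphic_space closed_unit_ball k"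
proof -
  let ?S = "ksubsets n d"
  \<comment> \<open>Constants are in the kernel of the generator, so the all-ones vector can be
    split off as an eigenvector.\<close>
  have row: "(\<Sum>C\<in>?S. exclusion_matrix n B C * 1) = 0 * 1" if "B \<in> ?S" for B
    using exclusion_matrix_row[OF that, of "\<lambda>_. 1"] by (simp add: exclusion_def)
  obtain m \<phi> \<mu> where "eigenbasis ?S (exclusion_matrix n) (\<lambda>_. 1) m \<phi> \<mu>"
    using spectral_theorem[OF finite_ksubsets sym_on_exclusion_matrix row] by blast
  then interpret exclusion_eigenbasis n d m \<phi> "\<lambda>k. - \<mu> k"
    using assms by unfold_locales simp_all
  show ?thesis
    using homeomorphic_space_trans[OF PL_space_homeomorphic closure_U_ball] by blast
qed

end
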